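(* Let $G$ be an infinite discrete countable group and let $(X,\mu,G)$ be an ergodic $G$-measure preserving system. Let $\mu=\int_X\mu_x\,d\mu(x)$ be the disintegration of $\mu$ over the Kronecker $\sigma$-algebra $\mathcal{K}_\mu(G)$, and let $k_\mu\in\mathbb{N}\cup\{\infty\}$ be such that $|\mathrm{supp}\,\mu_x|=k_\mu$ for $\mu$-a.e. $x$. Then $h^*_\mu(G)=\log k_\mu$.
   Context: $X$ is a compact metric space, $G$ acts by homeomorphisms and $\mu$ is a $G$-invariant ergodic Borel probability measure; $\mathcal{B}_X^\mu$ is the $\mu$-completion of the Borel $\sigma$-algebra. For $g\in G$, $U_gf(x)=f(gx)$ on $L^2(\mu)$. The Kronecker $\sigma$-algebra is $\mathcal{K}_\mu(G)=\{B\in\mathcal{B}_X^\mu:\{U_g1_B:g\in G\}\text{ is precompact in }L^2(\mu)\}$. It is a known fact that for ergodic $\mu$ the cardinality $|\mathrm{supp}\,\mu_x|$ is $\mu$-a.e. equal to a constant $k_\mu\in\mathbb{N}\cup\{\infty\}$. For a finite partition $\alpha$ of $X$ into sets of $\mathcal{B}_X^\mu$ and a sequence $\mathcal{A}=(g_n)$ in $G$, $h_\mu^{\mathcal{A}}(G,\alpha)=\limsup_n\frac1nH_\mu(\bigvee_{i=1}^ng_i^{-1}\alpha)$ with $H_\mu(\beta)=-\sum_{B\in\beta}\mu(B)\log\mu(B)$; $h_\mu^*(G,\alpha)=\sup_{\mathcal{A}}h^{\mathcal{A}}_\mu(G,\alpha)$ over all sequences in $G$, and $h_\mu^*(G)=\sup_\alpha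 h_\mu^*(G,\alpha)$ over all such finite partitions. $\log\infty=\infty$. *)

theory Defs
  imports "HOL-Probability.Probability"
begin

text \<open>Standing setting. X is a type 'a of class metric_space with compact UNIV;
  G is a type 'g of class group_add (not necessarily abelian) acting on the left by
  T :: 'g => 'a => 'a, i.e. T g x = g x.  The measure mu lives on the Borel sets.\<close>

definition meas_action :: "('g::group_add \<Rightarrow> 'a::metric_space \<Rightarrow> 'a) \<Rightarrow> bool" where
  "meas_action T \<longleftrightarrow> T 0 = id \<and> (\<forall>g h. T (g + h) = T g \<circ> T h) \<and>
     (\<forall>g. continuous_on UNIV (T g))"

definition invariant_ergodic ::
    "('g::group_add \<Rightarrow> 'a::metric_space \<Rightarrow> 'a) \<Rightarrow> 'a measure \<Rightarrow> bool" where
  "invariant_ergodic T \<mu> \<longleftrightarrow>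
     prob_space \<mu> \<and> sets \<mu> = sets borel \<and>
     (\<forall>g. \<forall>B\<in>sets borel. emeasure \<mu> (T g -` B) = emeasure \<mu> B) \<and>
     (\<forall>B\<in>sets borel. (\<forall>g. T g -` B = B) \<longrightarrow> measure \<mu> B = 0 \<or> measure \<mu> B = 1)"

text \<open>L2-norm distance of U_g 1_B and U_h 1_B, where (U_g f)(x) = f(g x),
  computed w.r.t. the completion of mu.\<close>
definition L2dist_shift ::
    "('g \<Rightarrow> 'a \<Rightarrow> 'a) \<Rightarrow> 'a measure \<Rightarrow> 'a set \<Rightarrow> 'g \<Rightarrow> 'g \<Rightarrow> real" where
  "L2dist_shift T \<mu> B g h =
     sqrt (\<integral>x. (indicator B (T g x) - indicator B (T h x))\<^sup>2 \<partial>completion \<mu>)"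

text \<open>Kronecker sigma-algebra: sets of the completed sigma-algebra whose orbit
  {U_g 1_B : g} is precompact (= totally bounded, since L2 is complete) in L2(mu).\<close>
definition kronecker_sets ::
    "('g \<Rightarrow> 'a \<Rightarrow> 'a) \<Rightarrow> 'a measure \<Rightarrow> 'a set set" where
  "kronecker_sets T \<mu> = {B \<in> sets (completion \<mu>).
     \<forall>e>0. \<exists>F. finite F \<and> (\<forall>g. \<exists>h\<in>F. L2dist_shift T \<mu> B g h < e)}"

definition kronecker_disintegration ::
    "('g \<Rightarrow> 'a::metric_space \<Rightarrow> 'a) \<Rightarrow> 'a measure \<Rightarrow> ('a \<Rightarrow> 'a measure) \<Rightarrow> bool" where
  "kronecker_disintegration T \<mu> \<nu> \<longleftrightarrow>
     (\<forall>x. prob_space (\<nu> x) \<and> sets (\<nu> x) = sets borel) \<and>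
     (\<forall>B\<in>sets borel.
        (\<lambda>x. measure (\<nu> x) B) \<in> borel_measurable (sigma UNIV (kronecker_sets T \<mu>)) \<and>
        (\<forall>A\<in>kronecker_sets T \<mu>.
           measure (completion \<mu>) (A \<inter> B) = (LINT x:A|completion \<mu>. measure (\<nu> x) B)))"

definition msupp :: "'a::topological_space measure \<Rightarrow> 'a set" where
  "msupp \<nu> = {y. \<forall>U. open U \<and> y \<in> U \<longrightarrow> emeasure \<nu> U > 0}"

definition ecard :: "'a set \<Rightarrow> enat" where
  "ecard S = (if finite S then enat (card S) else \<infinity>)"

definition fin_partition :: "'a measure \<Rightarrow> 'a set set \<Rightarrow> bool" where
  "fin_partition \<mu> \<alpha> \<longleftrightarrow> finite \<alpha> \<and> \<alpha> \<subseteq> sets (completion \<mu>) \<and> \<Union>\<alpha> = UNIV \<and>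
     (\<forall>A\<in>\<alpha>. \<forall>B\<in>\<alpha>. A \<noteq> B \<longrightarrow> A \<inter> B = {})"

definition join_seq :: "('g \<Rightarrow> 'a \<Rightarrow> 'a) \<Rightarrow> 'a set set \<Rightarrow> (nat \<Rightarrow> 'g) \<Rightarrow> nat \<Rightarrow> 'a set set" where
  "join_seq T \<alpha> gs n = {(\<Inter>i\<in>{1..n}. T (gs i) -` c i) | c. \<forall>i\<in>{1..n}. c i \<in> \<alpha>}"

definition entropy_part :: "'a measure \<Rightarrow> 'a set set \<Rightarrow> real" where
  "entropy_part \<mu> \<beta> = - (\<Sum>B\<in>\<beta>. measure (completion \<mu>) B * ln (measure (completion \<mu>) B))"

definition seq_entropy :: "('g \<Rightarrow> 'a \<Rightarrow> 'a) \<Rightarrow> 'a measure \<Rightarrow> (nat \<Rightarrow> 'g) \<Rightarrow> 'a set set \<Rightarrow> ereal" where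
  "seq_entropy T \<mu> gs \<alpha> =
     limsup (\<lambda>n. ereal (entropy_part \<mu> (join_seq T \<alpha> gs n) / real n))"

definition max_seq_entropy_part :: "('g \<Rightarrow> 'a \<Rightarrow> 'a) \<Rightarrow> 'a measure \<Rightarrow> 'a set set \<Rightarrow> ereal" where
  "max_seq_entropy_part T \<mu> \<alpha> = (SUP gs\<in>(UNIV :: (nat \<Rightarrow> 'g) set). seq_entropy T \<mu> gs \<alpha>)"

definition max_seq_entropy :: "('g \<Rightarrow> 'a \<Rightarrow> 'a) \<Rightarrow> 'a measure \<Rightarrow> ereal" where
  "max_seq_entropy T \<mu> = (SUP \<alpha>\<in>{\<alpha>. fin_partition \<mu> \<alpha>}. max_seq_entropy_part T \<mu> \<alpha>)"

definition log_enat :: "enat \<Rightarrow> ereal" where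
  "log_enat k = (case k of enat n \<Rightarrow> ereal (ln (real n)) | \<infinity> \<Rightarrow> \<infinity>)"

end

theory Submission
  imports Defs
begin

text \<open>For a finite partition with indicators \<open>1\<^sub>A\<close> put \<open>u\<^sub>A = E(1\<^sub>A | K)\<close> and \<open>\<eta> p = - p ln p\<close>. The
  supremum over all sequences of the sequence entropy of the partition equals \<open>\<integral> \<Sum>\<^sub>A \<eta>(u\<^sub>A)\<close>. The upper
  bound holds because a partition into Kronecker sets has zero sequence entropy along every sequence
  (its translates take only finitely many values up to a small error), and a partition discretising
  \<open>u\<close> has conditional entropy close to the integral. For the lower bound, \<open>1\<^sub>A - u\<^sub>A\<close> is orthogonal to all
  almost periodic functions, hence some translate of it is almost orthogonal to any finitely many
  given sets; concavity of \<open>\<eta>\<close> then shows that a suitable translate of the partition has conditional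
  entropy almost the integral given any finite partition, and the sequence is built greedily.

  It remains to maximise \<open>\<integral> H(\<nu>\<^sub>x, \<alpha>) d\<mu>\<close> over \<open>\<alpha>\<close>. It is at most \<open>ln k\<close> when \<open>\<nu>\<^sub>x\<close> has \<open>k\<close> support points.
  Conversely, \<open>x \<mapsto> \<nu>\<^sub>x{x}\<close> is invariant by equivariance of \<open>\<nu>\<close>, hence constant almost everywhere by
  ergodicity, and the constant is at most \<open>1/k\<close>; along partitions generating the Borel sets the
  integrals tend to \<open>\<integral> - ln \<nu>\<^sub>x{x} d\<mu>\<close>.\<close>

section \<open>Total boundedness of orbits and the Kronecker algebra\<close>

text \<open>The group need be neither abelian nor amenable, so almost orthogonality of a translate
  cannot be read off from averages along the group. Suppose that no translate of the functions
  \<phi> is almost orthogonal to all of finitely many test functions. Then the sum of the squared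
  correlations stays above some e > 0. This sum is a sum of values of the quadratic form of the
  finite-rank integral operator with kernel \<Sum> \<phi>(gx) \<phi>(gy), and being linear in the
  kernel it stays above e on the convex hull of these kernels. Kernels of almost minimal norm in the
  hull are almost invariant, so their operators almost commute with the action and send test
  functions close to almost periodic ones. Their images are however orthogonal to all almost
  periodic functions, so they tend to 0, a contradiction. Limits are taken only after applying the
  operators to a fixed function, where uniform bounds are available.

  A second difficulty is that cells of a partition lie in the completed \<sigma>-algebra, while
  \<nu> measures Borel sets only: a common Borel null set is removed from all cells.\<close>

definition totbdd :: "('g \<Rightarrow> 'g \<Rightarrow> real) \<Rightarrow> bool" where
  "totbdd d \<longleftrightarrow> (\<forall>e>0. \<exists>P. finite P \<and> \<Union>P = UNIV \<and> (\<forall>S\<in>P. \<forall>g\<in>S. \<forall>h\<in>S. d g h < e))"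

lemma tbdE:
  assumes "totbdd d" "e > 0"
  obtains P where "finite P" "\<Union>P = UNIV" "\<forall>S\<in>P. \<forall>g\<in>S. \<forall>h\<in>S. d g h < e"
  using assms(1)[unfolded totbdd_def, rule_format, OF assms(2)] that by (elim exE conjE) simp

lemma totbdd_approx:
  assumes "\<And>e. e > 0 \<Longrightarrow> \<exists>d' \<delta>. \<delta> > 0 \<and> totbdd d' \<and> (\<forall>g h. d' g h < \<delta> \<longrightarrow> d g h < e)"
  shows "totbdd d"
  unfolding totbdd_def
proof (intro allI impI)
  fix e :: real assume "e > 0"
  then obtain d' \<delta> where d: "\<delta> > 0" "totbdd d'" "\<And>g h. d' g h < \<delta> \<Longrightarrow> d g h < e"
    using assms by blast
  obtain P where "finite P" "\<Union>P = UNIV" "\<forall>S\<in>P. \<forall>g\<in>S. \<forall>h\<in>S. d' g h < \<delta>"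
    by (rule tbdE[OF d(2,1)])
  then show "\<exists>P. finite P \<and> \<Union>P = UNIV \<and> (\<forall>S\<in>P. \<forall>g\<in>S. \<forall>h\<in>S. d g h < e)"
    using d(3) by (intro exI[of _ P]) simp
qed

text \<open>Covers by sets of small diameter, unlike finite nets, can be refined by pairwise
  intersection. No triangle inequality for \<open>d\<close> is involved, and the three functions are
  related by the implication alone.\<close>

lemma totbdd_comb:
  assumes "totbdd d1" "totbdd d2"
    and "\<And>e. e > 0 \<Longrightarrow> \<exists>\<delta>>0. \<forall>g h. d1 g h < \<delta> \<and> d2 g h < \<delta> \<longrightarrow> d g h < e"
  shows "totbdd d"
  unfolding totbdd_def
proof (intro allI impI)
  fix e :: real assume "e > 0"
  then obtain \<delta> where d: "\<delta> > 0" "\<And>g h. d1 g h < \<delta> \<Longrightarrow> d2 g h < \<delta> \<Longrightarrow> d g h < e"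
    using assms(3) by blast
  obtain P where P: "finite P" "\<Union>P = UNIV" "\<forall>S\<in>P. \<forall>g\<in>S. \<forall>h\<in>S. d1 g h < \<delta>"
    by (rule tbdE[OF assms(1) d(1)])
  obtain Q where Q: "finite Q" "\<Union>Q = UNIV" "\<forall>S\<in>Q. \<forall>g\<in>S. \<forall>h\<in>S. d2 g h < \<delta>"
    by (rule tbdE[OF assms(2) d(1)])
  let ?R = "(\<lambda>(A, B). A \<inter> B) ` (P \<times> Q)"
  have "\<Union>?R = \<Union>P \<inter> \<Union>Q" by auto
  moreover have "\<forall>S\<in>?R. \<forall>g\<in>S. \<forall>h\<in>S. d g h < e"
    using P(3) Q(3) d(2) by auto
  ultimately show "\<exists>P. finite P \<and> \<Union>P = UNIV \<and> (\<forall>S\<in>P. \<forall>g\<in>S. \<forall>h\<in>S. d g h < e)"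
    using P(1,2) Q(1,2) by (intro exI[of _ ?R]) simp
qed

lemma totbdd_add:
  assumes "totbdd d1" "totbdd d2" "\<And>g h. d g h \<le> c * (d1 g h + d2 g h)" "c > 0"
  shows "totbdd d"
proof (rule totbdd_comb[OF assms(1,2)])
  fix e :: real assume "e > 0"
  have "d g h < e" if "d1 g h < e / (2 * c)" "d2 g h < e / (2 * c)" for g h
  proof -
    have "c * (d1 g h + d2 g h) < c * (e / (2 * c) + e / (2 * c))"
      by (rule mult_strict_left_mono) (use that assms(4) in auto)
    also have "\<dots> = e" using assms(4) by (simp add: field_simps)
    finally show ?thesis using assms(3)[of g h] by linarith
  qed
  then show "\<exists>\<delta>>0. \<forall>g h. d1 g h < \<delta> \<and> d2 g h < \<delta> \<longrightarrow> d g h < e"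
    using \<open>e > 0\<close> assms(4) by (intro exI[of _ "e / (2 * c)"]) auto
qed

lemma totbdd_zero: "totbdd (\<lambda>g h. 0)"
  unfolding totbdd_def by (auto intro: exI[of _ "{UNIV}"])

lemma totbdd_mono: "totbdd d1 \<Longrightarrow> (\<And>g h. d g h \<le> c * d1 g h) \<Longrightarrow> c > 0 \<Longrightarrow> totbdd d"
  by (rule totbdd_add[OF _ totbdd_zero, of d1 d c]) auto

text \<open>Cells of length \<open>sqrt e\<close> cut the bounded range into finitely many classes,
  and two numbers in one cell have squared difference below \<open>e\<close>. Compactness of
  finite-rank operators will come from here.\<close>

lemma totbdd_bounded_real:
  fixes a :: "'g \<Rightarrow> real"
  assumes "\<And>g. \<bar>a g\<bar> \<le> c"
  shows "totbdd (\<lambda>g h. (a g - a h)\<^sup>2)"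
  unfolding totbdd_def
proof (intro allI impI)
  fix e :: real assume e: "e > 0"
  define r where "r = sqrt e"
  have r: "r > 0" "r\<^sup>2 = e" using e by (auto simp: r_def)
  let ?S = "\<lambda>i::int. {g. \<lfloor>a g / r\<rfloor> = i}"
  have "\<lfloor>a g / r\<rfloor> \<in> {\<lfloor>- c / r\<rfloor>..\<lfloor>c / r\<rfloor>}" for g
    using assms[of g] r divide_right_mono[of "- c" "a g" r] divide_right_mono[of "a g" c r]
    by (auto intro!: floor_mono simp: abs_le_iff)
  then have "range (\<lambda>g. \<lfloor>a g / r\<rfloor>) \<subseteq> {\<lfloor>- c / r\<rfloor>..\<lfloor>c / r\<rfloor>}" by blast
  then have fin: "finite (range (\<lambda>g. \<lfloor>a g / r\<rfloor>))" using finite_subset by blast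
  have "(a g - a h)\<^sup>2 < e" if "\<lfloor>a g / r\<rfloor> = \<lfloor>a h / r\<rfloor>" for g h
  proof -
    have "\<bar>a g / r - a h / r\<bar> < 1" using that by linarith
    then have "\<bar>(a g - a h) / r\<bar> < 1" by (simp add: diff_divide_distrib)
    then have "\<bar>a g - a h\<bar> < r" using r by (simp add: field_simps)
    then have "\<bar>a g - a h\<bar>\<^sup>2 < r\<^sup>2" by (intro power_strict_mono) auto
    then show ?thesis using r by simp
  qed
  then show "\<exists>P. finite P \<and> \<Union>P = UNIV \<and> (\<forall>S\<in>P. \<forall>g\<in>S. \<forall>h\<in>S. (a g - a h)\<^sup>2 < e)"
    by (intro exI[of _ "?S ` range (\<lambda>g. \<lfloor>a g / r\<rfloor>)"] conjI finite_imageI fin) auto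
qed

text \<open>Links covers to the finite nets by which the Kronecker sets are defined. The factor 2 in
  the triangle inequality is the price of working with squared \<open>L2\<close> distances.\<close>

lemma totbdd_iff_net:
  assumes nn: "\<And>g h. d g h \<ge> 0" and sym: "\<And>g h. d g h = d h g"
    and tri: "\<And>g h k. d g k \<le> 2 * (d g h + d h k)"
  shows "totbdd d \<longleftrightarrow> (\<forall>e>0. \<exists>F. finite F \<and> (\<forall>g. \<exists>h\<in>F. d g h < e))"
proof (intro iffI allI impI)
  fix e :: real assume "totbdd d" "e > 0"
  then obtain P where P: "finite P" "\<Union>P = UNIV" "\<forall>S\<in>P. \<forall>g\<in>S. \<forall>h\<in>S. d g h < e"
    by (rule tbdE)
  let ?F = "(\<lambda>S. SOME g. g \<in> S) ` P"
  have "\<exists>h\<in>?F. d g h < e" for g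
  proof -
    obtain S where S: "S \<in> P" "g \<in> S" using P by blast
    then have "(SOME g. g \<in> S) \<in> S" by (metis someI)
    then show ?thesis using P(3) S by blast
  qed
  then show "\<exists>F. finite F \<and> (\<forall>g. \<exists>h\<in>F. d g h < e)" using P(1) by (intro exI[of _ ?F]) blast
next
  assume *: "\<forall>e>0. \<exists>F. finite F \<and> (\<forall>g. \<exists>h\<in>F. d g h < e)"
  show "totbdd d" unfolding totbdd_def
  proof (intro allI impI)
    fix e :: real assume "e > 0"
    then obtain F where F: "finite F" "\<forall>g. \<exists>h\<in>F. d g h < e/4" using * by (metis divide_pos_pos zero_less_numeral)
    have "d g k < e" if "d g h < e/4" "d k h < e/4" for g h k
    proof -
      have "d g k \<le> 2 * (d g h + d h k)" by (rule tri)
      then show ?thesis using that sym[of k h] by auto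
    qed
    then show "\<exists>P. finite P \<and> \<Union>P = UNIV \<and> (\<forall>S\<in>P. \<forall>g\<in>S. \<forall>h\<in>S. d g h < e)"
      using F by (intro exI[of _ "(\<lambda>h. {g. d g h < e/4}) ` F"]) auto
  qed
qed

lemma sq_diff_tri: "(a - c)\<^sup>2 \<le> 2 * ((a - b)\<^sup>2 + (b - c)\<^sup>2)" for a b c :: real
proof -
  have "2 * ((a - b)\<^sup>2 + (b - c)\<^sup>2) - (a - c)\<^sup>2 = (a - 2 * b + c)\<^sup>2" by (simp add: power2_eq_square algebra_simps)
  then show ?thesis by (metis diff_ge_0_iff_ge zero_le_power2)
qed

section \<open>Bounded measurable functions on a probability space\<close>

context prob_space begin

text \<open>Pointwise bounded functions stand in for \<open>L2\<close> classes: on a probability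
  space they are integrable and closed under products, so integrability reduces to
  \<open>bdd_meas_intros\<close>.\<close>

definition bdd_meas :: "('a \<Rightarrow> real) \<Rightarrow> bool" where
  "bdd_meas f \<longleftrightarrow> f \<in> borel_measurable M \<and> (\<exists>c. \<forall>x. \<bar>f x\<bar> \<le> c)"

lemma bdmI: "f \<in> borel_measurable M \<Longrightarrow> (\<And>x. \<bar>f x\<bar> \<le> c) \<Longrightarrow> bdd_meas f"
  unfolding bdd_meas_def by blast

lemma bdd_meas_measurable: "bdd_meas f \<Longrightarrow> f \<in> borel_measurable M" unfolding bdd_meas_def by simp

lemma bdd_meas_integrable: "bdd_meas f \<Longrightarrow> integrable M f"
  unfolding bdd_meas_def by (auto intro!: integrable_const_bound AE_I2)

lemma bdd_meas_const [simp]: "bdd_meas (\<lambda>_. c)"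
  by (rule bdmI[of _ "\<bar>c\<bar>"]) auto

lemma bdd_meas_indicator: "A \<in> sets M \<Longrightarrow> bdd_meas (indicator A)"
  by (rule bdmI[of _ 1]) (auto simp: indicator_def)

lemma bdd_meas_add: assumes "bdd_meas f" "bdd_meas g" shows "bdd_meas (\<lambda>x. f x + g x)"
proof -
  obtain c d where "\<And>x. \<bar>f x\<bar> \<le> c" "\<And>x. \<bar>g x\<bar> \<le> d" using assms unfolding bdd_meas_def by blast
  then have "\<bar>f x + g x\<bar> \<le> c + d" for x by (meson abs_triangle_ineq add_mono order_trans)
  then show ?thesis using assms by (intro bdmI[of _ "c + d"]) (auto intro: bdd_meas_measurable borel_measurable_add borel_measurable_times)
qed

lemma bdd_meas_mult: assumes "bdd_meas f" "bdd_meas g" shows "bdd_meas (\<lambda>x. f x * g x)"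
proof -
  obtain c d where cd: "\<And>x. \<bar>f x\<bar> \<le> c" "\<And>x. \<bar>g x\<bar> \<le> d" using assms unfolding bdd_meas_def by blast
  have "\<bar>f x * g x\<bar> \<le> c * d" for x
    unfolding abs_mult using cd[of x] by (intro mult_mono) (auto intro: order_trans[OF abs_ge_zero])
  then show ?thesis using assms by (intro bdmI[of _ "c * d"]) (auto intro: bdd_meas_measurable borel_measurable_add borel_measurable_times)
qed

lemma bdd_meas_diff: assumes "bdd_meas f" "bdd_meas g" shows "bdd_meas (\<lambda>x. f x - g x)"
  using bdd_meas_add[OF assms(1) bdd_meas_mult[OF bdd_meas_const[of "-1"] assms(2)]] by simp

lemma bdd_meas_divide: "bdd_meas f \<Longrightarrow> bdd_meas (\<lambda>x. f x / c)"
  using bdd_meas_mult[of f "\<lambda>_. inverse c"] by (simp add: field_class.field_divide_inverse)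

lemma bdd_meas_power2: "bdd_meas f \<Longrightarrow> bdd_meas (\<lambda>x. (f x)\<^sup>2)"
  unfolding power2_eq_square by (rule bdd_meas_mult)

lemma bdd_meas_sum: "(\<And>i. i \<in> I \<Longrightarrow> bdd_meas (f i)) \<Longrightarrow> bdd_meas (\<lambda>x. \<Sum>i\<in>I. f i x)"
  by (induction I rule: infinite_finite_induct) (auto intro: bdd_meas_add)

lemmas bdd_meas_intros = bdd_meas_const bdd_meas_indicator bdd_meas_add bdd_meas_mult bdd_meas_diff bdd_meas_divide bdd_meas_power2 bdd_meas_sum

lemma integral_sq_tri:
  assumes "bdd_meas f" "bdd_meas g" "bdd_meas h"
  shows "(\<integral>x. (f x - h x)\<^sup>2 \<partial>M) \<le> 2 * ((\<integral>x. (f x - g x)\<^sup>2 \<partial>M) + (\<integral>x. (g x - h x)\<^sup>2 \<partial>M))"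
proof -
  have "(\<integral>x. (f x - h x)\<^sup>2 \<partial>M) \<le> (\<integral>x. 2 * ((f x - g x)\<^sup>2 + (g x - h x)\<^sup>2) \<partial>M)"
    by (intro integral_mono bdd_meas_integrable bdd_meas_intros assms sq_diff_tri)
  also have "\<dots> = 2 * ((\<integral>x. (f x - g x)\<^sup>2 \<partial>M) + (\<integral>x. (g x - h x)\<^sup>2 \<partial>M))"
    by (subst integral_mult_right_zero, subst Bochner_Integration.integral_add)
      (auto intro!: bdd_meas_integrable bdd_meas_intros assms)
  finally show ?thesis .
qed

lemma integral_square_le:
  assumes "bdd_meas f" shows "(\<integral>x. f x \<partial>M)\<^sup>2 \<le> (\<integral>x. (f x)\<^sup>2 \<partial>M)"
proof -
  let ?m = "\<integral>x. f x \<partial>M"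
  have "0 \<le> (\<integral>x. (f x - ?m)\<^sup>2 \<partial>M)" by simp
  also have "\<dots> = (\<integral>x. (f x)\<^sup>2 - 2 * ?m * f x + ?m\<^sup>2 \<partial>M)" by (simp add: power2_diff algebra_simps)
  also have "\<dots> = (\<integral>x. (f x)\<^sup>2 \<partial>M) - 2 * ?m * ?m + ?m\<^sup>2"
    by (subst Bochner_Integration.integral_add, (intro bdd_meas_integrable bdd_meas_intros assms)+,
        subst Bochner_Integration.integral_diff, (intro bdd_meas_integrable bdd_meas_intros assms)+)
       (simp add: prob_space)
  finally show ?thesis by (simp add: power2_eq_square)
qed

text \<open>Cauchy-Schwarz: the squared norm of \<open>f - t * g\<close> is a nonnegative quadratic
  polynomial in \<open>t\<close>, evaluated at its minimum.\<close>

lemma integral_mult_bound: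
  assumes "bdd_meas f" "bdd_meas g" shows "(\<integral>x. f x * g x \<partial>M)\<^sup>2 \<le> (\<integral>x. (f x)\<^sup>2 \<partial>M) * (\<integral>x. (g x)\<^sup>2 \<partial>M)"
proof -
  let ?a = "\<integral>x. (f x)\<^sup>2 \<partial>M" and ?b = "\<integral>x. f x * g x \<partial>M" and ?c = "\<integral>x. (g x)\<^sup>2 \<partial>M"
  have q: "0 \<le> ?a - 2 * t * ?b + t\<^sup>2 * ?c" for t :: real
  proof -
    have "0 \<le> (\<integral>x. (f x - t * g x)\<^sup>2 \<partial>M)" by simp
    also have "\<dots> = (\<integral>x. (f x)\<^sup>2 - 2 * t * (f x * g x) + t\<^sup>2 * (g x)\<^sup>2 \<partial>M)"
      by (simp add: power2_diff power_mult_distrib algebra_simps)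
    also have "\<dots> = ?a - 2 * t * ?b + t\<^sup>2 * ?c"
      by (subst Bochner_Integration.integral_add, (intro bdd_meas_integrable bdd_meas_intros assms)+,
        subst Bochner_Integration.integral_diff, (intro bdd_meas_integrable bdd_meas_intros assms)+) simp
    finally show ?thesis .
  qed
  show ?thesis
  proof (cases "?c = 0")
    case True
    have "?b = 0"
    proof (rule ccontr)
      assume "?b \<noteq> 0"
      \<comment> \<open>With vanishing quadratic coefficient the polynomial is affine, and this
        \<open>t\<close> gives it the value -1.\<close>
      then show False using q[of "(?a + 1) / (2 * ?b)"] True by simp
    qed
    then show ?thesis using True by simp
  next
    case False
    then have "?c > 0" using Bochner_Integration.integral_nonneg[of M "\<lambda>x. (g x)\<^sup>2"] by (simp add: less_le)
    then show ?thesis using q[of "?b / ?c"] by (simp add: field_simps power2_eq_square)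
  qed
qed

end

section \<open>Almost periodic functions and the Kronecker \<sigma>-algebra of an action\<close>

locale measure_preserving_action = prob_space M for M :: "'a measure" +
  fixes T :: "'g::group_add \<Rightarrow> 'a \<Rightarrow> 'a"
  assumes space_M: "space M = UNIV"
    and T_meas [measurable]: "T g \<in> measurable M M"
    and T_pres: "distr M M (T g) = M"
    and T_add: "T (g + h) x = T g (T h x)"
    and T_0: "T 0 x = x"
begin

lemma T_meas_borel: "f \<in> borel_measurable M \<Longrightarrow> (\<lambda>x. f (T g x)) \<in> borel_measurable M"
  by (rule measurable_compose[OF T_meas])

lemma integral_T: "f \<in> borel_measurable M \<Longrightarrow> (\<integral>x. f (T g x) \<partial>M) = (\<integral>x. (f x :: real) \<partial>M)"
  using integral_distr[OF T_meas[of g], of f] by (simp add: T_pres)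

lemma vimage_T: "A \<in> sets M \<Longrightarrow> T g -` A \<in> sets M"
  using measurable_sets[OF T_meas[of g], of A] by (simp add: space_M)

lemma prob_T: "A \<in> sets M \<Longrightarrow> prob (T g -` A) = prob A"
  using measure_distr[OF T_meas[of g], of A] by (simp add: T_pres space_M)

lemma AE_T: "(AE x in M. P x) \<Longrightarrow> (AE x in M. P (T g x))"
  using AE_distrD[OF T_meas[of g], of P] unfolding T_pres .

lemma bdd_meas_T: "bdd_meas f \<Longrightarrow> bdd_meas (\<lambda>x. f (T g x))"
  unfolding bdd_meas_def by (auto intro: T_meas_borel)

definition shift_dist :: "('a \<Rightarrow> real) \<Rightarrow> 'g \<Rightarrow> 'g \<Rightarrow> real" where
  "shift_dist f g h = (\<integral>x. (f (T g x) - f (T h x))\<^sup>2 \<partial>M)"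

definition almost_periodic :: "('a \<Rightarrow> real) \<Rightarrow> bool" where
  "almost_periodic f \<longleftrightarrow> bdd_meas f \<and> totbdd (shift_dist f)"

definition K :: "'a set set" where
  "K = {B \<in> sets M. almost_periodic (indicator B)}"

lemma shift_dist_nonneg: "shift_dist f g h \<ge> 0" unfolding shift_dist_def by simp

lemma shift_dist_sym: "shift_dist f g h = shift_dist f h g" unfolding shift_dist_def by (simp add: power2_commute)

lemma shift_dist_tri: "bdd_meas f \<Longrightarrow> shift_dist f g k \<le> 2 * (shift_dist f g h + shift_dist f h k)"
  unfolding shift_dist_def by (intro integral_sq_tri bdd_meas_T)

lemma almost_periodic_bdd_meas: "almost_periodic f \<Longrightarrow> bdd_meas f" unfolding almost_periodic_def by simp

text \<open>Invariance of the measure makes an \<open>L2\<close> approximation of \<open>f\<close>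
  equally good for all translates at once. Two uses of the factor-2 triangle inequality bound the
  distance by 10 times \<open>e / 16\<close>.\<close>

lemma almost_periodic_approx:
  assumes "bdd_meas f" "\<And>e. e > 0 \<Longrightarrow> \<exists>f'. almost_periodic f' \<and> (\<integral>x. (f x - f' x)\<^sup>2 \<partial>M) < e"
  shows "almost_periodic f"
  unfolding almost_periodic_def
proof (intro conjI totbdd_approx)
  fix e :: real assume e: "e > 0"
  then obtain f' where f': "almost_periodic f'" "(\<integral>x. (f x - f' x)\<^sup>2 \<partial>M) < e / 16"
    using assms(2)[of "e/16"] by auto
  have b: "bdd_meas f'" using f' by (simp add: almost_periodic_bdd_meas)
  have "shift_dist f g h < e" if "shift_dist f' g h < e / 16" for g h
  proof -
    have 1: "(\<integral>x. (f (T g x) - f' (T g x))\<^sup>2 \<partial>M) < e / 16" for g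
      using f'(2) integral_T[OF bdd_meas_measurable, of "\<lambda>x. (f x - f' x)\<^sup>2" g] assms(1) b
      by (simp add: bdd_meas_power2 bdd_meas_diff)
    have 2: "(\<integral>x. (f' (T g x) - f (T g x))\<^sup>2 \<partial>M) < e / 16" for g
      using 1[of g] by (simp add: power2_commute)
    have "shift_dist f g h \<le> 2 * ((\<integral>x. (f (T g x) - f' (T g x))\<^sup>2 \<partial>M) + (\<integral>x. (f' (T g x) - f (T h x))\<^sup>2 \<partial>M))"
      unfolding shift_dist_def by (intro integral_sq_tri bdd_meas_T assms(1) b)
    moreover have "(\<integral>x. (f' (T g x) - f (T h x))\<^sup>2 \<partial>M) \<le>
        2 * (shift_dist f' g h + (\<integral>x. (f' (T h x) - f (T h x))\<^sup>2 \<partial>M))"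
      unfolding shift_dist_def by (intro integral_sq_tri bdd_meas_T assms(1) b)
    ultimately show ?thesis using that 1[of g] 2[of h] e by auto
  qed
  then show "\<exists>d' \<delta>. 0 < \<delta> \<and> totbdd d' \<and> (\<forall>g h. d' g h < \<delta> \<longrightarrow> shift_dist f g h < e)"
    using f'(1) e unfolding almost_periodic_def by (intro exI[of _ "shift_dist f'"] exI[of _ "e/16"]) auto
qed (rule assms(1))

text \<open>Composing with \<open>T g\<close> reindexes the orbit by the left translation
  \<open>h \<mapsto> g + h\<close>, so covers of the group are pulled back along it.\<close>

lemma almost_periodic_shift: assumes "almost_periodic f" shows "almost_periodic (\<lambda>x. f (T g x))"
  unfolding almost_periodic_def
proof
  show "bdd_meas (\<lambda>x. f (T g x))" by (intro bdd_meas_T almost_periodic_bdd_meas assms)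
  have shift_dist: "shift_dist (\<lambda>x. f (T g x)) h k = shift_dist f (g + h) (g + k)" for h k
    unfolding shift_dist_def by (simp add: T_add)
  show "totbdd (shift_dist (\<lambda>x. f (T g x)))"
    unfolding totbdd_def
  proof (intro allI impI)
    fix e :: real assume "e > 0"
    with assms obtain P where P: "finite P" "\<Union>P = UNIV" "\<forall>S\<in>P. \<forall>g\<in>S. \<forall>h\<in>S. shift_dist f g h < e"
      unfolding almost_periodic_def by (metis tbdE)
    let ?P = "(\<lambda>S. (\<lambda>h. g + h) -` S) ` P"
    have "\<Union>?P = (\<lambda>h. g + h) -` \<Union>P" by blast
    then have "finite ?P" "\<Union>?P = UNIV" "\<forall>S\<in>?P. \<forall>h\<in>S. \<forall>k\<in>S. shift_dist (\<lambda>x. f (T g x)) h k < e"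
      using P shift_dist by auto
    then show "\<exists>P. finite P \<and> \<Union> P = UNIV \<and> (\<forall>S\<in>P. \<forall>h\<in>S. \<forall>k\<in>S. shift_dist (\<lambda>x. f (T g x)) h k < e)"
      by (intro exI[of _ ?P] conjI)
  qed
qed

lemma K_sets: "A \<in> K \<Longrightarrow> A \<in> sets M" unfolding K_def by simp

lemma K_vimage: "A \<in> K \<Longrightarrow> T g -` A \<in> K"
proof -
  assume A: "A \<in> K"
  have "(\<lambda>x. indicator A (T g x) :: real) = indicator (T g -` A)" by (auto simp: indicator_def)
  then show ?thesis using A almost_periodic_shift[of "indicator A" g] vimage_T[of A g] unfolding K_def by auto
qed

lemma K_Compl: "A \<in> K \<Longrightarrow> - A \<in> K"
proof -
  assume A: "A \<in> K"
  have "- A \<in> sets M" using sets.compl_sets[of A M] A by (simp add: K_sets space_M Compl_eq_Diff_UNIV)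
  moreover have "shift_dist (indicator (- A)) = shift_dist (indicator A)"
    unfolding shift_dist_def by (intro ext Bochner_Integration.integral_cong refl) (auto simp: indicator_def)
  ultimately show ?thesis using A unfolding K_def almost_periodic_def by (auto intro: bdd_meas_indicator)
qed

lemma K_Un: assumes A: "A \<in> K" and B: "B \<in> K" shows "A \<union> B \<in> K"
proof -
  have s: "A \<in> sets M" "B \<in> sets M" using A B by (simp_all add: K_sets)
  have "shift_dist (indicator (A \<union> B)) g h \<le> 1 * (shift_dist (indicator A) g h + shift_dist (indicator B) g h)" for g h
  proof -
    have "shift_dist (indicator (A \<union> B)) g h \<le> (\<integral>x. (indicator A (T g x) - indicator A (T h x))\<^sup>2 +
        (indicator B (T g x) - indicator B (T h x))\<^sup>2 \<partial>M)"
      unfolding shift_dist_def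
      by (intro integral_mono bdd_meas_integrable bdd_meas_intros bdd_meas_T[of "indicator _"] s sets.Un)
        (auto simp: indicator_def)
    also have "\<dots> = shift_dist (indicator A) g h + shift_dist (indicator B) g h"
      unfolding shift_dist_def
      by (intro Bochner_Integration.integral_add bdd_meas_integrable bdd_meas_intros bdd_meas_T[of "indicator _"] s)
    finally show ?thesis by simp
  qed
  then have "totbdd (shift_dist (indicator (A \<union> B)))"
    using A B totbdd_add[of "shift_dist (indicator A)" "shift_dist (indicator B)" "shift_dist (indicator (A \<union> B))" 1]
    unfolding K_def almost_periodic_def by simp
  then show ?thesis using s unfolding K_def almost_periodic_def by (auto intro!: bdd_meas_indicator)
qed

lemma K_empty: "{} \<in> K"
  unfolding K_def almost_periodic_def shift_dist_def by (auto simp: totbdd_zero bdd_meas_indicator)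

text \<open>The finite unions converge in measure to the whole union, hence their indicators
  converge in \<open>L2\<close>, and almost periodicity is closed under such limits.\<close>

lemma K_UN: assumes "range A \<subseteq> K" shows "(\<Union>i::nat. A i) \<in> K"
proof -
  have K: "(\<Union>i<n. A i) \<in> K" for n
    by (induction n) (use assms in \<open>auto simp: K_empty lessThan_Suc intro: K_Un\<close>)
  let ?A = "\<Union>i. A i"
  let ?B = "\<lambda>n. \<Union>i<n. A i"
  have s: "?A \<in> sets M" "\<And>n. ?B n \<in> sets M" using assms K by (auto dest!: K_sets)
  have U: "(\<Union>n. ?B n) = ?A" by blast
  have "(\<lambda>n. prob (?B n)) \<longlonglongrightarrow> prob ?A"
    using finite_Lim_measure_incseq[of ?B] s by (auto simp: incseq_def U) (blast intro: less_le_trans)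
  have "almost_periodic (indicator ?A)"
  proof (rule almost_periodic_approx)
    fix e :: real assume "e > 0"
    then obtain n where n: "\<bar>prob (?B n) - prob ?A\<bar> < e"
      using \<open>(\<lambda>n. prob (?B n)) \<longlonglongrightarrow> prob ?A\<close> by (metis LIMSEQ_D order_refl real_norm_def)
    have "(\<integral>x. (indicator ?A x - indicator (?B n) x)\<^sup>2 \<partial>M) = (\<integral>x. (indicator (?A - ?B n) x :: real) \<partial>M)"
      by (intro Bochner_Integration.integral_cong refl) (auto simp: indicator_def)
    also have "\<dots> = prob (?A - ?B n)" using s by simp
    also have "\<dots> = prob ?A - prob (?B n)" using s by (intro finite_measure_Diff) auto
    finally show "\<exists>f'. almost_periodic f' \<and> (\<integral>x. (indicator ?A x - f' x)\<^sup>2 \<partial>M) < e"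
      using n K[of n] unfolding K_def by (intro exI[of _ "indicator (?B n)"]) auto
  qed (use s in \<open>auto intro: bdd_meas_indicator\<close>)
  then show ?thesis using s unfolding K_def by auto
qed

lemma K_sigma: "sigma_algebra UNIV K"
  unfolding sigma_algebra_iff2
  using K_empty K_Compl K_UN by (auto simp: Compl_eq_Diff_UNIV)

definition kron_alg :: "'a measure" where "kron_alg = sigma UNIV K"

lemma sets_kron_alg: "sets kron_alg = K" and space_kron_alg: "space kron_alg = UNIV"
  unfolding kron_alg_def using sigma_algebra.sets_measure_of_eq[OF K_sigma] by (auto simp: sigma_sets_into_sp)

lemma kron_alg_sub: "subalgebra M kron_alg"
  unfolding subalgebra_def by (auto simp: sets_kron_alg space_kron_alg space_M K_sets)

sublocale kron_alg: finite_measure_subalgebra M kron_alg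
  by unfold_locales (rule kron_alg_sub)

end

section \<open>Almost periodic functions\<close>

text \<open>Completeness of \<open>L2\<close> in a form that keeps the limit bounded. The square
  root of the geometric rate is still summable, so almost everywhere the increments are absolutely
  summable; the common bound \<open>c\<close> then gives \<open>L2\<close> convergence by
  domination.\<close>

lemma (in prob_space) L2_limit:
  assumes u: "\<And>n. bdd_meas (u n)" and c: "\<And>n x. \<bar>u n x\<bar> \<le> c"
    and d: "\<And>n. (\<integral>x. (u n x - u (Suc n) x)\<^sup>2 \<partial>M) \<le> C * (1/16)^n"
  shows "\<exists>f. bdd_meas f \<and> (\<lambda>n. \<integral>x. (u n x - f x)\<^sup>2 \<partial>M) \<longlonglongrightarrow> 0"
proof -
  have [measurable]: "u n \<in> borel_measurable M" for n using u by (rule bdd_meas_measurable)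
  have C: "C \<ge> 0" using d[of 0] order_trans[OF Bochner_Integration.integral_nonneg[of M "\<lambda>x. (u 0 x - u (Suc 0) x)\<^sup>2"]] by simp
  have ba: "bdd_meas (\<lambda>x. \<bar>u n x - u (Suc n) x\<bar>)" for n
  proof (rule bdmI[of _ "2 * c"])
    show "\<bar>\<bar>u n x - u (Suc n) x\<bar>\<bar> \<le> 2 * c" for x using c[of n x] c[of "Suc n" x] by arith
  qed measurable
  have L1: "(\<integral>x. \<bar>u n x - u (Suc n) x\<bar> \<partial>M) \<le> sqrt C * (1/4)^n" for n
  proof -
    have "(\<integral>x. \<bar>u n x - u (Suc n) x\<bar> \<partial>M)\<^sup>2 \<le> (\<integral>x. \<bar>u n x - u (Suc n) x\<bar>\<^sup>2 \<partial>M)"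
      by (rule integral_square_le[OF ba])
    also have "\<dots> \<le> C * (1/16)^n" using d[of n] by simp
    also have "(1/16::real)^n = ((1/4)^n)\<^sup>2" by (simp add: power2_eq_square flip: power_mult_distrib)
    also have "C * ((1/4)^n)\<^sup>2 = (sqrt C * (1/4)^n)\<^sup>2" using C by (simp add: power_mult_distrib)
    finally show ?thesis by (rule power2_le_imp_le) (use C in simp)
  qed
  have sm: "summable (\<lambda>n. sqrt C * (1/4::real)^n)" by (intro summable_mult summable_geometric) simp
  have "(\<integral>\<^sup>+x. (\<Sum>n. ennreal \<bar>u n x - u (Suc n) x\<bar>) \<partial>M) = (\<Sum>n. \<integral>\<^sup>+x. ennreal \<bar>u n x - u (Suc n) x\<bar> \<partial>M)"
    by (intro nn_integral_suminf) measurable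
  also have "\<dots> = (\<Sum>n. ennreal (\<integral>x. \<bar>u n x - u (Suc n) x\<bar> \<partial>M))"
    by (subst nn_integral_eq_integral[OF bdd_meas_integrable[OF ba]]) auto
  also have "\<dots> \<le> (\<Sum>n. ennreal (sqrt C * (1/4)^n))"
    by (intro suminf_le ennreal_leI L1 summableI)
  also have "\<dots> < \<infinity>" using C sm by (subst suminf_ennreal2) auto
  finally have "AE x in M. (\<Sum>n. ennreal \<bar>u n x - u (Suc n) x\<bar>) \<noteq> \<infinity>"
    by (intro nn_integral_PInf_AE) auto
  moreover have "convergent (\<lambda>n. u n x)" if "(\<Sum>n. ennreal \<bar>u n x - u (Suc n) x\<bar>) \<noteq> \<infinity>" for x
  proof -
    have "summable (\<lambda>n. \<bar>u n x - u (Suc n) x\<bar>)"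
      using that by (intro summable_suminf_not_top) auto
    then have "summable (\<lambda>n. u n x - u (Suc n) x)" by (rule summable_rabs_cancel)
    then have "convergent (\<lambda>n. \<Sum>i<n. u i x - u (Suc i) x)" by (simp add: summable_iff_convergent)
    moreover have "(\<Sum>i<n. u i x - u (Suc i) x) = u 0 x - u n x" for n by (induction n) auto
    ultimately have "convergent (\<lambda>n. u 0 x - u n x)" by simp
    from convergent_diff[OF convergent_const[of "u 0 x"] this] show ?thesis by simp
  qed
  ultimately have cv: "AE x in M. convergent (\<lambda>n. u n x)" by auto
  define f where "f x = (if convergent (\<lambda>n. u n x) then lim (\<lambda>n. u n x) else 0)" for x
  have [measurable]: "f \<in> borel_measurable M" unfolding f_def Cauchy_convergent_iff[symmetric] by measurable
  have lim: "(\<lambda>n. u n x) \<longlonglongrightarrow> f x" if "convergent (\<lambda>n. u n x)" for x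
    using that by (simp add: f_def convergent_LIMSEQ_iff)
  have c0: "c \<ge> 0" using order_trans[OF abs_ge_zero c[of 0]] by blast
  have fc: "\<bar>f x\<bar> \<le> c" for x
  proof (cases "convergent (\<lambda>n. u n x)")
    case True
    then have "(\<lambda>n. \<bar>u n x\<bar>) \<longlonglongrightarrow> \<bar>f x\<bar>" by (intro tendsto_rabs lim)
    then show ?thesis by (rule LIMSEQ_le_const2) (use c in auto)
  qed (use c0 in \<open>simp add: f_def\<close>)
  have "(\<lambda>n. \<integral>x. (u n x - f x)\<^sup>2 \<partial>M) \<longlonglongrightarrow> (\<integral>x. 0 \<partial>M)"
  proof (rule integral_dominated_convergence[where w = "\<lambda>x. (2 * c)\<^sup>2"])
    show "AE x in M. (\<lambda>n. (u n x - f x)\<^sup>2) \<longlonglongrightarrow> 0"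
      using cv
    proof eventually_elim
      case (elim x)
      have "(\<lambda>n. (u n x - f x)\<^sup>2) \<longlonglongrightarrow> (f x - f x)\<^sup>2"
        by (intro tendsto_intros lim elim)
      then show ?case by simp
    qed
    show "AE x in M. norm ((u n x - f x)\<^sup>2) \<le> (2 * c)\<^sup>2" for n
    proof (rule AE_I2)
      fix x
      have "\<bar>u n x - f x\<bar> \<le> 2 * c" using c[of n x] fc[of x] by arith
      then have "\<bar>u n x - f x\<bar>\<^sup>2 \<le> (2 * c)\<^sup>2" by (rule power_mono) simp
      then show "norm ((u n x - f x)\<^sup>2) \<le> (2 * c)\<^sup>2" by simp
    qed
  qed auto
  then show ?thesis using fc by (intro exI[of _ f] conjI bdmI[of f c]) auto
qed

context measure_preserving_action begin

text \<open>Cutting at \<open>t\<close> is discontinuous, but values of \<open>f\<close> near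
  \<open>t\<close> have small probability when \<open>t\<close> is not an atom of its distribution.
  Away from them a change of the indicator forces \<open>f\<close> to move by a definite
  amount.\<close>

lemma almost_periodic_level:
  assumes f: "almost_periodic f" and t: "prob {x. f x = t} = 0"
  shows "{x. t < f x} \<in> K"
proof -
  have b: "bdd_meas f" using f by (rule almost_periodic_bdd_meas)
  have [measurable]: "f \<in> borel_measurable M" using b by (rule bdd_meas_measurable)
  have s: "{x. t < f x} \<in> sets M"
    using measurable_sets[of f M borel "{t<..}"] by (simp add: space_M vimage_def)
  let ?S = "\<lambda>\<delta>. {x. \<bar>f x - t\<bar> \<le> \<delta>}"
  have S: "?S \<delta> \<in> sets M" for \<delta>
    using measurable_sets[of "\<lambda>x. \<bar>f x - t\<bar>" M borel "{..\<delta>}"] by (simp add: space_M vimage_def)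
  have small: "\<exists>\<delta>>0. prob (?S \<delta>) < e" if "e > 0" for e
  proof -
    have "(\<lambda>n. prob (?S (1 / real (Suc n)))) \<longlonglongrightarrow> prob (\<Inter>n. ?S (1 / real (Suc n)))"
      using S by (intro finite_Lim_measure_decseq) (auto simp: decseq_def intro: order_trans[OF _ divide_left_mono])
    moreover have "(\<Inter>n. ?S (1 / real (Suc n))) = {x. f x = t}"
    proof (intro set_eqI iffI)
      fix x assume "x \<in> (\<Inter>n. ?S (1 / real (Suc n)))"
      then have *: "\<bar>f x - t\<bar> \<le> 1 / real (Suc n)" for n by blast
      have "\<bar>f x - t\<bar> \<le> 0"
      proof (rule field_le_epsilon)
        fix e :: real assume "e > 0"
        then obtain n where "inverse (real (Suc n)) < e" using reals_Archimedean by blast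
        then show "\<bar>f x - t\<bar> \<le> 0 + e" using *[of n] by (simp add: inverse_eq_divide)
      qed
      then show "x \<in> {x. f x = t}" by simp
    qed auto
    ultimately have "(\<lambda>n. prob (?S (1 / real (Suc n)))) \<longlonglongrightarrow> 0" using t by simp
    from order_tendstoD(2)[OF this that] obtain n where "prob (?S (1 / real (Suc n))) < e"
      by (auto simp: eventually_sequentially)
    then show ?thesis by (intro exI[of _ "1 / real (Suc n)"]) auto
  qed
  let ?I = "\<lambda>x. indicator {x. t < f x} x :: real"
  have "totbdd (shift_dist ?I)"
  proof (rule totbdd_approx)
    fix e :: real assume e: "e > 0"
    then obtain \<delta> where \<delta>: "\<delta> > 0" "prob (?S \<delta>) < e / 2" using small[of "e/2"] by auto
    have "shift_dist ?I g h < e" if "shift_dist f g h < \<delta>\<^sup>2 * (e / 2)" for g h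
    proof -
      \<comment> \<open>If \<open>f\<close> moves by less than \<delta> and the indicators differ,
        then \<open>t\<close> lies between the two values, so \<open>f y\<close> is within \<delta>
        of \<open>t\<close>. If it moves by at least \<delta>, the quotient is at least 1.\<close>
      have pt: "(?I y - ?I z)\<^sup>2 \<le> (f y - f z)\<^sup>2 / \<delta>\<^sup>2 + indicator (?S \<delta>) y" for y z
      proof (cases "\<bar>f y - f z\<bar> \<ge> \<delta>")
        case True
        then have "\<delta>\<^sup>2 \<le> (f y - f z)\<^sup>2" using \<delta> by (simp add: abs_le_square_iff[symmetric])
        then have "1 \<le> (f y - f z)\<^sup>2 / \<delta>\<^sup>2" using \<delta> by simp
        then show ?thesis by (auto simp: indicator_def)
      next
        case False
        then have "(?I y - ?I z)\<^sup>2 \<le> indicator (?S \<delta>) y" using \<delta> by (auto simp: indicator_def)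
        then show ?thesis by (simp add: add_increasing)
      qed
      have "shift_dist ?I g h \<le> (\<integral>x. (f (T g x) - f (T h x))\<^sup>2 / \<delta>\<^sup>2 + indicator (?S \<delta>) (T g x) \<partial>M)"
        unfolding shift_dist_def
        by (intro integral_mono bdd_meas_integrable bdd_meas_intros bdd_meas_T bdd_meas_T[of "indicator _"] b S s pt)
      also have "\<dots> = (\<integral>x. (f (T g x) - f (T h x))\<^sup>2 / \<delta>\<^sup>2 \<partial>M) + (\<integral>x. indicator (?S \<delta>) (T g x) \<partial>M)"
        by (intro Bochner_Integration.integral_add bdd_meas_integrable bdd_meas_intros bdd_meas_T bdd_meas_T[of "indicator _"] b S)
      also have "\<dots> = shift_dist f g h / \<delta>\<^sup>2 + prob (?S \<delta>)"
        unfolding shift_dist_def using S[of \<delta>] by (subst integral_T) (auto simp: space_M)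
      also have "\<dots> < e / 2 + e / 2"
        using that \<delta> by (intro add_strict_mono) (auto simp: field_simps)
      finally show ?thesis by simp
    qed
    then show "\<exists>d' \<delta>. \<delta> > 0 \<and> totbdd d' \<and> (\<forall>g h. d' g h < \<delta> \<longrightarrow> shift_dist ?I g h < e)"
      using f \<delta>(1) e unfolding almost_periodic_def by (intro exI[of _ "shift_dist f"] exI[of _ "\<delta>\<^sup>2 * (e / 2)"]) auto
  qed
  then show ?thesis using s unfolding K_def almost_periodic_def by (auto intro: bdd_meas_indicator)
qed

text \<open>The distribution of \<open>f\<close> has only countably many atoms, so every level
  \<open>a\<close> is the limit from above of levels \<open>t n\<close> to which
  \<open>almost_periodic_level\<close> applies.\<close>

lemma almost_periodic_kron_alg: assumes f: "almost_periodic f" shows "f \<in> borel_measurable kron_alg"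
  unfolding borel_measurable_iff_greater
proof
  fix a
  have b: "bdd_meas f" using f by (rule almost_periodic_bdd_meas)
  have [measurable]: "f \<in> borel_measurable M" using b by (rule bdd_meas_measurable)
  interpret d: prob_space "distr M borel f" by (rule prob_space_distr) simp
  let ?A = "{t. measure (distr M borel f) {t} \<noteq> 0}"
  have A: "countable ?A" by (rule d.countable_support)
  have "\<exists>t. a < t \<and> t < a + 1 / real (Suc n) \<and> t \<notin> ?A" for n
  proof -
    have "uncountable {a<..<a + 1 / real (Suc n)}" by (simp add: uncountable_open_interval)
    then have "\<not> {a<..<a + 1 / real (Suc n)} \<subseteq> ?A" using A countable_subset by blast
    then show ?thesis by (auto simp: subset_iff)
  qed
  then obtain t where t: "\<And>n. a < t n" "\<And>n. t n < a + 1 / real (Suc n)" "\<And>n. t n \<notin> ?A" by metis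
  have "{x. t n < f x} \<in> K" for n
    using t(3)[of n] by (intro almost_periodic_level f) (simp add: measure_distr vimage_def space_M)
  then have "(\<Union>n. {x. t n < f x}) \<in> K" by (intro K_UN) auto
  moreover have "(\<Union>n. {x. t n < f x}) = {x. a < f x}"
  proof (intro set_eqI iffI)
    fix x assume "x \<in> {x. a < f x}"
    then have "f x - a > 0" by simp
    then obtain n where "inverse (real (Suc n)) < f x - a" using reals_Archimedean by blast
    then have "t n < f x" using t(2)[of n] by (simp add: inverse_eq_divide)
    then show "x \<in> (\<Union>n. {x. t n < f x})" by blast
  qed (use t(1) in \<open>auto intro: less_trans\<close>)
  ultimately show "{w \<in> space kron_alg. a < f w} \<in> sets kron_alg" by (simp add: sets_kron_alg space_kron_alg)
qed

definition kron_orth :: "('a \<Rightarrow> real) \<Rightarrow> bool" where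
  "kron_orth \<phi> \<longleftrightarrow> bdd_meas \<phi> \<and> (\<forall>C\<in>K. (\<integral>x. indicator C x * \<phi> x \<partial>M) = 0)"

text \<open>Orthogonality to the indicators of Kronecker sets says that the conditional expectation
  of \<phi> vanishes, and the Kronecker-measurable factor \<open>f\<close> can be pulled out of
  it.\<close>

lemma almost_periodic_orth:
  assumes f: "almost_periodic f" and \<phi>: "kron_orth \<phi>"
  shows "(\<integral>x. f x * \<phi> x \<partial>M) = 0"
proof -
  have b: "bdd_meas f" "bdd_meas \<phi>" using f \<phi> by (auto simp: almost_periodic_def kron_orth_def)
  have [measurable]: "\<phi> \<in> borel_measurable M" using b bdd_meas_measurable by blast
  have "AE x in M. real_cond_exp M kron_alg \<phi> x = 0"
    using \<phi> b by (intro kron_alg.real_cond_exp_charact bdd_meas_integrable)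
      (auto simp: sets_kron_alg set_lebesgue_integral_def kron_orth_def)
  moreover have "(\<integral>x. f x * \<phi> x \<partial>M) = (\<integral>x. f x * real_cond_exp M kron_alg \<phi> x \<partial>M)"
    by (rule kron_alg.real_cond_exp_intg(2)[symmetric]) (auto intro: almost_periodic_kron_alg f bdd_meas_integrable bdd_meas_mult b)
  moreover have "(\<integral>x. f x * real_cond_exp M kron_alg \<phi> x \<partial>M) = (\<integral>x. 0 \<partial>M)"
    using calculation(1) bdd_meas_measurable[OF b(1)] by (intro integral_cong_AE) auto
  ultimately show ?thesis by simp
qed

section \<open>Integral operators with kernels on the product space\<close>

interpretation PP: pair_prob_space M M ..

lemma measurable_section: "F \<in> borel_measurable (M \<Otimes>\<^sub>M M) \<Longrightarrow> (\<lambda>y. F (x, y)) \<in> borel_measurable M"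
  by (rule measurable_compose[OF measurable_Pair1']) (auto simp: space_M)

lemma bdd_meas_section: "PP.bdd_meas F \<Longrightarrow> bdd_meas (\<lambda>y. F (x, y))"
  unfolding bdd_meas_def PP.bdd_meas_def by (auto intro: measurable_section)

lemma PP_fubini: "PP.bdd_meas F \<Longrightarrow> (\<integral>p. F p \<partial>(M \<Otimes>\<^sub>M M)) = (\<integral>x. (\<integral>y. F (x, y) \<partial>M) \<partial>M)"
  by (rule PP.integral_fst'[symmetric, OF PP.bdd_meas_integrable])

lemma bdd_meas_int: assumes "PP.bdd_meas F" shows "bdd_meas (\<lambda>x. \<integral>y. F (x, y) \<partial>M)"
proof -
  obtain c where c: "\<And>p. \<bar>F p\<bar> \<le> c" using assms unfolding PP.bdd_meas_def by blast
  have [measurable]: "F \<in> borel_measurable (M \<Otimes>\<^sub>M M)" using assms by (rule PP.bdd_meas_measurable)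
  show ?thesis
  proof (rule bdmI[of _ c])
    fix x
    have b: "bdd_meas (\<lambda>y. F (x, y))" by (rule bdd_meas_section[OF assms])
    have "\<bar>\<integral>y. F (x, y) \<partial>M\<bar> \<le> (\<integral>y. \<bar>F (x, y)\<bar> \<partial>M)" by (rule integral_abs_bound)
    also have "\<dots> \<le> (\<integral>y. c \<partial>M)" using c bdd_meas_integrable[OF b] by (intro integral_mono) auto
    finally show "\<bar>\<integral>y. F (x, y) \<partial>M\<bar> \<le> c" by (simp add: prob_space)
  qed measurable
qed

lemma PP_bdd_meas_prod: "bdd_meas f \<Longrightarrow> bdd_meas h \<Longrightarrow> PP.bdd_meas (\<lambda>p. f (fst p) * h (snd p))"
proof (rule PP.bdd_meas_mult)
  show "bdd_meas f \<Longrightarrow> PP.bdd_meas (\<lambda>p. f (fst p))"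
    unfolding bdd_meas_def PP.bdd_meas_def by (auto intro: measurable_compose[OF measurable_fst])
  show "bdd_meas h \<Longrightarrow> PP.bdd_meas (\<lambda>p. h (snd p))"
    unfolding bdd_meas_def PP.bdd_meas_def by (auto intro: measurable_compose[OF measurable_snd])
qed

lemma PP_bdd_meas_snd: "bdd_meas h \<Longrightarrow> PP.bdd_meas (\<lambda>p. h (snd p))"
  using PP_bdd_meas_prod[of "\<lambda>_. 1" h] by simp

lemma PP_bdd_meas_T: assumes F: "PP.bdd_meas F" shows "PP.bdd_meas (\<lambda>p. F (T g (fst p), T g (snd p)))"
proof -
  have "(\<lambda>p. (T g (fst p), T g (snd p))) \<in> M \<Otimes>\<^sub>M M \<rightarrow>\<^sub>M M \<Otimes>\<^sub>M M" by measurable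
  from measurable_compose[OF this PP.bdd_meas_measurable[OF F]]
  show ?thesis using F unfolding PP.bdd_meas_def by blast
qed

definition kernel_op :: "('a \<times> 'a \<Rightarrow> real) \<Rightarrow> ('a \<Rightarrow> real) \<Rightarrow> 'a \<Rightarrow> real" where
  "kernel_op F \<psi> x = (\<integral>y. F (x, y) * \<psi> y \<partial>M)"

definition hs_norm2 :: "('a \<times> 'a \<Rightarrow> real) \<Rightarrow> real" where
  "hs_norm2 F = (\<integral>p. (F p)\<^sup>2 \<partial>(M \<Otimes>\<^sub>M M))"

lemma bdd_meas_op: "PP.bdd_meas F \<Longrightarrow> bdd_meas \<psi> \<Longrightarrow> bdd_meas (kernel_op F \<psi>)"
  unfolding kernel_op_def using bdd_meas_int[of "\<lambda>p. F p * \<psi> (snd p)"] by (simp add: PP.bdd_meas_mult PP_bdd_meas_snd)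

lemma kernel_op_bound:
  assumes F: "PP.bdd_meas F" and \<psi>: "bdd_meas \<psi>" "\<And>y. \<bar>\<psi> y\<bar> \<le> 1" and c: "\<And>p. \<bar>F p\<bar> \<le> c"
  shows "\<bar>kernel_op F \<psi> x\<bar> \<le> c"
proof -
  have "bdd_meas (\<lambda>y. F (x, y) * \<psi> y)" using F \<psi> by (intro bdd_meas_intros bdd_meas_section)
  then have i: "integrable M (\<lambda>y. F (x, y) * \<psi> y)" by (rule bdd_meas_integrable)
  have "\<bar>\<integral>y. F (x, y) * \<psi> y \<partial>M\<bar> \<le> (\<integral>y. \<bar>F (x, y) * \<psi> y\<bar> \<partial>M)" by (rule integral_abs_bound)
  also have "\<dots> \<le> (\<integral>y. c \<partial>M)"
  proof (intro integral_mono)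
    fix y
    have "\<bar>F (x, y)\<bar> * \<bar>\<psi> y\<bar> \<le> c * 1" using c[of "(x, y)"] \<psi>(2)[of y]
      by (intro mult_mono) (auto intro: order_trans[OF abs_ge_zero])
    then show "\<bar>F (x, y) * \<psi> y\<bar> \<le> c" by (simp add: abs_mult)
  qed (use i in auto)
  finally show ?thesis by (simp add: prob_space kernel_op_def)
qed

text \<open>The operator norm is at most the Hilbert-Schmidt norm, that is, the \<open>L2\<close>
  norm of the kernel: apply the square inequality for integrals on each fibre \<open>x\<close> and
  integrate by Fubini.\<close>

lemma kernel_op_diff_le:
  assumes F: "PP.bdd_meas F" "PP.bdd_meas F'" and \<psi>: "bdd_meas \<psi>" "\<And>y. \<bar>\<psi> y\<bar> \<le> 1"
  shows "(\<integral>x. (kernel_op F \<psi> x - kernel_op F' \<psi> x)\<^sup>2 \<partial>M) \<le> hs_norm2 (\<lambda>p. F p - F' p)"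
proof -
  let ?G = "\<lambda>p. F p - F' p"
  have G: "PP.bdd_meas ?G" using F by (rule PP.bdd_meas_diff)
  have "(kernel_op F \<psi> x - kernel_op F' \<psi> x)\<^sup>2 \<le> (\<integral>y. (?G (x, y))\<^sup>2 \<partial>M)" for x
  proof -
    have "kernel_op F \<psi> x - kernel_op F' \<psi> x = (\<integral>y. ?G (x, y) * \<psi> y \<partial>M)"
      unfolding kernel_op_def left_diff_distrib
      by (intro Bochner_Integration.integral_diff[symmetric] bdd_meas_integrable bdd_meas_intros bdd_meas_section F \<psi>)
    moreover have "(\<integral>y. ?G (x, y) * \<psi> y \<partial>M)\<^sup>2 \<le> (\<integral>y. (?G (x, y) * \<psi> y)\<^sup>2 \<partial>M)"
      by (intro integral_square_le bdd_meas_intros bdd_meas_section[OF F(1)] bdd_meas_section[OF F(2)] \<psi>)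
    ultimately have "(kernel_op F \<psi> x - kernel_op F' \<psi> x)\<^sup>2 \<le> (\<integral>y. (?G (x, y) * \<psi> y)\<^sup>2 \<partial>M)"
      by presburger
    also have "\<dots> \<le> (\<integral>y. (?G (x, y))\<^sup>2 \<partial>M)"
    proof (intro integral_mono bdd_meas_integrable)
      fix y
      have "(\<psi> y)\<^sup>2 \<le> 1" using \<psi>(2)[of y] by (simp add: abs_square_le_1)
      then have "(?G (x, y))\<^sup>2 * (\<psi> y)\<^sup>2 \<le> (?G (x, y))\<^sup>2 * 1" by (intro mult_left_mono) auto
      then show "(?G (x, y) * \<psi> y)\<^sup>2 \<le> (?G (x, y))\<^sup>2" by (simp add: power_mult_distrib)
    qed (intro bdd_meas_intros bdd_meas_section[OF F(1)] bdd_meas_section[OF F(2)] \<psi>)+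
    finally show ?thesis .
  qed
  moreover have "bdd_meas (\<lambda>x. \<integral>y. (?G (x, y))\<^sup>2 \<partial>M)"
    by (rule bdd_meas_int[of "\<lambda>p. (?G p)\<^sup>2", OF PP.bdd_meas_power2[OF G]])
  ultimately have "(\<integral>x. (kernel_op F \<psi> x - kernel_op F' \<psi> x)\<^sup>2 \<partial>M) \<le> (\<integral>x. (\<integral>y. (?G (x, y))\<^sup>2 \<partial>M) \<partial>M)"
    by (intro integral_mono bdd_meas_integrable bdd_meas_intros bdd_meas_op F \<psi>)
  also have "\<dots> = hs_norm2 ?G" unfolding hs_norm2_def by (rule PP_fubini[symmetric, OF PP.bdd_meas_power2[OF G]])
  finally show ?thesis .
qed

lemma hs_norm2_T: assumes F: "PP.bdd_meas F" shows "hs_norm2 (\<lambda>p. F (T g (fst p), T g (snd p))) = hs_norm2 F"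
proof -
  let ?F2 = "\<lambda>p. (F p)\<^sup>2"
  have F2: "PP.bdd_meas ?F2" by (rule PP.bdd_meas_power2[OF F])
  have "hs_norm2 (\<lambda>p. F (T g (fst p), T g (snd p))) = (\<integral>x. (\<integral>y. ?F2 (T g x, T g y) \<partial>M) \<partial>M)"
    unfolding hs_norm2_def using PP_fubini[OF PP.bdd_meas_power2[OF PP_bdd_meas_T[OF F]]] by simp
  also have "\<dots> = (\<integral>x. (\<integral>y. ?F2 (T g x, y) \<partial>M) \<partial>M)"
    using integral_T[OF bdd_meas_measurable[OF bdd_meas_section[OF F2]]] by simp
  also have "\<dots> = (\<integral>x. (\<integral>y. ?F2 (x, y) \<partial>M) \<partial>M)"
    by (rule integral_T[OF bdd_meas_measurable[OF bdd_meas_int[OF F2]]])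
  also have "\<dots> = hs_norm2 F" unfolding hs_norm2_def by (rule PP_fubini[symmetric, OF F2])
  finally show ?thesis .
qed

text \<open>Substitution of \<open>T g y\<close> for \<open>y\<close>. In particular the operator of
  a kernel that is almost invariant under the diagonal action almost commutes with
  translation.\<close>

lemma kernel_op_T:
  assumes F: "PP.bdd_meas F" and \<psi>: "bdd_meas \<psi>"
  shows "kernel_op F \<psi> (T g x) = kernel_op (\<lambda>p. F (T g (fst p), T g (snd p))) (\<lambda>y. \<psi> (T g y)) x"
  unfolding kernel_op_def
  using integral_T[of "\<lambda>y. F (T g x, y) * \<psi> y" g] bdd_meas_mult[OF bdd_meas_section[OF F, of "T g x"] \<psi>]
  by (simp add: bdd_meas_measurable)

text \<open>The functions range over a bounded set in the span of finitely many fixed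
  \<open>b j\<close>; only the coefficients \<open>a j g\<close> depend on the group element. This
  is the precompactness of bounded sets under a finite-rank operator.\<close>

lemma totbdd_sum:
  assumes "finite J" "\<And>j. j \<in> J \<Longrightarrow> bdd_meas (b j)" "\<And>j g. j \<in> J \<Longrightarrow> \<bar>a j g\<bar> \<le> (c j :: real)"
  shows "totbdd (\<lambda>g h. \<integral>x. ((\<Sum>j\<in>J. b j x * a j g) - (\<Sum>j\<in>J. b j x * a j h))\<^sup>2 \<partial>M)"
  using assms
proof (induction J rule: finite_induct)
  case empty then show ?case by (simp add: totbdd_zero)
next
  case (insert i J)
  let ?s = "\<lambda>g x. \<Sum>j\<in>J. b j x * a j g"
  have 1: "totbdd (\<lambda>g h. \<integral>x. (?s g x - ?s h x)\<^sup>2 \<partial>M)" using insert by auto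
  have "totbdd (\<lambda>g h. (a i g - a i h)\<^sup>2)" by (rule totbdd_bounded_real[of _ "c i"]) (use insert in auto)
  then have 2: "totbdd (\<lambda>g h. (\<integral>x. (b i x)\<^sup>2 \<partial>M) * (a i g - a i h)\<^sup>2)"
  proof (rule totbdd_mono[where c = "(\<integral>x. (b i x)\<^sup>2 \<partial>M) + 1"])
    show "(\<integral>x. (b i x)\<^sup>2 \<partial>M) * (a i g - a i h)\<^sup>2 \<le> ((\<integral>x. (b i x)\<^sup>2 \<partial>M) + 1) * (a i g - a i h)\<^sup>2" for g h
      by (intro mult_right_mono) auto
    show "0 < (\<integral>x. (b i x)\<^sup>2 \<partial>M) + 1" by (rule add_nonneg_pos) auto
  qed
  show ?case
  proof (rule totbdd_add[OF 1 2, of _ 2])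
    fix g h
    have bi: "bdd_meas (b i)" and bs: "\<And>g. bdd_meas (?s g)" using insert.prems by (auto intro!: bdd_meas_intros)
    have "(\<integral>x. ((\<Sum>j\<in>insert i J. b j x * a j g) - (\<Sum>j\<in>insert i J. b j x * a j h))\<^sup>2 \<partial>M)
       \<le> (\<integral>x. 2 * ((?s g x - ?s h x)\<^sup>2 + (b i x)\<^sup>2 * (a i g - a i h)\<^sup>2) \<partial>M)"
    proof (intro integral_mono bdd_meas_integrable)
      fix x
      have "(\<Sum>j\<in>insert i J. b j x * a j g) - (\<Sum>j\<in>insert i J. b j x * a j h) =
          (?s g x - ?s h x) - - (b i x * (a i g - a i h))"
        using insert.hyps by (simp add: algebra_simps)
      then show "((\<Sum>j\<in>insert i J. b j x * a j g) - (\<Sum>j\<in>insert i J. b j x * a j h))\<^sup>2 \<le>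
          2 * ((?s g x - ?s h x)\<^sup>2 + (b i x)\<^sup>2 * (a i g - a i h)\<^sup>2)"
        using sq_diff_tri[of "?s g x - ?s h x" "- (b i x * (a i g - a i h))" 0] by (simp add: power_mult_distrib)
    qed (intro bdd_meas_intros bs bi insert.prems(1); simp)+
    also have "\<dots> = 2 * ((\<integral>x. (?s g x - ?s h x)\<^sup>2 \<partial>M) + (\<integral>x. (b i x)\<^sup>2 \<partial>M) * (a i g - a i h)\<^sup>2)"
      by (subst integral_mult_right_zero, subst Bochner_Integration.integral_add)
        (auto intro!: bdd_meas_integrable bdd_meas_intros bs bi)
    finally show "(\<integral>x. ((\<Sum>j\<in>insert i J. b j x * a j g) - (\<Sum>j\<in>insert i J. b j x * a j h))\<^sup>2 \<partial>M)
       \<le> 2 * ((\<integral>x. (?s g x - ?s h x)\<^sup>2 \<partial>M) + (\<integral>x. (b i x)\<^sup>2 \<partial>M) * (a i g - a i h)\<^sup>2)" .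
  qed simp
qed

end

section \<open>Weak mixing on the orthogonal complement\<close>

lemma half_sum_sq: "((a + b) / 2)\<^sup>2 \<le> a\<^sup>2 + b\<^sup>2" for a b :: real
proof -
  have "a\<^sup>2 + b\<^sup>2 - ((a + b) / 2)\<^sup>2 = ((a - b) / 2)\<^sup>2 + (a\<^sup>2 + b\<^sup>2) / 2"
    by (simp add: power2_eq_square field_simps)
  moreover have "0 \<le> ((a - b) / 2)\<^sup>2 + (a\<^sup>2 + b\<^sup>2) / 2" by simp
  ultimately show ?thesis by linarith
qed

context measure_preserving_action begin

interpretation PP: pair_prob_space M M ..

text \<open>Closure under midpoints suffices: by the parallelogram identity, norm-minimising sequences in the
  hull of the translates of a kernel are then Cauchy, so their limits are invariant.\<close>

inductive_set mid_hull :: "('b \<Rightarrow> 'a \<Rightarrow> real) \<Rightarrow> 'b set \<Rightarrow> ('a \<times> 'a \<Rightarrow> real) set"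
  for \<phi> J where
  base: "(\<lambda>p. \<Sum>j\<in>J. \<phi> j (T g (fst p)) * \<phi> j (T g (snd p))) \<in> mid_hull \<phi> J"
| mid: "F \<in> mid_hull \<phi> J \<Longrightarrow> F' \<in> mid_hull \<phi> J \<Longrightarrow> (\<lambda>p. (F p + F' p) / 2) \<in> mid_hull \<phi> J"

lemma mid_hull_T: "F \<in> mid_hull \<phi> J \<Longrightarrow> (\<lambda>p. F (T h (fst p), T h (snd p))) \<in> mid_hull \<phi> J"
proof (induction rule: mid_hull.induct)
  case (base g)
  show ?case using mid_hull.base[where g = "g + h"] by (simp add: T_add)
next
  case (mid F F')
  then show ?case by (auto dest: mid_hull.mid)
qed

lemma kernel_op_mid:
  assumes F: "PP.bdd_meas F" "PP.bdd_meas F'" and \<psi>: "bdd_meas \<psi>"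
  shows "kernel_op (\<lambda>p. (F p + F' p) / 2) \<psi> x = (kernel_op F \<psi> x + kernel_op F' \<psi> x) / 2"
proof -
  have "kernel_op (\<lambda>p. (F p + F' p) / 2) \<psi> x = (\<integral>y. (F (x, y) * \<psi> y + F' (x, y) * \<psi> y) / 2 \<partial>M)"
    unfolding kernel_op_def by (simp add: field_simps)
  also have "\<dots> = (\<integral>y. F (x, y) * \<psi> y + F' (x, y) * \<psi> y \<partial>M) / 2"
    by (rule integral_divide_zero)
  also have "(\<integral>y. F (x, y) * \<psi> y + F' (x, y) * \<psi> y \<partial>M) = kernel_op F \<psi> x + kernel_op F' \<psi> x"
    unfolding kernel_op_def
    by (intro Bochner_Integration.integral_add bdd_meas_integrable bdd_meas_intros bdd_meas_section[OF F(1)] bdd_meas_section[OF F(2)] \<psi>)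
  finally show ?thesis .
qed

context
  fixes \<phi> :: "'b \<Rightarrow> 'a \<Rightarrow> real" and J :: "'b set"
  assumes J: "finite J" and kron_orth: "\<And>j. j \<in> J \<Longrightarrow> kron_orth (\<phi> j)"
begin

lemma bdd_meas_\<phi>: "j \<in> J \<Longrightarrow> bdd_meas (\<phi> j)" using kron_orth unfolding kron_orth_def by blast

lemma mid_hull_bdd_meas: "F \<in> mid_hull \<phi> J \<Longrightarrow> PP.bdd_meas F"
  by (induction rule: mid_hull.induct) (auto intro!: PP.bdd_meas_sum PP_bdd_meas_prod bdd_meas_T bdd_meas_\<phi> PP.bdd_meas_divide PP.bdd_meas_add)

lemma kernel_op_base:
  assumes \<psi>: "bdd_meas \<psi>"
  shows "kernel_op (\<lambda>p. \<Sum>j\<in>J. \<phi> j (T g (fst p)) * \<phi> j (T g (snd p))) \<psi> x =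
    (\<Sum>j\<in>J. \<phi> j (T g x) * (\<integral>y. \<phi> j (T g y) * \<psi> y \<partial>M))"
proof -
  have "kernel_op (\<lambda>p. \<Sum>j\<in>J. \<phi> j (T g (fst p)) * \<phi> j (T g (snd p))) \<psi> x =
      (\<integral>y. (\<Sum>j\<in>J. \<phi> j (T g x) * (\<phi> j (T g y) * \<psi> y)) \<partial>M)"
    unfolding kernel_op_def by (simp add: sum_distrib_right mult.assoc)
  also have "\<dots> = (\<Sum>j\<in>J. \<integral>y. \<phi> j (T g x) * (\<phi> j (T g y) * \<psi> y) \<partial>M)"
    by (intro Bochner_Integration.integral_sum bdd_meas_integrable bdd_meas_intros bdd_meas_T bdd_meas_\<phi> \<psi>)
  finally show ?thesis by simp
qed

text \<open>Midpoints do not increase a supremum bound. A bound valid on the whole hull is what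
  \<open>L2_limit\<close> requires of the images along a sequence of kernels.\<close>

lemma mid_hull_bound: "\<exists>c. \<forall>F\<in>mid_hull \<phi> J. \<forall>p. \<bar>F p\<bar> \<le> c"
proof -
  have "\<forall>j\<in>J. \<exists>c. \<forall>x. \<bar>\<phi> j x\<bar> \<le> c" using bdd_meas_\<phi> unfolding bdd_meas_def by blast
  then obtain c where c: "\<And>j x. j \<in> J \<Longrightarrow> \<bar>\<phi> j x\<bar> \<le> c j" by metis
  have "\<bar>F p\<bar> \<le> (\<Sum>j\<in>J. c j * c j)" if "F \<in> mid_hull \<phi> J" for F p
    using that
  proof (induction arbitrary: p rule: mid_hull.induct)
    case (base g)
    have "\<bar>\<Sum>j\<in>J. \<phi> j (T g (fst p)) * \<phi> j (T g (snd p))\<bar> \<le> (\<Sum>j\<in>J. \<bar>\<phi> j (T g (fst p)) * \<phi> j (T g (snd p))\<bar>)"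
      by (rule sum_abs)
    also have "\<dots> \<le> (\<Sum>j\<in>J. c j * c j)"
      unfolding abs_mult by (intro sum_mono mult_mono c) (auto intro: order_trans[OF abs_ge_zero c])
    finally show ?case .
  next
    case (mid F F')
    have "\<bar>F p + F' p\<bar> \<le> \<bar>F p\<bar> + \<bar>F' p\<bar>" by simp
    then show ?case using mid(3,4)[of p] by simp
  qed
  then show ?thesis by blast
qed

text \<open>The image under a base kernel is a combination of translates of the
  \<open>\<phi> j\<close>. Moving the translation to the other factor leaves an almost periodic
  function there, to which \<open>\<phi> j\<close> is orthogonal; midpoints follow by
  linearity.\<close>

lemma mid_hull_orth:
  assumes F: "F \<in> mid_hull \<phi> J" and f: "almost_periodic f" and \<psi>: "bdd_meas \<psi>"
  shows "(\<integral>x. kernel_op F \<psi> x * f x \<partial>M) = 0"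
  using F
proof (induction rule: mid_hull.induct)
  case (base g)
  let ?a = "\<lambda>j. \<integral>y. \<phi> j (T g y) * \<psi> y \<partial>M"
  have bf: "bdd_meas f" using f by (rule almost_periodic_bdd_meas)
  note kernel_op = kernel_op_base[OF \<psi>, of g]
  have "(\<integral>x. \<phi> j (T g x) * f x \<partial>M) = 0" if j: "j \<in> J" for j
  proof -
    have "(\<integral>x. \<phi> j (T g x) * f x \<partial>M) = (\<integral>x. (\<lambda>x. \<phi> j x * f (T (- g) x)) (T g x) \<partial>M)"
      using T_add[of "- g" g] by (simp add: T_0)
    also have "\<dots> = (\<integral>x. f (T (- g) x) * \<phi> j x \<partial>M)"
      by (subst integral_T[OF bdd_meas_measurable]) (auto intro!: bdd_meas_intros bdd_meas_T bdd_meas_\<phi> bf j simp: mult.commute)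
    also have "\<dots> = 0" by (rule almost_periodic_orth[OF almost_periodic_shift[OF f] kron_orth[OF j]])
    finally show ?thesis .
  qed
  moreover have "(\<integral>x. (\<Sum>j\<in>J. \<phi> j (T g x) * ?a j) * f x \<partial>M) = (\<integral>x. (\<Sum>j\<in>J. ?a j * (\<phi> j (T g x) * f x)) \<partial>M)"
    by (simp add: sum_distrib_right mult.assoc mult.left_commute)
  moreover have "\<dots> = (\<Sum>j\<in>J. \<integral>x. ?a j * (\<phi> j (T g x) * f x) \<partial>M)"
    by (intro Bochner_Integration.integral_sum bdd_meas_integrable bdd_meas_intros bdd_meas_T bdd_meas_\<phi> bf)
  ultimately show ?case unfolding kernel_op by simp
next
  case (mid F F')
  note kernel_op = kernel_op_mid[OF mid_hull_bdd_meas[OF mid(1)] mid_hull_bdd_meas[OF mid(2)] \<psi>]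
  have "(\<integral>x. (kernel_op F \<psi> x + kernel_op F' \<psi> x) / 2 * f x \<partial>M) =
     (\<integral>x. kernel_op F \<psi> x * f x / 2 + kernel_op F' \<psi> x * f x / 2 \<partial>M)"
    by (simp add: algebra_simps add_divide_distrib)
  also have "\<dots> = (\<integral>x. kernel_op F \<psi> x * f x / 2 \<partial>M) + (\<integral>x. kernel_op F' \<psi> x * f x / 2 \<partial>M)"
    by (intro Bochner_Integration.integral_add bdd_meas_integrable bdd_meas_intros bdd_meas_op \<psi> mid_hull_bdd_meas mid almost_periodic_bdd_meas f)
  finally show ?case unfolding kernel_op using mid.IH by simp
qed

text \<open>Every kernel of the hull has finite rank, and translating \<psi> changes only the
  coefficients, which are bounded uniformly in the group element.\<close>

lemma mid_hull_totbdd: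
  assumes F: "F \<in> mid_hull \<phi> J" and \<psi>: "bdd_meas \<psi>"
  shows "totbdd (\<lambda>g h. \<integral>x. (kernel_op F (\<lambda>y. \<psi> (T g y)) x - kernel_op F (\<lambda>y. \<psi> (T h y)) x)\<^sup>2 \<partial>M)"
  using F
proof (induction rule: mid_hull.induct)
  case (base k)
  let ?a = "\<lambda>j g. \<integral>y. \<phi> j (T k y) * \<psi> (T g y) \<partial>M"
  note kernel_op = kernel_op_base[OF bdd_meas_T[OF \<psi>], of k]
  have "\<exists>c. \<forall>g. \<bar>?a j g\<bar> \<le> c" if j: "j \<in> J" for j
  proof -
    obtain c1 where c1: "\<And>x. \<bar>\<phi> j x\<bar> \<le> c1" using bdd_meas_\<phi>[OF j] unfolding bdd_meas_def by blast
    obtain c2 where c2: "\<And>x. \<bar>\<psi> x\<bar> \<le> c2" using \<psi> unfolding bdd_meas_def by blast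
    have "\<bar>?a j g\<bar> \<le> c1 * c2" for g
    proof -
      have "\<bar>?a j g\<bar> \<le> (\<integral>y. \<bar>\<phi> j (T k y) * \<psi> (T g y)\<bar> \<partial>M)" by (rule integral_abs_bound)
      also have "\<dots> \<le> (\<integral>y. c1 * c2 \<partial>M)"
      proof (rule integral_mono)
        show "\<bar>\<phi> j (T k y) * \<psi> (T g y)\<bar> \<le> c1 * c2" for y
          unfolding abs_mult by (intro mult_mono c1 c2) (auto intro: order_trans[OF abs_ge_zero c1])
        show "integrable M (\<lambda>y. \<bar>\<phi> j (T k y) * \<psi> (T g y)\<bar>)"
          by (intro integrable_abs bdd_meas_integrable bdd_meas_intros bdd_meas_T bdd_meas_\<phi> \<psi> j)
      qed simp
      finally show ?thesis by (simp add: prob_space)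
    qed
    then show ?thesis by blast
  qed
  then obtain c where c: "\<And>j g. j \<in> J \<Longrightarrow> \<bar>?a j g\<bar> \<le> c j" by metis
  show ?case unfolding kernel_op by (rule totbdd_sum[where c = c, OF J]) (auto intro: bdd_meas_T bdd_meas_\<phi> c)
next
  case (mid F F')
  have bd: "bdd_meas (kernel_op F (\<lambda>y. \<psi> (T g y)))" "bdd_meas (kernel_op F' (\<lambda>y. \<psi> (T g y)))" for g
    by (intro bdd_meas_op mid_hull_bdd_meas mid bdd_meas_T \<psi>)+
  note kernel_op = kernel_op_mid[OF mid_hull_bdd_meas[OF mid(1)] mid_hull_bdd_meas[OF mid(2)] bdd_meas_T[OF \<psi>]]
  show ?case
  proof (rule totbdd_add[OF mid.IH, of _ 1])
    fix g h
    let ?u = "\<lambda>x. kernel_op F (\<lambda>y. \<psi> (T g y)) x - kernel_op F (\<lambda>y. \<psi> (T h y)) x"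
    let ?v = "\<lambda>x. kernel_op F' (\<lambda>y. \<psi> (T g y)) x - kernel_op F' (\<lambda>y. \<psi> (T h y)) x"
    have "(\<integral>x. (kernel_op (\<lambda>p. (F p + F' p) / 2) (\<lambda>y. \<psi> (T g y)) x - kernel_op (\<lambda>p. (F p + F' p) / 2) (\<lambda>y. \<psi> (T h y)) x)\<^sup>2 \<partial>M)
      \<le> (\<integral>x. (?u x)\<^sup>2 + (?v x)\<^sup>2 \<partial>M)"
    proof (intro integral_mono bdd_meas_integrable)
      fix x
      have "kernel_op (\<lambda>p. (F p + F' p) / 2) (\<lambda>y. \<psi> (T g y)) x - kernel_op (\<lambda>p. (F p + F' p) / 2) (\<lambda>y. \<psi> (T h y)) x
          = (?u x + ?v x) / 2" unfolding kernel_op by (simp add: field_simps)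
      moreover have "((?u x + ?v x) / 2)\<^sup>2 \<le> (?u x)\<^sup>2 + (?v x)\<^sup>2"
        by (rule half_sum_sq)
      ultimately show "(kernel_op (\<lambda>p. (F p + F' p) / 2) (\<lambda>y. \<psi> (T g y)) x -
          kernel_op (\<lambda>p. (F p + F' p) / 2) (\<lambda>y. \<psi> (T h y)) x)\<^sup>2 \<le> (?u x)\<^sup>2 + (?v x)\<^sup>2" by presburger
    qed (unfold kernel_op, (intro bdd_meas_intros bd)+)
    also have "\<dots> = 1 * ((\<integral>x. (?u x)\<^sup>2 \<partial>M) + (\<integral>x. (?v x)\<^sup>2 \<partial>M))"
      by (subst Bochner_Integration.integral_add) (auto intro!: bdd_meas_integrable bdd_meas_intros bd)
    finally show "(\<integral>x. (kernel_op (\<lambda>p. (F p + F' p) / 2) (\<lambda>y. \<psi> (T g y)) x - kernel_op (\<lambda>p. (F p + F' p) / 2) (\<lambda>y. \<psi> (T h y)) x)\<^sup>2 \<partial>M)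
      \<le> 1 * ((\<integral>x. (?u x)\<^sup>2 \<partial>M) + (\<integral>x. (?v x)\<^sup>2 \<partial>M))" .
  qed simp
qed

text \<open>For a base kernel the quadratic form at \<open>\<psi> b\<close> is exactly the sum over
  \<open>j\<close> of squared correlations. The form is linear in the kernel, so a bound valid for
  all translates passes to the hull.\<close>

lemma mid_hull_lower:
  assumes F: "F \<in> mid_hull \<phi> J" and \<psi>: "\<And>b. b \<in> B \<Longrightarrow> bdd_meas (\<psi> b)"
    and low: "\<And>g. e \<le> (\<Sum>b\<in>B. \<Sum>j\<in>J. (\<integral>x. \<phi> j (T g x) * \<psi> b x \<partial>M)\<^sup>2)"
  shows "e \<le> (\<Sum>b\<in>B. \<integral>x. kernel_op F (\<psi> b) x * \<psi> b x \<partial>M)"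
  using F
proof (induction rule: mid_hull.induct)
  case (base g)
  have "(\<integral>x. kernel_op (\<lambda>p. \<Sum>j\<in>J. \<phi> j (T g (fst p)) * \<phi> j (T g (snd p))) (\<psi> b) x * \<psi> b x \<partial>M) =
      (\<Sum>j\<in>J. (\<integral>x. \<phi> j (T g x) * \<psi> b x \<partial>M)\<^sup>2)" if b: "b \<in> B" for b
  proof -
    let ?a = "\<lambda>j. \<integral>y. \<phi> j (T g y) * \<psi> b y \<partial>M"
    note kernel_op = kernel_op_base[OF \<psi>[OF b], of g]
    have "(\<integral>x. (\<Sum>j\<in>J. \<phi> j (T g x) * ?a j) * \<psi> b x \<partial>M) = (\<integral>x. (\<Sum>j\<in>J. ?a j * (\<phi> j (T g x) * \<psi> b x)) \<partial>M)"
      by (simp add: sum_distrib_right mult.assoc mult.left_commute)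
    also have "\<dots> = (\<Sum>j\<in>J. \<integral>x. ?a j * (\<phi> j (T g x) * \<psi> b x) \<partial>M)"
      by (intro Bochner_Integration.integral_sum bdd_meas_integrable bdd_meas_intros bdd_meas_T bdd_meas_\<phi> \<psi> b)
    finally show ?thesis unfolding kernel_op by (simp add: power2_eq_square)
  qed
  then show ?case using low[of g] by simp
next
  case (mid F F')
  have "(\<integral>x. kernel_op (\<lambda>p. (F p + F' p) / 2) (\<psi> b) x * \<psi> b x \<partial>M) =
    (\<integral>x. kernel_op F (\<psi> b) x * \<psi> b x \<partial>M) / 2 + (\<integral>x. kernel_op F' (\<psi> b) x * \<psi> b x \<partial>M) / 2" if b: "b \<in> B" for b
  proof -
    note kernel_op = kernel_op_mid[OF mid_hull_bdd_meas[OF mid(1)] mid_hull_bdd_meas[OF mid(2)] \<psi>[OF b]]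
    have "(\<integral>x. kernel_op (\<lambda>p. (F p + F' p) / 2) (\<psi> b) x * \<psi> b x \<partial>M) =
       (\<integral>x. kernel_op F (\<psi> b) x * \<psi> b x / 2 + kernel_op F' (\<psi> b) x * \<psi> b x / 2 \<partial>M)"
      unfolding kernel_op by (simp add: algebra_simps add_divide_distrib)
    also have "\<dots> = (\<integral>x. kernel_op F (\<psi> b) x * \<psi> b x / 2 \<partial>M) + (\<integral>x. kernel_op F' (\<psi> b) x * \<psi> b x / 2 \<partial>M)"
      by (intro Bochner_Integration.integral_add bdd_meas_integrable bdd_meas_intros bdd_meas_op \<psi> mid_hull_bdd_meas mid b)
    finally show ?thesis by simp
  qed
  then have "(\<Sum>b\<in>B. \<integral>x. kernel_op (\<lambda>p. (F p + F' p) / 2) (\<psi> b) x * \<psi> b x \<partial>M) =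
      (\<Sum>b\<in>B. \<integral>x. kernel_op F (\<psi> b) x * \<psi> b x \<partial>M) / 2 + (\<Sum>b\<in>B. \<integral>x. kernel_op F' (\<psi> b) x * \<psi> b x \<partial>M) / 2"
    by (simp add: sum.distrib sum_divide_distrib)
  then show ?case using mid.IH by simp
qed

text \<open>Parallelogram identity: the midpoint again lies in the hull, so its squared norm cannot
  fall below the infimum, and this caps the difference of two almost minimal kernels.\<close>

lemma mid_hull_minimizing:
  assumes "F \<in> mid_hull \<phi> J" "F' \<in> mid_hull \<phi> J" "hs_norm2 F \<le> Inf (hs_norm2 ` mid_hull \<phi> J) + r" "hs_norm2 F' \<le> Inf (hs_norm2 ` mid_hull \<phi> J) + r"
  shows "hs_norm2 (\<lambda>p. F p - F' p) \<le> 4 * r"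
proof -
  let ?m = "\<lambda>p. (F p + F' p) / 2"
  have b: "PP.bdd_meas F" "PP.bdd_meas F'" using assms mid_hull_bdd_meas by auto
  have "Inf (hs_norm2 ` mid_hull \<phi> J) \<le> hs_norm2 ?m"
    by (rule cInf_lower) (auto intro!: imageI mid_hull.mid assms bdd_belowI[of _ 0] simp: hs_norm2_def)
  moreover have "hs_norm2 (\<lambda>p. F p - F' p) = 2 * hs_norm2 F + 2 * hs_norm2 F' - 4 * hs_norm2 ?m"
  proof -
    have "hs_norm2 (\<lambda>p. F p - F' p) + 4 * hs_norm2 ?m = (\<integral>p. (F p - F' p)\<^sup>2 + 4 * (?m p)\<^sup>2 \<partial>(M \<Otimes>\<^sub>M M))"
      unfolding hs_norm2_def
      by (subst Bochner_Integration.integral_add) (auto intro!: PP.bdd_meas_integrable PP.bdd_meas_intros b)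
    also have "\<dots> = (\<integral>p. 2 * (F p)\<^sup>2 + 2 * (F' p)\<^sup>2 \<partial>(M \<Otimes>\<^sub>M M))"
      by (intro Bochner_Integration.integral_cong refl) (simp add: power2_eq_square field_simps)
    also have "\<dots> = 2 * hs_norm2 F + 2 * hs_norm2 F'"
      unfolding hs_norm2_def
      by (subst Bochner_Integration.integral_add) (auto intro!: PP.bdd_meas_integrable PP.bdd_meas_intros b)
    finally show ?thesis by simp
  qed
  ultimately show ?thesis using assms(3,4) by argo
qed

text \<open>By contradiction: a positive lower bound would persist on the hull, yet along a
  norm-minimising sequence of kernels the images of every \<open>\<psi> b\<close> tend to 0 in
  \<open>L2\<close>.\<close>

lemma not_bounded_below:
  assumes B: "finite B" and \<psi>: "\<And>b. b \<in> B \<Longrightarrow> bdd_meas (\<psi> b)" "\<And>b x. b \<in> B \<Longrightarrow> \<bar>\<psi> b x\<bar> \<le> 1" and e: "e > 0"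
  shows "\<exists>g. (\<Sum>b\<in>B. \<Sum>j\<in>J. (\<integral>x. \<phi> j (T g x) * \<psi> b x \<partial>M)\<^sup>2) < e"
proof (rule ccontr)
  assume "\<not> ?thesis"
  then have low: "e \<le> (\<Sum>b\<in>B. \<Sum>j\<in>J. (\<integral>x. \<phi> j (T g x) * \<psi> b x \<partial>M)\<^sup>2)" for g
    by (meson not_le)
  let ?\<delta> = "Inf (hs_norm2 ` mid_hull \<phi> J)"
  \<comment> \<open>This rate turns \<open>mid_hull_minimizing\<close> into the increment bound of
    \<open>L2_limit\<close> with \<open>C = 4\<close>.\<close>
  have "\<exists>F\<in>mid_hull \<phi> J. hs_norm2 F \<le> ?\<delta> + (1/16)^n" for n :: nat
  proof -
    have "hs_norm2 ` mid_hull \<phi> J \<noteq> {}" using mid_hull.base by blast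
    moreover have "?\<delta> < ?\<delta> + (1/16)^n" by simp
    ultimately obtain r where "r \<in> hs_norm2 ` mid_hull \<phi> J" "r < ?\<delta> + (1/16)^n" by (rule cInf_lessD[THEN bexE])
    then show ?thesis by force
  qed
  then obtain F where F: "\<And>n. F n \<in> mid_hull \<phi> J" "\<And>n::nat. hs_norm2 (F n) \<le> ?\<delta> + (1/16)^n" by metis
  have Fb: "PP.bdd_meas (F n)" for n by (rule mid_hull_bdd_meas[OF F(1)])
  obtain c where c: "\<And>F p. F \<in> mid_hull \<phi> J \<Longrightarrow> \<bar>F p\<bar> \<le> c" using mid_hull_bound by blast
  have lim0: "(\<lambda>n. \<integral>x. (kernel_op (F n) (\<psi> b) x)\<^sup>2 \<partial>M) \<longlonglongrightarrow> 0" if b: "b \<in> B" for b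
  proof -
    let ?u = "\<lambda>n. kernel_op (F n) (\<psi> b)"
    note \<psi>b = \<psi>(1)[OF b] \<psi>(2)[OF b]
    have ub: "bdd_meas (?u n)" for n by (rule bdd_meas_op[OF Fb \<psi>b(1)])
    have "\<exists>f. bdd_meas f \<and> (\<lambda>n. \<integral>x. (?u n x - f x)\<^sup>2 \<partial>M) \<longlonglongrightarrow> 0"
    proof (rule L2_limit[OF ub, where C = 4])
      show "\<bar>?u n x\<bar> \<le> c" for n x by (rule kernel_op_bound[OF Fb \<psi>b c[OF F(1)]])
      show "(\<integral>x. (?u n x - ?u (Suc n) x)\<^sup>2 \<partial>M) \<le> 4 * (1/16)^n" for n
      proof -
        have "hs_norm2 (F (Suc n)) \<le> ?\<delta> + (1/16)^n" using F(2)[of "Suc n"] by (rule order_trans) simp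
        then have "hs_norm2 (\<lambda>p. F n p - F (Suc n) p) \<le> 4 * (1/16)^n"
          by (intro mid_hull_minimizing F)
        then show ?thesis using kernel_op_diff_le[OF Fb Fb \<psi>b, of n "Suc n"] by linarith
      qed
    qed
    then obtain f where f: "bdd_meas f" "(\<lambda>n. \<integral>x. (?u n x - f x)\<^sup>2 \<partial>M) \<longlonglongrightarrow> 0" by blast
    \<comment> \<open>A translate of \<open>f\<close> is close to the image of a translate of \<open>\<psi> b\<close> under the operator of \<open>F n\<close>,
      because \<open>F n\<close> is almost invariant; and this operator has finite rank.\<close>
    have "almost_periodic f"
      unfolding almost_periodic_def
    proof (intro conjI f totbdd_approx)
      fix e :: real assume e: "e > 0"
      have "(\<lambda>n. (\<integral>x. (?u n x - f x)\<^sup>2 \<partial>M) + 4 * (1/16)^n) \<longlonglongrightarrow> 0 + 4 * 0"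
        by (intro tendsto_intros f LIMSEQ_power_zero) simp
      \<comment> \<open>With errors below \<open>e / 50\<close> in each elementary comparison, the
        nested factor-2 triangle inequalities add up to \<open>28 * (e / 50)\<close>.\<close>
      from order_tendstoD(2)[OF this, of "e / 50"] e
      obtain n where "(\<integral>x. (?u n x - f x)\<^sup>2 \<partial>M) + 4 * (1/16)^n < e / 50"
        by (auto simp: eventually_sequentially)
      moreover have "0 \<le> (\<integral>x. (?u n x - f x)\<^sup>2 \<partial>M)" by simp
      moreover have "(0::real) \<le> 4 * (1/16)^n" by simp
      ultimately have n: "(\<integral>x. (?u n x - f x)\<^sup>2 \<partial>M) < e / 50" "4 * (1/16)^n < e / 50" by linarith+
      let ?w = "\<lambda>g. kernel_op (F n) (\<lambda>y. \<psi> b (T g y))"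
      have wb: "bdd_meas (?w g)" for g by (intro bdd_meas_op Fb bdd_meas_T \<psi>b)
      have A: "(\<integral>x. (f (T g x) - ?u n (T g x))\<^sup>2 \<partial>M) < e / 50" for g
      proof -
        have "(\<integral>x. (?u n (T g x) - f (T g x))\<^sup>2 \<partial>M) = (\<integral>x. (?u n x - f x)\<^sup>2 \<partial>M)"
          by (rule integral_T[OF bdd_meas_measurable[OF bdd_meas_power2[OF bdd_meas_diff[OF ub f(1)]]]])
        then show ?thesis using n(1) by (simp add: power2_commute)
      qed
      have Bd: "(\<integral>x. (?u n (T g x) - ?w g x)\<^sup>2 \<partial>M) < e / 50" for g
      proof -
        let ?G = "\<lambda>p. F n (T g (fst p), T g (snd p))"
        have G: "?G \<in> mid_hull \<phi> J" by (rule mid_hull_T[OF F(1)])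
        have "?u n (T g x) = kernel_op ?G (\<lambda>y. \<psi> b (T g y)) x" for x by (rule kernel_op_T[OF Fb \<psi>b(1)])
        then have "(\<integral>x. (?u n (T g x) - ?w g x)\<^sup>2 \<partial>M) = (\<integral>x. (kernel_op ?G (\<lambda>y. \<psi> b (T g y)) x - ?w g x)\<^sup>2 \<partial>M)"
          by simp
        also have "\<dots> \<le> hs_norm2 (\<lambda>p. ?G p - F n p)"
          by (intro kernel_op_diff_le Fb mid_hull_bdd_meas[OF G] bdd_meas_T \<psi>b)
        \<comment> \<open>The translated kernel lies in the hull and has the same norm, so both
          kernels are almost minimal and therefore close to each other.\<close>
        also have "\<dots> \<le> 4 * (1/16)^n"
          using F(2)[of n] hs_norm2_T[OF Fb, of n g] by (intro mid_hull_minimizing G F) simp_all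
        finally show ?thesis using n(2) by linarith
      qed
      have C: "(\<integral>x. (f (T g x) - ?w g x)\<^sup>2 \<partial>M) < 4 * (e / 50)" for g
        using integral_sq_tri[OF bdd_meas_T[OF f(1), of g] bdd_meas_T[OF ub[of n], of g] wb[of g]] A[of g] Bd[of g] by argo
      have "shift_dist f g h < e" if "(\<integral>x. (?w g x - ?w h x)\<^sup>2 \<partial>M) < e / 50" for g h
      proof -
        have "(\<integral>x. (?w g x - f (T h x))\<^sup>2 \<partial>M) \<le> 2 * ((\<integral>x. (?w g x - ?w h x)\<^sup>2 \<partial>M) + (\<integral>x. (?w h x - f (T h x))\<^sup>2 \<partial>M))"
          by (rule integral_sq_tri[OF wb wb bdd_meas_T[OF f(1)]])
        moreover have "(\<integral>x. (?w h x - f (T h x))\<^sup>2 \<partial>M) < 4 * (e / 50)"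
          using C[of h] by (simp add: power2_commute)
        moreover have "shift_dist f g h \<le> 2 * ((\<integral>x. (f (T g x) - ?w g x)\<^sup>2 \<partial>M) + (\<integral>x. (?w g x - f (T h x))\<^sup>2 \<partial>M))"
          unfolding shift_dist_def by (rule integral_sq_tri[OF bdd_meas_T[OF f(1)] wb bdd_meas_T[OF f(1)]])
        ultimately show ?thesis using C[of g] that e by argo
      qed
      then show "\<exists>d' \<delta>. \<delta> > 0 \<and> totbdd d' \<and> (\<forall>g h. d' g h < \<delta> \<longrightarrow> shift_dist f g h < e)"
        using mid_hull_totbdd[OF F(1)[of n] \<psi>b(1)] e
        by (intro exI[of _ "\<lambda>g h. \<integral>x. (?w g x - ?w h x)\<^sup>2 \<partial>M"] exI[of _ "e / 50"]) auto
    qed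
    \<comment> \<open>Being almost periodic, \<open>f\<close> is orthogonal to the very images that
      converge to it. By Pythagoras the norm of \<open>?u n\<close> is at most its distance to
      \<open>f\<close>, which tends to 0.\<close>
    then have o: "(\<integral>x. ?u n x * f x \<partial>M) = 0" for n by (rule mid_hull_orth[OF F(1) _ \<psi>b(1)])
    have "(\<integral>x. (?u n x - f x)\<^sup>2 \<partial>M) = (\<integral>x. (?u n x)\<^sup>2 \<partial>M) + (\<integral>x. (f x)\<^sup>2 \<partial>M)" for n
    proof -
      have "(\<integral>x. (?u n x - f x)\<^sup>2 \<partial>M) = (\<integral>x. (?u n x)\<^sup>2 + (f x)\<^sup>2 - 2 * (?u n x * f x) \<partial>M)"
        by (simp add: power2_diff mult.assoc)
      also have "\<dots> = (\<integral>x. (?u n x)\<^sup>2 + (f x)\<^sup>2 \<partial>M) - (\<integral>x. 2 * (?u n x * f x) \<partial>M)"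
        by (intro Bochner_Integration.integral_diff bdd_meas_integrable bdd_meas_intros ub f)
      also have "(\<integral>x. (?u n x)\<^sup>2 + (f x)\<^sup>2 \<partial>M) = (\<integral>x. (?u n x)\<^sup>2 \<partial>M) + (\<integral>x. (f x)\<^sup>2 \<partial>M)"
        by (intro Bochner_Integration.integral_add bdd_meas_integrable bdd_meas_intros ub f)
      finally show ?thesis using o[of n] by simp
    qed
    then show ?thesis
      by (intro tendsto_sandwich[OF _ _ tendsto_const f(2), of "\<lambda>n. \<integral>x. (?u n x)\<^sup>2 \<partial>M"]) auto
  qed
  have "(\<lambda>n. \<integral>x. kernel_op (F n) (\<psi> b) x * \<psi> b x \<partial>M) \<longlonglongrightarrow> 0" if b: "b \<in> B" for b
  proof (rule tendsto_rabs_zero_cancel, rule tendsto_sandwich[OF _ _ tendsto_const])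
    show "(\<lambda>n. sqrt (\<integral>x. (kernel_op (F n) (\<psi> b) x)\<^sup>2 \<partial>M)) \<longlonglongrightarrow> 0"
      using tendsto_real_sqrt[OF lim0[OF b]] by simp
    show "\<forall>\<^sub>F n in sequentially. \<bar>\<integral>x. kernel_op (F n) (\<psi> b) x * \<psi> b x \<partial>M\<bar> \<le> sqrt (\<integral>x. (kernel_op (F n) (\<psi> b) x)\<^sup>2 \<partial>M)"
    proof (intro always_eventually allI real_le_rsqrt)
      fix n
      have ub: "bdd_meas (kernel_op (F n) (\<psi> b))" by (rule bdd_meas_op[OF Fb \<psi>(1)[OF b]])
      have "(\<integral>x. kernel_op (F n) (\<psi> b) x * \<psi> b x \<partial>M)\<^sup>2 \<le> (\<integral>x. (kernel_op (F n) (\<psi> b) x)\<^sup>2 \<partial>M) * (\<integral>x. (\<psi> b x)\<^sup>2 \<partial>M)"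
        by (rule integral_mult_bound[OF ub \<psi>(1)[OF b]])
      also have "\<dots> \<le> (\<integral>x. (kernel_op (F n) (\<psi> b) x)\<^sup>2 \<partial>M) * 1"
      proof (rule mult_left_mono)
        have "(\<integral>x. (\<psi> b x)\<^sup>2 \<partial>M) \<le> (\<integral>x. 1 \<partial>M)"
          using \<psi>(2)[OF b] by (intro integral_mono bdd_meas_integrable bdd_meas_intros \<psi>(1)[OF b]) (simp add: abs_square_le_1)
        then show "(\<integral>x. (\<psi> b x)\<^sup>2 \<partial>M) \<le> 1" by (simp add: prob_space)
      qed simp
      finally show "\<bar>\<integral>x. kernel_op (F n) (\<psi> b) x * \<psi> b x \<partial>M\<bar>\<^sup>2 \<le> (\<integral>x. (kernel_op (F n) (\<psi> b) x)\<^sup>2 \<partial>M)" by simp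
    qed
  qed simp
  then have "(\<lambda>n. \<Sum>b\<in>B. \<integral>x. kernel_op (F n) (\<psi> b) x * \<psi> b x \<partial>M) \<longlonglongrightarrow> 0"
    by (rule tendsto_null_sum)
  moreover have "e \<le> (\<Sum>b\<in>B. \<integral>x. kernel_op (F n) (\<psi> b) x * \<psi> b x \<partial>M)" for n
    by (rule mid_hull_lower[OF F(1) \<psi>(1) low])
  ultimately have "e \<le> 0" by (intro LIMSEQ_le_const) auto
  then show False using e by simp
qed

end

text \<open>One group element serves all pairs \<open>j\<close>, \<open>b\<close>, because it is the
  sum of all the squared correlations that can be made small.\<close>

theorem weak_mixing:
  assumes J: "finite J" "\<And>j. j \<in> J \<Longrightarrow> kron_orth (\<phi> j)"
    and B: "finite B" "\<And>b. b \<in> B \<Longrightarrow> bdd_meas (\<psi> b)" "\<And>b x. b \<in> B \<Longrightarrow> \<bar>\<psi> b x\<bar> \<le> 1" and e: "e > 0"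
  shows "\<exists>g. \<forall>j\<in>J. \<forall>b\<in>B. \<bar>\<integral>x. \<phi> j (T g x) * \<psi> b x \<partial>M\<bar> < e"
proof -
  have "\<exists>g. (\<Sum>b\<in>B. \<Sum>j\<in>J. (\<integral>x. \<phi> j (T g x) * \<psi> b x \<partial>M)\<^sup>2) < e\<^sup>2"
    by (rule not_bounded_below) (use J B e in auto)
  then obtain g where g: "(\<Sum>b\<in>B. \<Sum>j\<in>J. (\<integral>x. \<phi> j (T g x) * \<psi> b x \<partial>M)\<^sup>2) < e\<^sup>2" ..
  have "\<bar>\<integral>x. \<phi> j (T g x) * \<psi> b x \<partial>M\<bar> < e" if j: "j \<in> J" and b: "b \<in> B" for j b
  proof -
    have "(\<integral>x. \<phi> j (T g x) * \<psi> b x \<partial>M)\<^sup>2 \<le> (\<Sum>j\<in>J. (\<integral>x. \<phi> j (T g x) * \<psi> b x \<partial>M)\<^sup>2)"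
      by (rule member_le_sum[OF j]) (use J in auto)
    also have "\<dots> \<le> (\<Sum>b\<in>B. \<Sum>j\<in>J. (\<integral>x. \<phi> j (T g x) * \<psi> b x \<partial>M)\<^sup>2)"
      by (rule member_le_sum[OF b, of "\<lambda>b. \<Sum>j\<in>J. (\<integral>x. \<phi> j (T g x) * \<psi> b x \<partial>M)\<^sup>2"]) (use B in \<open>auto intro: sum_nonneg\<close>)
    finally have "\<bar>\<integral>x. \<phi> j (T g x) * \<psi> b x \<partial>M\<bar>\<^sup>2 < e\<^sup>2" using g by simp
    then show ?thesis by (rule power2_less_imp_less) (use e in simp)
  qed
  then show ?thesis by blast
qed

end

section \<open>Entropy of finitely valued functions\<close>

definition eta :: "real \<Rightarrow> real" where "eta p = - (p * ln p)"

lemma eta_0 [simp]: "eta 0 = 0" and eta_1 [simp]: "eta 1 = 0" by (simp_all add: eta_def)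

lemma eta_nonneg: "0 \<le> p \<Longrightarrow> p \<le> 1 \<Longrightarrow> 0 \<le> eta p"
  unfolding eta_def by (cases "p = 0") (auto simp: mult_le_0_iff)

lemma eta_mult: "c \<ge> 0 \<Longrightarrow> p \<ge> 0 \<Longrightarrow> eta (c * p) = p * eta c + c * eta p"
  unfolding eta_def by (cases "c = 0 \<or> p = 0") (auto simp: ln_mult algebra_simps)

text \<open>From \<open>ln t \<le> t - 1\<close> at \<open>t = 1 / sqrt p\<close>. It yields
  continuity of \<open>eta\<close> at 0 and the uniform bound 2 on the unit interval.\<close>

lemma eta_le_sqrt: assumes "0 \<le> p" "p \<le> 1" shows "eta p \<le> 2 * sqrt p"
proof (cases "p = 0")
  case False
  then have p: "p > 0" using assms by simp
  have "ln (1 / sqrt p) \<le> 1 / sqrt p - 1" by (rule ln_le_minus_one) (use p in simp)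
  moreover have "ln (1 / sqrt p) = - (ln p / 2)" using p by (simp add: ln_div ln_sqrt)
  ultimately have "- ln p \<le> 2 * (1 / sqrt p)" by simp
  then have "p * (- ln p) \<le> p * (2 * (1 / sqrt p))" using p by (intro mult_left_mono) auto
  also have "\<dots> = 2 * sqrt p" using p real_sqrt_mult_self[of p] by (simp add: field_simps)
  finally show ?thesis by (simp add: eta_def)
qed simp

text \<open>The right-hand side is the tangent of the concave function \<open>eta\<close> at
  \<open>s\<close>. The Jensen and Gibbs type inequalities below all use it, each with its own
  choice of \<open>s\<close>.\<close>

lemma eta_tangent: assumes "s > 0" "t \<ge> 0" shows "eta t \<le> - t * ln s + (s - t)"
proof (cases "t = 0")
  case False
  then have t: "t > 0" using assms by simp
  have "ln (s / t) \<le> s / t - 1" by (rule ln_le_minus_one) (use assms t in simp)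
  then have "t * ln (s / t) \<le> t * (s / t - 1)" using t by (intro mult_left_mono) auto
  then show ?thesis using assms t by (simp add: ln_div eta_def algebra_simps)
qed (use assms in simp)


lemma continuous_eta: "continuous_on {0..1} eta"
  unfolding continuous_on_eq_continuous_within
proof
  fix p :: real assume p: "p \<in> {0..1}"
  show "continuous (at p within {0..1}) eta"
  proof (cases "p = 0")
    case True
    have "(eta \<longlongrightarrow> 0) (at 0 within {0..1})"
    proof (rule tendsto_sandwich)
      have ev: "\<forall>\<^sub>F x in at 0 within {0..1}. 0 \<le> x \<and> x \<le> (1::real)"
        by (auto simp: eventually_at_filter)
      show "\<forall>\<^sub>F x in at 0 within {0..1}. 0 \<le> eta x" using ev by eventually_elim (auto intro: eta_nonneg)
      show "\<forall>\<^sub>F x in at 0 within {0..1}. eta x \<le> 2 * sqrt x" using ev by eventually_elim (auto intro: eta_le_sqrt)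
      have "((\<lambda>x. 2 * sqrt x) \<longlongrightarrow> 2 * sqrt 0) (at 0 within {0..1})" by (intro tendsto_intros)
      then show "((\<lambda>x. 2 * sqrt x) \<longlongrightarrow> 0) (at 0 within {0..1})" by simp
    qed simp
    then show ?thesis using True by (simp add: continuous_within)
  next
    case False
    then have "isCont eta p" unfolding eta_def[abs_def] by (intro continuous_intros) auto
    then show ?thesis by (rule continuous_at_imp_continuous_at_within)
  qed
qed

lemma eta_uniform:
  assumes "e > 0"
  shows "\<exists>\<delta>>0. \<forall>p q. 0 \<le> p \<longrightarrow> p \<le> 1 \<longrightarrow> 0 \<le> q \<longrightarrow> q \<le> 1 \<longrightarrow> \<bar>p - q\<bar> < \<delta> \<longrightarrow> \<bar>eta p - eta q\<bar> < e"
proof -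
  have "uniformly_continuous_on {0..1} eta"
    by (rule compact_uniformly_continuous[OF continuous_eta]) simp
  then obtain \<delta> where "\<delta> > 0" "\<And>p q. p \<in> {0..1} \<Longrightarrow> q \<in> {0..1} \<Longrightarrow> dist q p < \<delta> \<Longrightarrow> dist (eta q) (eta p) < e"
    using assms unfolding uniformly_continuous_on_def by metis
  then show ?thesis by (intro exI[of _ \<delta>]) (auto simp: dist_real_def abs_minus_commute)
qed

lemma eta_measurable [measurable]: "eta \<in> borel_measurable borel"
  unfolding eta_def[abs_def] by measurable

lemma eta_sum_cond:
  assumes "finite A" "\<And>v. v \<in> A \<Longrightarrow> P v \<ge> 0" "(\<Sum>v\<in>A. P v) = c"
  shows "(\<Sum>v\<in>A. eta (P v)) - eta c = c * (\<Sum>v\<in>A. eta (P v / c))"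
proof (cases "c = 0")
  case True
  then have "\<forall>v\<in>A. P v = 0" using assms by (simp add: sum_nonneg_eq_0_iff)
  then show ?thesis using True by simp
next
  case False
  have c: "c > 0" using False assms(3) sum_nonneg[of A P] assms(2) by force
  have "eta (P v) = P v / c * eta c + c * eta (P v / c)" if "v \<in> A" for v
    using eta_mult[of c "P v / c"] c assms(2)[OF that] by simp
  then have "(\<Sum>v\<in>A. eta (P v)) = (\<Sum>v\<in>A. P v / c * eta c + c * eta (P v / c))" by simp
  also have "\<dots> = (\<Sum>v\<in>A. P v) / c * eta c + c * (\<Sum>v\<in>A. eta (P v / c))"
    by (simp add: sum.distrib sum_distrib_left sum_divide_distrib sum_distrib_right)
  finally show ?thesis using c assms(3) by simp
qed

text \<open>Strong subadditivity of entropy on one cell of mass \<open>c\<close>. The tangent is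
  taken at \<open>a x * b y / c\<close>, the mass that the pair would have if its coordinates were
  independent; these masses also add up to \<open>c\<close>, so the linear terms cancel.\<close>

lemma eta_submod:
  fixes P :: "'b \<Rightarrow> 'c \<Rightarrow> real"
  assumes fin: "finite A" "finite B" and P: "\<And>x y. P x y \<ge> 0"
  shows "(\<Sum>x\<in>A. \<Sum>y\<in>B. eta (P x y)) + eta (\<Sum>x\<in>A. \<Sum>y\<in>B. P x y) \<le>
    (\<Sum>x\<in>A. eta (\<Sum>y\<in>B. P x y)) + (\<Sum>y\<in>B. eta (\<Sum>x\<in>A. P x y))"
proof -
  define a where "a x = (\<Sum>y\<in>B. P x y)" for x
  define b where "b y = (\<Sum>x\<in>A. P x y)" for y
  define c where "c = (\<Sum>x\<in>A. \<Sum>y\<in>B. P x y)"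
  have ca: "c = (\<Sum>x\<in>A. a x)" by (simp add: c_def a_def)
  have cb: "c = (\<Sum>y\<in>B. b y)" unfolding c_def b_def by (rule sum.swap)
  have pos: "a x \<ge> 0" "b y \<ge> 0" "c \<ge> 0" for x y by (auto simp: a_def b_def c_def intro!: sum_nonneg P)
  have pt: "eta (P x y) - P x y * ln c + P x y * ln (a x) + P x y * ln (b y) \<le> a x * b y / c - P x y"
    if xy: "x \<in> A" "y \<in> B" for x y
  proof (cases "P x y = 0")
    case True then show ?thesis using pos by simp
  next
    case False
    then have p: "P x y > 0" using P[of x y] by simp
    have "P x y \<le> a x" unfolding a_def by (rule member_le_sum) (use xy fin P in auto)
    moreover have "P x y \<le> b y" unfolding b_def by (rule member_le_sum) (use xy fin P in auto)
    moreover have "a x \<le> c" unfolding ca by (rule member_le_sum) (use xy fin pos in auto)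
    ultimately have abc: "a x > 0" "b y > 0" "c > 0" using p by auto
    have "eta (P x y) \<le> - P x y * ln (a x * b y / c) + (a x * b y / c - P x y)"
      by (rule eta_tangent) (use abc p in auto)
    moreover have "ln (a x * b y / c) = ln (a x) + ln (b y) - ln c" using abc by (simp add: ln_mult ln_div)
    ultimately show ?thesis by (simp add: algebra_simps)
  qed
  have "(\<Sum>x\<in>A. \<Sum>y\<in>B. eta (P x y) - P x y * ln c + P x y * ln (a x) + P x y * ln (b y)) \<le>
      (\<Sum>x\<in>A. \<Sum>y\<in>B. a x * b y / c - P x y)"
    by (intro sum_mono pt)
  also have "\<dots> = (\<Sum>x\<in>A. a x) * (\<Sum>y\<in>B. b y) / c - c"
    by (simp add: sum_subtractf c_def sum_product sum_divide_distrib)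
  also have "\<dots> = 0" unfolding ca[symmetric] cb[symmetric] by simp
  finally have 1: "(\<Sum>x\<in>A. \<Sum>y\<in>B. eta (P x y) - P x y * ln c + P x y * ln (a x) + P x y * ln (b y)) \<le> 0" .
  have "(\<Sum>x\<in>A. \<Sum>y\<in>B. P x y * ln c) = - eta c"
    by (simp add: c_def eta_def sum_distrib_right)
  moreover have "(\<Sum>x\<in>A. \<Sum>y\<in>B. P x y * ln (a x)) = - (\<Sum>x\<in>A. eta (a x))"
    by (simp add: eta_def sum_distrib_right[symmetric] a_def[symmetric] sum_negf)
  moreover have "(\<Sum>x\<in>A. \<Sum>y\<in>B. P x y * ln (b y)) = - (\<Sum>y\<in>B. eta (b y))"
    by (subst sum.swap) (simp add: eta_def sum_distrib_right[symmetric] b_def[symmetric] sum_negf)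
  ultimately show ?thesis
    using 1 unfolding a_def[symmetric] b_def[symmetric] c_def[symmetric]
    by (simp add: sum.distrib sum_subtractf flip: ca)
qed

section \<open>Entropy of partitions given as level sets\<close>

context measure_preserving_action begin

definition finite_valued :: "('a \<Rightarrow> 'b) \<Rightarrow> bool" where
  "finite_valued X \<longleftrightarrow> finite (range X) \<and> (\<forall>v. X -` {v} \<in> sets M)"

text \<open>Summing over level sets instead of values makes the entropy depend on the induced
  partition alone. A function may thus be recoded by any other with the same fibres, even one of
  another type, through \<open>ent_cong\<close>.\<close>

definition ent :: "('a \<Rightarrow> 'b) \<Rightarrow> real" where
  "ent X = (\<Sum>C\<in>range (\<lambda>x. X -` {X x}). eta (prob C))"

lemma ent_cong: "(\<And>x y. X x = X y \<longleftrightarrow> Y x = Y y) \<Longrightarrow> ent X = ent Y"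
  unfolding ent_def by (simp add: vimage_def)

lemma ent_sum:
  assumes "finite V" "range X \<subseteq> V" shows "ent X = (\<Sum>v\<in>V. eta (prob (X -` {v})))"
proof -
  have inj: "inj_on (\<lambda>v. X -` {v}) (range X)" by (auto simp: inj_on_def)
  have "ent X = (\<Sum>C\<in>(\<lambda>v. X -` {v}) ` range X. eta (prob C))" unfolding ent_def by (simp add: image_image)
  also have "\<dots> = (\<Sum>v\<in>range X. eta (prob (X -` {v})))" by (subst sum.reindex[OF inj]) simp
  also have "\<dots> = (\<Sum>v\<in>V. eta (prob (X -` {v})))"
  proof (rule sum.mono_neutral_left[OF assms])
    show "\<forall>i\<in>V - range X. eta (prob (X -` {i})) = 0"
    proof
      fix i assume "i \<in> V - range X"
      then have "X -` {i} = {}" by auto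
      then show "eta (prob (X -` {i})) = 0" by simp
    qed
  qed
  finally show ?thesis .
qed

lemma finite_valued_finite: "finite_valued X \<Longrightarrow> finite (range X)" and finite_valued_sets: "finite_valued X \<Longrightarrow> X -` {v} \<in> sets M"
  unfolding finite_valued_def by auto

lemma finite_valued_vimage: assumes "finite_valued X" shows "X -` A \<in> sets M"
proof -
  have "X -` A = (\<Union>v\<in>A \<inter> range X. X -` {v})" by auto
  also have "\<dots> \<in> sets M" using finite_valued_finite[OF assms] finite_valued_sets[OF assms] by (intro sets.finite_UN) auto
  finally show ?thesis .
qed

lemma finite_valued_comp: assumes "finite_valued X" shows "finite_valued (\<lambda>x. f (X x))"
  unfolding finite_valued_def
proof (intro conjI allI)
  show "finite (range (\<lambda>x. f (X x)))" using finite_imageI[OF finite_valued_finite[OF assms], of f] by (simp add: image_image)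
  show "(\<lambda>x. f (X x)) -` {v} \<in> sets M" for v using finite_valued_vimage[OF assms, of "f -` {v}"] by (simp add: vimage_def)
qed

lemma finite_valued_pair: assumes "finite_valued X" "finite_valued Y" shows "finite_valued (\<lambda>x. (X x, Y x))"
  unfolding finite_valued_def
proof (intro conjI allI)
  show "finite (range (\<lambda>x. (X x, Y x)))"
    by (rule finite_subset[of _ "range X \<times> range Y"]) (use finite_valued_finite[OF assms(1)] finite_valued_finite[OF assms(2)] in auto)
  show "(\<lambda>x. (X x, Y x)) -` {v} \<in> sets M" for v
  proof -
    have "(\<lambda>x. (X x, Y x)) -` {v} = X -` {fst v} \<inter> Y -` {snd v}" by (cases v) auto
    then show ?thesis using assms by (auto intro: finite_valued_sets)
  qed
qed

lemma finite_valued_T: assumes "finite_valued X" shows "finite_valued (\<lambda>x. X (T g x))"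
  unfolding finite_valued_def
proof (intro conjI allI)
  show "finite (range (\<lambda>x. X (T g x)))"
    by (rule finite_subset[OF _ finite_valued_finite[OF assms]]) auto
  show "(\<lambda>x. X (T g x)) -` {v} \<in> sets M" for v
    using vimage_T[OF finite_valued_sets[OF assms], of g v] by (simp add: vimage_def)
qed

lemma finite_valued_const: "finite_valued (\<lambda>_. c)"
  unfolding finite_valued_def using sets.top[of M] by (auto simp: vimage_def space_M)

lemma prob_split:
  assumes "finite_valued Y" "E \<in> sets M" "finite B" "range Y \<subseteq> B"
  shows "prob E = (\<Sum>y\<in>B. prob (E \<inter> Y -` {y}))"
proof -
  have "prob (\<Union>y\<in>B. E \<inter> Y -` {y}) = (\<Sum>y\<in>B. prob (E \<inter> Y -` {y}))"
    by (rule finite_measure_finite_Union) (use assms in \<open>auto intro: finite_valued_sets simp: disjoint_family_on_def\<close>)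
  moreover have "(\<Union>y\<in>B. E \<inter> Y -` {y}) = E" using assms(4) by auto
  ultimately show ?thesis by simp
qed

lemma ent_pair:
  assumes "finite A" "range X \<subseteq> A" "finite B" "range Y \<subseteq> B"
  shows "ent (\<lambda>x. (X x, Y x)) = (\<Sum>v\<in>A. \<Sum>w\<in>B. eta (prob (X -` {v} \<inter> Y -` {w})))"
proof -
  have "ent (\<lambda>x. (X x, Y x)) = (\<Sum>v\<in>A \<times> B. eta (prob ((\<lambda>x. (X x, Y x)) -` {v})))"
    by (rule ent_sum) (use assms in auto)
  also have "\<dots> = (\<Sum>(v, w)\<in>A \<times> B. eta (prob (X -` {v} \<inter> Y -` {w})))"
    by (intro sum.cong refl) (auto intro!: arg_cong[where f = "\<lambda>C. eta (prob C)"])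
  finally show ?thesis by (simp add: sum.cartesian_product)
qed

text \<open>\<open>eta_submod\<close> on each level set of \<open>Z\<close>: given \<open>Z\<close>,
  the joint entropy of \<open>X\<close> and \<open>Y\<close> is at most the sum of their
  entropies.\<close>

lemma ent_submod:
  assumes X: "finite_valued X" and Y: "finite_valued Y" and Z: "finite_valued Z"
  shows "ent (\<lambda>x. (X x, Y x, Z x)) + ent Z \<le> ent (\<lambda>x. (X x, Z x)) + ent (\<lambda>x. (Y x, Z x))"
proof -
  note fX = finite_valued_finite[OF X] and fY = finite_valued_finite[OF Y] and fZ = finite_valued_finite[OF Z]
  let ?P = "\<lambda>z x y. prob (X -` {x} \<inter> Y -` {y} \<inter> Z -` {z})"
  have s: "X -` {x} \<in> sets M" "Y -` {y} \<in> sets M" "Z -` {z} \<in> sets M" for x y z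
    using X Y Z by (auto intro: finite_valued_sets)
  have xz: "prob (X -` {x} \<inter> Z -` {z}) = (\<Sum>y\<in>range Y. ?P z x y)" for x z
    by (subst prob_split[OF Y _ fY order_refl]) (auto simp: s Int_ac intro!: sum.cong arg_cong[where f = prob])
  have yz: "prob (Y -` {y} \<inter> Z -` {z}) = (\<Sum>x\<in>range X. ?P z x y)" for y z
    by (subst prob_split[OF X _ fX order_refl]) (auto simp: s Int_ac intro!: sum.cong arg_cong[where f = prob])
  have z: "prob (Z -` {z}) = (\<Sum>x\<in>range X. \<Sum>y\<in>range Y. ?P z x y)" for z
    unfolding xz[symmetric] by (subst prob_split[OF X _ fX order_refl]) (auto simp: s Int_ac)
  have "ent (\<lambda>x. (X x, Y x, Z x)) = (\<Sum>x\<in>range X. \<Sum>w\<in>range Y \<times> range Z. eta (prob (X -` {x} \<inter> (\<lambda>x. (Y x, Z x)) -` {w})))"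
    by (rule ent_pair) (use fX fY fZ in auto)
  also have "\<dots> = (\<Sum>x\<in>range X. \<Sum>(y, z)\<in>range Y \<times> range Z. eta (?P z x y))"
    by (intro sum.cong refl) (auto intro!: arg_cong[where f = "\<lambda>C. eta (prob C)"])
  also have "\<dots> = (\<Sum>x\<in>range X. \<Sum>y\<in>range Y. \<Sum>z\<in>range Z. eta (?P z x y))"
    by (simp add: sum.cartesian_product)
  also have "\<dots> = (\<Sum>x\<in>range X. \<Sum>z\<in>range Z. \<Sum>y\<in>range Y. eta (?P z x y))"
    by (intro sum.cong refl sum.swap)
  also have "\<dots> = (\<Sum>z\<in>range Z. \<Sum>x\<in>range X. \<Sum>y\<in>range Y. eta (?P z x y))"
    by (rule sum.swap)
  finally have 1: "ent (\<lambda>x. (X x, Y x, Z x)) = (\<Sum>z\<in>range Z. \<Sum>x\<in>range X. \<Sum>y\<in>range Y. eta (?P z x y))" .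
  have 2: "ent Z = (\<Sum>z\<in>range Z. eta (\<Sum>x\<in>range X. \<Sum>y\<in>range Y. ?P z x y))"
    using ent_sum[OF fZ order_refl] by (simp add: z)
  have 3: "ent (\<lambda>x. (X x, Z x)) = (\<Sum>z\<in>range Z. \<Sum>x\<in>range X. eta (\<Sum>y\<in>range Y. ?P z x y))"
    using ent_pair[OF fX order_refl fZ order_refl] by (simp add: xz) (rule sum.swap)
  have 4: "ent (\<lambda>x. (Y x, Z x)) = (\<Sum>z\<in>range Z. \<Sum>y\<in>range Y. eta (\<Sum>x\<in>range X. ?P z x y))"
    using ent_pair[OF fY order_refl fZ order_refl] by (simp add: yz) (rule sum.swap)
  show ?thesis unfolding 1 2 3 4 sum.distrib[symmetric]
    by (intro sum_mono eta_submod fX fY) simp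
qed

lemma ent_T: "finite_valued X \<Longrightarrow> ent (\<lambda>x. X (T g x)) = ent X"
proof -
  assume X: "finite_valued X"
  have "ent (\<lambda>x. X (T g x)) = (\<Sum>v\<in>range X. eta (prob ((\<lambda>x. X (T g x)) -` {v})))"
    by (rule ent_sum) (use finite_valued_finite[OF X] in auto)
  also have "\<dots> = (\<Sum>v\<in>range X. eta (prob (X -` {v})))"
    using prob_T[OF finite_valued_sets[OF X], of g] by (simp add: vimage_def)
  also have "\<dots> = ent X" by (rule ent_sum[symmetric]) (use finite_valued_finite[OF X] in auto)
  finally show ?thesis .
qed

definition cond_ent :: "('a \<Rightarrow> 'b) \<Rightarrow> ('a \<Rightarrow> 'c) \<Rightarrow> real" where
  "cond_ent X Z = ent (\<lambda>x. (X x, Z x)) - ent Z"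

lemma cond_ent_eq:
  assumes X: "finite_valued X" and Z: "finite_valued Z"
  shows "cond_ent X Z = (\<Sum>z\<in>range Z. prob (Z -` {z}) * (\<Sum>v\<in>range X. eta (prob (X -` {v} \<inter> Z -` {z}) / prob (Z -` {z}))))"
proof -
  note fX = finite_valued_finite[OF X] and fZ = finite_valued_finite[OF Z]
  have "cond_ent X Z = (\<Sum>z\<in>range Z. (\<Sum>v\<in>range X. eta (prob (X -` {v} \<inter> Z -` {z}))) - eta (prob (Z -` {z})))"
    unfolding cond_ent_def ent_pair[OF fX order_refl fZ order_refl] ent_sum[OF fZ order_refl] sum_subtractf
    by (subst sum.swap) simp
  also have "\<dots> = (\<Sum>z\<in>range Z. prob (Z -` {z}) * (\<Sum>v\<in>range X. eta (prob (X -` {v} \<inter> Z -` {z}) / prob (Z -` {z}))))"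
    by (intro sum.cong refl eta_sum_cond fX measure_nonneg)
      (subst prob_split[OF X finite_valued_sets[OF Z] fX order_refl], simp add: Int_commute)
  finally show ?thesis .
qed

lemma cond_ent_nonneg: assumes X: "finite_valued X" and Z: "finite_valued Z" shows "cond_ent X Z \<ge> 0"
proof -
  have "prob (X -` {v} \<inter> Z -` {z}) / prob (Z -` {z}) \<le> 1" for v z
    using finite_measure_mono[of "X -` {v} \<inter> Z -` {z}" "Z -` {z}"] finite_valued_sets[OF Z]
    by (simp add: divide_le_eq_1 zero_less_measure_iff)
  then show ?thesis unfolding cond_ent_eq[OF X Z]
    by (intro sum_nonneg mult_nonneg_nonneg eta_nonneg) auto
qed

lemma ent_le_pair: "finite_valued X \<Longrightarrow> finite_valued Z \<Longrightarrow> ent Z \<le> ent (\<lambda>x. (X x, Z x))"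
  using cond_ent_nonneg[of X Z] by (simp add: cond_ent_def)

text \<open>Conditioning on finer information lowers entropy: this is submodularity with
  \<open>Z\<close> and \<open>f o Z\<close>, since pairing \<open>Z\<close> with
  \<open>f o Z\<close> does not change its level sets.\<close>

lemma cond_ent_fun: assumes X: "finite_valued X" and Z: "finite_valued Z" shows "cond_ent X Z \<le> cond_ent X (\<lambda>x. f (Z x))"
proof -
  have "ent (\<lambda>x. (X x, Z x, f (Z x))) = ent (\<lambda>x. (X x, Z x))"
    "ent (\<lambda>x. (Z x, f (Z x))) = ent Z" by (intro ent_cong; auto)+
  then show ?thesis using ent_submod[OF X Z finite_valued_comp[OF Z, of f]] unfolding cond_ent_def by simp
qed

definition itinerary :: "('a \<Rightarrow> 'b) \<Rightarrow> 'g list \<Rightarrow> 'a \<Rightarrow> 'b list" where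
  "itinerary X L x = map (\<lambda>g. X (T g x)) L"

lemma finite_valued_itinerary: assumes X: "finite_valued X" shows "finite_valued (itinerary X L)"
proof (induction L)
  case Nil
  then show ?case by (simp add: itinerary_def[abs_def] finite_valued_const)
next
  case (Cons g L)
  have "itinerary X (g # L) = (\<lambda>x. (\<lambda>(a, b). a # b) (X (T g x), itinerary X L x))" by (auto simp: itinerary_def)
  then show ?case using finite_valued_comp[OF finite_valued_pair[OF finite_valued_T[OF X, of g] Cons], of "\<lambda>(a, b). a # b"] by simp
qed

text \<open>Adjoin \<open>Z\<close> and add the coordinates one at a time; by submodularity each
  costs at most its entropy given \<open>Z\<close> alone.\<close>

lemma ent_itinerary_le:
  assumes X: "finite_valued X" and Z: "finite_valued Z"
  shows "ent (itinerary X L) \<le> ent Z + (\<Sum>g\<leftarrow>L. cond_ent (\<lambda>x. X (T g x)) Z)"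
proof -
  have "ent (\<lambda>x. (itinerary X L x, Z x)) \<le> ent Z + (\<Sum>g\<leftarrow>L. cond_ent (\<lambda>x. X (T g x)) Z)"
  proof (induction L)
    case Nil
    have "ent (\<lambda>x. (itinerary X [] x, Z x)) = ent Z" by (intro ent_cong) (auto simp: itinerary_def)
    then show ?case by simp
  next
    case (Cons g L)
    have "ent (\<lambda>x. (itinerary X (g # L) x, Z x)) = ent (\<lambda>x. (X (T g x), itinerary X L x, Z x))"
      by (intro ent_cong) (auto simp: itinerary_def)
    also have "\<dots> \<le> cond_ent (\<lambda>x. X (T g x)) Z + ent (\<lambda>x. (itinerary X L x, Z x))"
      using ent_submod[OF finite_valued_T[OF X, of g] finite_valued_itinerary[OF X, of L] Z] by (simp add: cond_ent_def)
    finally show ?case using Cons.IH by simp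
  qed
  moreover have "ent (itinerary X L) \<le> ent (\<lambda>x. (itinerary X L x, Z x))"
  proof -
    have "ent (itinerary X L) \<le> ent (\<lambda>x. (Z x, itinerary X L x))" by (rule ent_le_pair[OF Z finite_valued_itinerary[OF X]])
    also have "\<dots> = ent (\<lambda>x. (itinerary X L x, Z x))" by (intro ent_cong) auto
    finally show ?thesis .
  qed
  ultimately show ?thesis by linarith
qed

section \<open>Kronecker partitions have zero sequence entropy\<close>

lemma totbdd_reps:
  assumes "totbdd d" "e > 0"
  shows "\<exists>r. finite (range r) \<and> (\<forall>g. d g (r g) < e)"
proof -
  obtain P where P: "finite P" "\<Union>P = UNIV" "\<forall>S\<in>P. \<forall>g\<in>S. \<forall>h\<in>S. d g h < e" by (rule tbdE[OF assms])
  have "\<exists>S. S \<in> P \<and> g \<in> S" for g using P(2) by blast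
  then obtain S where S: "\<And>g. S g \<in> P" "\<And>g. g \<in> S g" by metis
  define r where "r g = (SOME h. h \<in> S g)" for g
  have r: "r g \<in> S g" for g unfolding r_def using S(2)[of g] by (rule someI)
  have "range r \<subseteq> (\<lambda>A. SOME h. h \<in> A) ` P" using S by (auto simp: r_def)
  then have "finite (range r)" using P(1) finite_surj by blast
  moreover have "d g (r g) < e" for g by (rule P(3)[rule_format, OF S r])
  ultimately show ?thesis by blast
qed

lemma totbdd_finite_sum: "finite J \<Longrightarrow> (\<And>j. j \<in> J \<Longrightarrow> totbdd (d j)) \<Longrightarrow> totbdd (\<lambda>g h. \<Sum>j\<in>J. d j g h)"
proof (induction J rule: finite_induct)
  case (insert i J)
  have "totbdd (\<lambda>g h. \<Sum>j\<in>J. d j g h)" using insert by simp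
  with insert.prems[OF insertI1] show ?case by (rule totbdd_add[where c = 1]) (use insert.hyps in simp_all)
qed (simp add: totbdd_zero)

lemma prob_diff_le_D:
  assumes "A \<in> sets M" shows "prob (T g -` A - T h -` A) \<le> shift_dist (indicator A) g h"
proof -
  have s: "T g -` A - T h -` A \<in> sets M" using vimage_T[OF assms] by auto
  have "prob (T g -` A - T h -` A) = (\<integral>x. indicator (T g -` A - T h -` A) x \<partial>M)" using s by simp
  also have "\<dots> \<le> shift_dist (indicator A) g h"
    unfolding shift_dist_def
    by (intro integral_mono bdd_meas_integrable bdd_meas_intros s bdd_meas_T[of "indicator _"] assms) (auto simp: indicator_def)
  finally show ?thesis .
qed

text \<open>When two translates of the partition are close, their joint distribution is close to a
  diagonal one, for which the conditional entropy is 0. Uniform continuity of \<open>eta\<close>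
  controls the error.\<close>

lemma cond_ent_K_small:
  assumes Y: "finite_valued Y" and e: "e > 0"
  shows "\<exists>\<delta>>0. \<forall>g h. (\<Sum>y\<in>range Y. shift_dist (indicator (Y -` {y})) g h) < \<delta> \<longrightarrow>
    cond_ent (\<lambda>x. Y (T g x)) (\<lambda>x. Y (T h x)) \<le> e"
proof -
  note fY = finite_valued_finite[OF Y]
  let ?m = "real (card (range Y))"
  have m: "?m > 0" using fY by (simp add: card_gt_0_iff)
  then obtain \<delta> where \<delta>: "\<delta> > 0" "\<And>p q. 0 \<le> p \<Longrightarrow> p \<le> 1 \<Longrightarrow> 0 \<le> q \<Longrightarrow> q \<le> 1 \<Longrightarrow> \<bar>p - q\<bar> < \<delta> \<Longrightarrow> \<bar>eta p - eta q\<bar> < e / (?m * ?m)"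
    using eta_uniform[of "e / (?m * ?m)"] divide_pos_pos[OF e mult_pos_pos[OF m m]] by metis
  have "cond_ent (\<lambda>x. Y (T g x)) (\<lambda>x. Y (T h x)) \<le> e"
    if d: "(\<Sum>y\<in>range Y. shift_dist (indicator (Y -` {y})) g h) < \<delta>" for g h
  proof -
    let ?E = "\<lambda>g y. T g -` Y -` {y}"
    have s: "?E g y \<in> sets M" for g y by (intro vimage_T finite_valued_sets[OF Y])
    have dy: "prob (?E g y - ?E h y) < \<delta>" "prob (?E h y - ?E g y) < \<delta>" if "y \<in> range Y" for y
    proof -
      have "shift_dist (indicator (Y -` {y})) g h \<le> (\<Sum>y\<in>range Y. shift_dist (indicator (Y -` {y})) g h)"
        by (rule member_le_sum[OF that]) (use fY shift_dist_nonneg in auto)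
      then show "prob (?E g y - ?E h y) < \<delta>" "prob (?E h y - ?E g y) < \<delta>"
        using d prob_diff_le_D[OF finite_valued_sets[OF Y], of g y h] prob_diff_le_D[OF finite_valued_sets[OF Y], of h y g]
        by (auto simp: shift_dist_sym[of _ h g])
    qed
    \<comment> \<open>The subtracted term belongs to the diagonal distribution. There are
      \<open>?m * ?m\<close> pairs of cells, hence the tolerance.\<close>
    have tm: "\<bar>eta (prob (?E g y \<inter> ?E h z)) - (if y = z then eta (prob (?E h z)) else 0)\<bar> < e / (?m * ?m)"
      if yz: "y \<in> range Y" "z \<in> range Y" for y z
    proof (cases "y = z")
      case True
      have "prob (?E h z - ?E g z) = prob (?E h z) - prob (?E h z \<inter> ?E g z)"
        by (rule finite_measure_Diff'[OF s s])
      then have "\<bar>prob (?E g z \<inter> ?E h z) - prob (?E h z)\<bar> < \<delta>"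
        using dy(2)[OF yz(2)] finite_measure_mono[of "?E g z \<inter> ?E h z" "?E h z"] s by (auto simp: Int_commute)
      then show ?thesis using True \<delta>(2)[of "prob (?E g z \<inter> ?E h z)" "prob (?E h z)"] by simp
    next
      case False
      then have "?E g y \<inter> ?E h z \<subseteq> ?E g y - ?E h y" by auto
      then have "prob (?E g y \<inter> ?E h z) \<le> prob (?E g y - ?E h y)" using s by (intro finite_measure_mono) auto
      also have "\<dots> < \<delta>" by (rule dy(1)[OF yz(1)])
      finally show ?thesis using False \<delta>(2)[of "prob (?E g y \<inter> ?E h z)" 0] by simp
    qed
    have v: "(\<lambda>x. Y (T g x)) -` {y} = ?E g y" for g y by auto
    have "cond_ent (\<lambda>x. Y (T g x)) (\<lambda>x. Y (T h x)) =
        (\<Sum>z\<in>range Y. (\<Sum>y\<in>range Y. eta (prob (?E g y \<inter> ?E h z)))) - (\<Sum>z\<in>range Y. eta (prob (?E h z)))"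
    proof -
      have rg: "range (\<lambda>x. Y (T g x)) \<subseteq> range Y" for g by auto
      show ?thesis
        unfolding cond_ent_def ent_pair[OF fY rg fY rg] ent_sum[OF fY rg] v by (subst sum.swap) simp
    qed
    also have "\<dots> = (\<Sum>z\<in>range Y. \<Sum>y\<in>range Y. eta (prob (?E g y \<inter> ?E h z)) - (if y = z then eta (prob (?E h z)) else 0))"
      using fY by (simp add: sum_subtractf)
    also have "\<dots> \<le> (\<Sum>z\<in>range Y. \<Sum>y\<in>range Y. e / (?m * ?m))"
    proof (intro sum_mono)
      fix z y assume "z \<in> range Y" "y \<in> range Y"
      then show "eta (prob (?E g y \<inter> ?E h z)) - (if y = z then eta (prob (?E h z)) else 0) \<le> e / (?m * ?m)"
        using order_trans[OF abs_ge_self less_imp_le[OF tm]] by simp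
    qed
    also have "\<dots> = e" using m by simp
    finally show ?thesis .
  qed
  then show ?thesis using \<delta>(1) by (intro exI[of _ \<delta>]) simp
qed

text \<open>\<open>C\<close> is the entropy of the itinerary along finitely many representatives of
  the group, chosen independently of \<open>L\<close>. Given that itinerary, every further translate
  costs at most \<open>e\<close>.\<close>

lemma ent_K_le:
  assumes Y: "finite_valued Y" and K: "\<And>y. Y -` {y} \<in> K" and e: "e > 0"
  shows "\<exists>C. \<forall>L. ent (itinerary Y L) \<le> C + real (length L) * e"
proof -
  obtain \<delta> where \<delta>: "\<delta> > 0" "\<And>g h. (\<Sum>y\<in>range Y. shift_dist (indicator (Y -` {y})) g h) < \<delta> \<Longrightarrow>
    cond_ent (\<lambda>x. Y (T g x)) (\<lambda>x. Y (T h x)) \<le> e"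
    using cond_ent_K_small[OF Y e] by blast
  have "totbdd (\<lambda>g h. \<Sum>y\<in>range Y. shift_dist (indicator (Y -` {y})) g h)"
    using K finite_valued_finite[OF Y] by (intro totbdd_finite_sum) (auto simp: K_def almost_periodic_def)
  from totbdd_reps[OF this \<delta>(1)] obtain r where
    r: "finite (range r)" "\<And>g. (\<Sum>y\<in>range Y. shift_dist (indicator (Y -` {y})) g (r g)) < \<delta>" by blast
  obtain R where R: "set R = range r" using finite_list[OF r(1)] by blast
  have "cond_ent (\<lambda>x. Y (T g x)) (itinerary Y R) \<le> e" for g
  proof -
    have "r g \<in> set R" using R by auto
    then obtain i where i: "i < length R" "R ! i = r g" by (auto simp: in_set_conv_nth)
    have "cond_ent (\<lambda>x. Y (T g x)) (itinerary Y R) \<le> cond_ent (\<lambda>x. Y (T g x)) (\<lambda>x. itinerary Y R x ! i)"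
      by (rule cond_ent_fun[OF finite_valued_T[OF Y] finite_valued_itinerary[OF Y]])
    also have "(\<lambda>x. itinerary Y R x ! i) = (\<lambda>x. Y (T (r g) x))" using i by (simp add: itinerary_def)
    also have "cond_ent (\<lambda>x. Y (T g x)) (\<lambda>x. Y (T (r g) x)) \<le> e" by (rule \<delta>(2)[OF r(2)])
    finally show ?thesis .
  qed
  then have "(\<Sum>g\<leftarrow>L. cond_ent (\<lambda>x. Y (T g x)) (itinerary Y R)) \<le> (\<Sum>g\<leftarrow>L. e)" for L by (intro sum_list_mono) simp
  then have "ent (itinerary Y L) \<le> ent (itinerary Y R) + real (length L) * e" for L
    using ent_itinerary_le[OF Y finite_valued_itinerary[OF Y, of R], of L] order_trans[OF _ add_left_mono] by (fastforce simp: sum_list_triv)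
  then show ?thesis by blast
qed

end

section \<open>Sequence entropy and the Kronecker algebra\<close>

context measure_preserving_action begin

text \<open>A version of the conditional probabilities of the events \<open>X = v\<close> with
  values in the unit interval everywhere. They add up to 1 only almost everywhere, because the
  versions obtained from \<nu> for completed cells may lose mass on a null set.\<close>

definition kron_version :: "('a \<Rightarrow> 'b) \<Rightarrow> ('b \<Rightarrow> 'a \<Rightarrow> real) \<Rightarrow> bool" where
  "kron_version X u \<longleftrightarrow> (\<forall>v\<in>range X. u v \<in> borel_measurable kron_alg \<and> (\<forall>x. 0 \<le> u v x \<and> u v x \<le> 1) \<and>
      (\<forall>C\<in>K. prob (C \<inter> X -` {v}) = (\<integral>x. indicator C x * u v x \<partial>M))) \<and>
    (AE x in M. (\<Sum>v\<in>range X. u v x) = 1)"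

text \<open>The conditional entropy of the partition given the Kronecker \<sigma>-algebra.\<close>

definition kron_entropy :: "('a \<Rightarrow> 'b) \<Rightarrow> ('b \<Rightarrow> 'a \<Rightarrow> real) \<Rightarrow> real" where
  "kron_entropy X u = (\<integral>x. (\<Sum>v\<in>range X. eta (u v x)) \<partial>M)"

lemma sum_cells:
  assumes Y: "finite_valued Y" and f: "bdd_meas f"
  shows "(\<Sum>y\<in>range Y. \<integral>x. indicator (Y -` {y}) x * f x \<partial>M) = (\<integral>x. f x \<partial>M)"
proof -
  have "(\<Sum>y\<in>range Y. \<integral>x. indicator (Y -` {y}) x * f x \<partial>M) = (\<integral>x. (\<Sum>y\<in>range Y. indicator (Y -` {y}) x * f x) \<partial>M)"
    by (intro Bochner_Integration.integral_sum[symmetric] bdd_meas_integrable bdd_meas_mult f bdd_meas_indicator finite_valued_sets[OF Y])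
  moreover have "(\<Sum>y\<in>range Y. indicator (Y -` {y}) x * f x) = f x" for x
  proof -
    have "(\<Sum>y\<in>range Y. indicator (Y -` {y}) x * f x) = (\<Sum>y\<in>range Y. if y = Y x then f x else 0)"
      by (intro sum.cong refl) (auto simp: indicator_def)
    then show ?thesis using finite_valued_finite[OF Y] by simp
  qed
  ultimately show ?thesis by simp
qed

text \<open>Jensen's inequality on the cell \<open>E\<close>: the right-hand side equals
  \<open>prob E * eta (q / prob E)\<close>, and the tangent is taken at the mean
  \<open>q / prob E\<close> of \<open>w\<close> over the cell.\<close>

lemma eta_cell_le:
  assumes E: "E \<in> sets M" and w: "bdd_meas w" "\<And>x. 0 \<le> w x" "\<And>x. w x \<le> 1" and ew: "bdd_meas (\<lambda>x. eta (w x))"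
  defines "q \<equiv> \<integral>x. indicator E x * w x \<partial>M"
  shows "(\<integral>x. indicator E x * eta (w x) \<partial>M) \<le> eta q + q * ln (prob E)"
proof (cases "q = 0")
  case True
  have "integrable M (\<lambda>x. indicator E x * w x)"
    by (intro bdd_meas_integrable bdd_meas_mult bdd_meas_indicator E w)
  moreover have "AE x in M. 0 \<le> indicator E x * w x" using w(2) by (intro AE_I2) simp
  ultimately have "AE x in M. indicator E x * w x = 0"
    using True unfolding q_def by (rule integral_nonneg_eq_0_iff_AE[THEN iffD1])
  then have "AE x in M. indicator E x * eta (w x) = 0"
    by eventually_elim (metis eta_0 mult_eq_0_iff)
  then have "(\<integral>x. indicator E x * eta (w x) \<partial>M) = 0"
    by (rule integral_eq_zero_AE)
  then show ?thesis using True by simp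
next
  case False
  have q0: "q \<ge> 0" unfolding q_def using w by (intro Bochner_Integration.integral_nonneg) auto
  then have q: "q > 0" using False by simp
  have "q \<le> (\<integral>x. indicator E x \<partial>M)"
    unfolding q_def using w E by (intro integral_mono bdd_meas_integrable bdd_meas_mult bdd_meas_indicator) (auto simp: indicator_def)
  then have c: "prob E > 0" using q E by simp
  let ?s = "q / prob E"
  have s: "?s > 0" using q c by simp
  have "(\<integral>x. indicator E x * eta (w x) \<partial>M) \<le> (\<integral>x. ?s * indicator E x - (1 + ln ?s) * (indicator E x * w x) \<partial>M)"
  proof (intro integral_mono bdd_meas_integrable)
    fix x
    show "indicator E x * eta (w x) \<le> ?s * indicator E x - (1 + ln ?s) * (indicator E x * w x)"
      using eta_tangent[OF s w(2)[of x]] by (auto simp: indicator_def algebra_simps)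
  qed (intro bdd_meas_intros w ew E)+
  also have "\<dots> = ?s * prob E - (1 + ln ?s) * q"
    unfolding q_def using E
    by (subst Bochner_Integration.integral_diff) (auto intro!: bdd_meas_integrable bdd_meas_intros w)
  also have "\<dots> = eta q + q * ln (prob E)"
    using q c by (simp add: ln_div eta_def algebra_simps)
  finally show ?thesis .
qed

context
  fixes X :: "'a \<Rightarrow> 'b" and u :: "'b \<Rightarrow> 'a \<Rightarrow> real"
  assumes X: "finite_valued X" and u: "kron_version X u"
begin

lemma u_kron_alg: "v \<in> range X \<Longrightarrow> u v \<in> borel_measurable kron_alg" and u_nonneg: "v \<in> range X \<Longrightarrow> 0 \<le> u v x"
  and u_le_1: "v \<in> range X \<Longrightarrow> u v x \<le> 1"
  and u_int: "v \<in> range X \<Longrightarrow> C \<in> K \<Longrightarrow> prob (C \<inter> X -` {v}) = (\<integral>x. indicator C x * u v x \<partial>M)"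
  and u_sum: "AE x in M. (\<Sum>v\<in>range X. u v x) = 1"
  using u unfolding kron_version_def by auto

lemma u_meas: "v \<in> range X \<Longrightarrow> u v \<in> borel_measurable M"
  using u_kron_alg measurable_from_subalg[OF kron_alg_sub] by blast

lemma u_bdd_meas: "v \<in> range X \<Longrightarrow> bdd_meas (u v)"
  by (rule bdmI[of _ 1]) (use u_meas u_nonneg u_le_1 in auto)

lemma eta_u_nonneg: "v \<in> range X \<Longrightarrow> 0 \<le> eta (u v x)"
  by (intro eta_nonneg u_nonneg u_le_1)

lemma eta_u_bdd_meas: "v \<in> range X \<Longrightarrow> bdd_meas (\<lambda>x. eta (u v x))"
proof (rule bdmI[of _ 2])
  assume v: "v \<in> range X"
  show "(\<lambda>x. eta (u v x)) \<in> borel_measurable M"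
    by (rule measurable_compose[OF u_meas[OF v] eta_measurable])
  fix x
  have "eta (u v x) \<le> 2 * sqrt (u v x)" by (intro eta_le_sqrt u_nonneg u_le_1 v)
  also have "\<dots> \<le> 2" using u_le_1[OF v, of x] by simp
  finally show "\<bar>eta (u v x)\<bar> \<le> 2" using eta_u_nonneg[OF v, of x] by simp
qed

text \<open>\<open>Y\<close> records all \<open>u v\<close> up to \<open>1 / N\<close>. On a cell of
  \<open>Y\<close> the conditional probability of \<open>v\<close> is an average of
  \<open>u v\<close>, hence within \<open>1 / N\<close> of its values there, and uniform continuity
  of \<open>eta\<close> applies.\<close>

lemma cond_ent_discretized:
  assumes e: "e > 0"
  shows "\<exists>Y :: 'a \<Rightarrow> 'b \<Rightarrow> int. finite_valued Y \<and> (\<forall>y. Y -` {y} \<in> K) \<and> cond_ent X Y \<le> kron_entropy X u + e"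
proof -
  note fX = finite_valued_finite[OF X]
  let ?m = "real (card (range X))"
  have m: "?m > 0" using fX by (simp add: card_gt_0_iff)
  obtain \<delta> where \<delta>: "\<delta> > 0" "\<And>p q. 0 \<le> p \<Longrightarrow> p \<le> 1 \<Longrightarrow> 0 \<le> q \<Longrightarrow> q \<le> 1 \<Longrightarrow> \<bar>p - q\<bar> < \<delta> \<Longrightarrow> \<bar>eta p - eta q\<bar> < e / ?m"
    using eta_uniform[OF divide_pos_pos[OF e m]] by metis
  obtain N0 where N0: "inverse (real (Suc N0)) < \<delta>" using reals_Archimedean[OF \<delta>(1)] by blast
  define N where "N = Suc N0"
  have N: "real N > 0" "1 / real N < \<delta>" using N0 by (auto simp: N_def inverse_eq_divide)
  \<comment> \<open>The default 0 outside \<open>range X\<close> keeps the range of \<open>Y\<close>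
    finite although its values are functions on the whole type.\<close>
  define Y where "Y x v = (if v \<in> range X then \<lfloor>real N * u v x\<rfloor> else 0)" for x v
  have "Y x v \<in> {0..int N}" if "v \<in> range X" for x v
  proof -
    have "real N * u v x \<le> real N * 1" by (intro mult_left_mono u_le_1 that) simp
    then have "\<lfloor>real N * u v x\<rfloor> \<le> int N" by linarith
    then show ?thesis using that u_nonneg[OF that, of x] by (simp add: Y_def)
  qed
  then have "range Y \<subseteq> {f. \<forall>v. (v \<in> range X \<longrightarrow> f v \<in> {0..int N}) \<and> (v \<notin> range X \<longrightarrow> f v = 0)}"
    by (auto simp: Y_def)
  then have fY: "finite (range Y)"
    by (rule finite_subset) (rule finite_set_of_finite_funs[OF fX], simp)
  have YK: "Y -` {y} \<in> K" for y
  proof (cases "\<forall>v. v \<notin> range X \<longrightarrow> y v = 0")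
    case True
    then have "Y -` {y} = {x \<in> space kron_alg. \<forall>v\<in>range X. \<lfloor>real N * u v x\<rfloor> = y v}"
      by (auto simp: Y_def space_kron_alg fun_eq_iff)
    also have "\<dots> \<in> sets kron_alg"
    proof (rule sets.sets_Collect_finite_All'[OF _ fX])
      fix v assume v: "v \<in> range X"
      have [measurable]: "u v \<in> borel_measurable kron_alg" by (rule u_kron_alg[OF v])
      show "{x \<in> space kron_alg. \<lfloor>real N * u v x\<rfloor> = y v} \<in> sets kron_alg" by measurable
    qed auto
    finally show ?thesis by (simp add: sets_kron_alg)
  next
    case False
    then have "Y -` {y} = {}" by (auto simp: Y_def)
    then show ?thesis by (simp add: K_empty)
  qed
  have Y: "finite_valued Y" unfolding finite_valued_def using fY YK K_sets by blast
  have key: "prob (Y -` {y}) * eta (prob (X -` {v} \<inter> Y -` {y}) / prob (Y -` {y})) \<le>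
     (\<integral>x. indicator (Y -` {y}) x * (eta (u v x) + e / ?m) \<partial>M)" (is "?c * eta (?p / ?c) \<le> ?I")
    if v: "v \<in> range X" for v y
  proof (cases "?c = 0")
    case True
    have "0 \<le> eta (u v x) + e / ?m" for x using eta_u_nonneg[OF v] e by (intro add_nonneg_nonneg) auto
    then have "0 \<le> ?I" by (intro Bochner_Integration.integral_nonneg) auto
    then show ?thesis using True by simp
  next
    case False
    then have c: "?c > 0" by (simp add: zero_less_measure_iff)
    have s: "Y -` {y} \<in> sets M" by (rule finite_valued_sets[OF Y])
    have p: "?p = (\<integral>x. indicator (Y -` {y}) x * u v x \<partial>M)"
      using u_int[OF v YK[of y]] by (simp add: Int_commute)
    have rng: "real_of_int (y v) / real N \<le> u v x" "u v x \<le> real_of_int (y v) / real N + 1 / real N"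
      if "x \<in> Y -` {y}" for x
    proof -
      have "\<lfloor>real N * u v x\<rfloor> = y v" using that v by (auto simp: Y_def)
      then have "real_of_int (y v) \<le> real N * u v x" "real N * u v x \<le> real_of_int (y v) + 1" by linarith+
      then show "real_of_int (y v) / real N \<le> u v x" "u v x \<le> real_of_int (y v) / real N + 1 / real N"
        using N(1) by (simp_all add: field_simps)
    qed
    let ?a = "real_of_int (y v) / real N"
    have "(\<integral>x. ?a * indicator (Y -` {y}) x \<partial>M) \<le> ?p" unfolding p
      by (intro integral_mono bdd_meas_integrable bdd_meas_intros u_bdd_meas v s) (use rng(1) in \<open>auto simp: indicator_def\<close>)
    then have p1: "?a \<le> ?p / ?c" using s c by (simp add: pos_le_divide_eq)
    have "?p \<le> (\<integral>x. (?a + 1 / real N) * indicator (Y -` {y}) x \<partial>M)" unfolding p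
      by (intro integral_mono bdd_meas_integrable bdd_meas_intros u_bdd_meas v s) (use rng(2) in \<open>auto simp: indicator_def\<close>)
    then have p2: "?p / ?c \<le> ?a + 1 / real N" using s c by (simp add: pos_divide_le_eq)
    have p3: "0 \<le> ?p / ?c" "?p / ?c \<le> 1"
      using c finite_measure_mono[of "X -` {v} \<inter> Y -` {y}" "Y -` {y}"] s by (auto simp: divide_le_eq_1)
    have "?c * eta (?p / ?c) = (\<integral>x. indicator (Y -` {y}) x * eta (?p / ?c) \<partial>M)"
      using s by simp
    also have "\<dots> \<le> ?I"
    proof (intro integral_mono bdd_meas_integrable)
      fix x
      show "indicator (Y -` {y}) x * eta (?p / ?c) \<le> indicator (Y -` {y}) x * (eta (u v x) + e / ?m)"
      proof (cases "x \<in> Y -` {y}")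
        case True
        have "\<bar>?p / ?c - u v x\<bar> < \<delta>" using rng[OF True] p1 p2 N(2) by linarith
        then have "\<bar>eta (?p / ?c) - eta (u v x)\<bar> < e / ?m"
          by (intro \<delta>(2) p3 u_nonneg u_le_1 v)
        then show ?thesis using True by simp
      qed simp
    qed (intro bdd_meas_intros s eta_u_bdd_meas v)+
    finally show ?thesis .
  qed
  have "cond_ent X Y \<le> (\<Sum>y\<in>range Y. \<Sum>v\<in>range X. \<integral>x. indicator (Y -` {y}) x * (eta (u v x) + e / ?m) \<partial>M)"
    unfolding cond_ent_eq[OF X Y] sum_distrib_left by (intro sum_mono key)
  also have "\<dots> = (\<Sum>v\<in>range X. \<Sum>y\<in>range Y. \<integral>x. indicator (Y -` {y}) x * (eta (u v x) + e / ?m) \<partial>M)"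
    by (rule sum.swap)
  also have "\<dots> = (\<Sum>v\<in>range X. \<integral>x. eta (u v x) + e / ?m \<partial>M)"
    by (intro sum.cong refl sum_cells Y bdd_meas_intros eta_u_bdd_meas)
  also have "\<dots> = (\<Sum>v\<in>range X. (\<integral>x. eta (u v x) \<partial>M) + e / ?m)"
    by (intro sum.cong refl, subst Bochner_Integration.integral_add)
      (auto intro!: bdd_meas_integrable eta_u_bdd_meas simp: prob_space)
  also have "\<dots> = kron_entropy X u + e"
    using m unfolding kron_entropy_def
    by (subst Bochner_Integration.integral_sum) (auto intro!: bdd_meas_integrable eta_u_bdd_meas simp: sum.distrib)
  finally show ?thesis using Y YK by blast
qed

text \<open>Condition on the itinerary of the discretised partition \<open>Y\<close> along the same
  list: it determines \<open>Y o T g\<close> for each \<open>g\<close> of the list, so by invariance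
  each coordinate costs at most \<open>cond_ent X Y\<close>. The itinerary of \<open>Y\<close>
  itself has negligible entropy growth.\<close>

lemma ent_itinerary_upper:
  assumes e: "e > 0"
  shows "\<exists>C. \<forall>L. ent (itinerary X L) \<le> C + real (length L) * (kron_entropy X u + e)"
proof -
  obtain Y :: "'a \<Rightarrow> 'b \<Rightarrow> int" where Y: "finite_valued Y" "\<And>y. Y -` {y} \<in> K" "cond_ent X Y \<le> kron_entropy X u + e / 2"
    using cond_ent_discretized[of "e / 2"] e by auto
  obtain C where C: "\<And>L. ent (itinerary Y L) \<le> C + real (length L) * (e / 2)"
    using ent_K_le[OF Y(1,2), of "e / 2"] e by auto
  have "ent (itinerary X L) \<le> C + real (length L) * (kron_entropy X u + e)" for L
  proof -
    have "cond_ent (\<lambda>x. X (T g x)) (itinerary Y L) \<le> kron_entropy X u + e / 2" if g: "g \<in> set L" for g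
    proof -
      obtain i where i: "i < length L" "L ! i = g" using g by (auto simp: in_set_conv_nth)
      have "cond_ent (\<lambda>x. X (T g x)) (itinerary Y L) \<le> cond_ent (\<lambda>x. X (T g x)) (\<lambda>x. itinerary Y L x ! i)"
        by (rule cond_ent_fun[OF finite_valued_T[OF X] finite_valued_itinerary[OF Y(1)]])
      also have "(\<lambda>x. itinerary Y L x ! i) = (\<lambda>x. Y (T g x))" using i by (simp add: itinerary_def)
      also have "cond_ent (\<lambda>x. X (T g x)) (\<lambda>x. Y (T g x)) = cond_ent X Y"
        unfolding cond_ent_def using ent_T[OF finite_valued_pair[OF X Y(1)], of g] ent_T[OF Y(1), of g] by simp
      finally show ?thesis using Y(3) by simp
    qed
    then have "(\<Sum>g\<leftarrow>L. cond_ent (\<lambda>x. X (T g x)) (itinerary Y L)) \<le> (\<Sum>g\<leftarrow>L. kron_entropy X u + e / 2)"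
      by (intro sum_list_mono)
    also have "\<dots> = real (length L) * (kron_entropy X u + e / 2)" by (rule sum_list_triv)
    finally have "(\<Sum>g\<leftarrow>L. cond_ent (\<lambda>x. X (T g x)) (itinerary Y L)) \<le> real (length L) * (kron_entropy X u + e / 2)" .
    moreover have "ent (itinerary X L) \<le> ent (itinerary Y L) + (\<Sum>g\<leftarrow>L. cond_ent (\<lambda>x. X (T g x)) (itinerary Y L))"
      by (rule ent_itinerary_le[OF X finite_valued_itinerary[OF Y(1)]])
    ultimately show ?thesis using C[of L] by (simp add: algebra_simps)
  qed
  then show ?thesis by blast
qed

lemma ent_extend:
  assumes Z: "finite_valued Z" and e: "e > 0"
  shows "\<exists>g. ent Z + kron_entropy X u - e \<le> ent (\<lambda>x. (X (T g x), Z x))"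
proof -
  note fX = finite_valued_finite[OF X] and fZ = finite_valued_finite[OF Z]
  let ?mm = "real (card (range X)) * real (card (range Z))"
  have mm: "?mm > 0" using fX fZ by (simp add: card_gt_0_iff)
  obtain \<delta> where \<delta>: "\<delta> > 0" "\<And>p q. 0 \<le> p \<Longrightarrow> p \<le> 1 \<Longrightarrow> 0 \<le> q \<Longrightarrow> q \<le> 1 \<Longrightarrow> \<bar>p - q\<bar> < \<delta> \<Longrightarrow> \<bar>eta p - eta q\<bar> < e / ?mm"
    using eta_uniform[OF divide_pos_pos[OF e mm]] by metis
  let ?\<phi> = "\<lambda>v x. indicator (X -` {v}) x - u v x"
  have sX: "X -` {v} \<in> sets M" and sZ: "Z -` {z} \<in> sets M" for v z
    by (rule finite_valued_sets[OF X], rule finite_valued_sets[OF Z])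
  have kron_orth: "kron_orth (?\<phi> v)" if v: "v \<in> range X" for v
    unfolding kron_orth_def
  proof (intro conjI ballI)
    show "bdd_meas (?\<phi> v)" by (intro bdd_meas_intros sX u_bdd_meas v)
    fix C assume C: "C \<in> K"
    have sC: "C \<in> sets M" by (rule K_sets[OF C])
    have "(\<integral>x. indicator C x * ?\<phi> v x \<partial>M) = (\<integral>x. indicator (C \<inter> X -` {v}) x - indicator C x * u v x \<partial>M)"
      by (intro Bochner_Integration.integral_cong refl) (auto simp: indicator_def)
    also have "\<dots> = (\<integral>x. indicator (C \<inter> X -` {v}) x \<partial>M) - (\<integral>x. indicator C x * u v x \<partial>M)"
      by (intro Bochner_Integration.integral_diff bdd_meas_integrable bdd_meas_intros u_bdd_meas v sX sC sets.Int)
    also have "\<dots> = 0" using u_int[OF v C] sX[of v] sC by simp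
    finally show "(\<integral>x. indicator C x * ?\<phi> v x \<partial>M) = 0" .
  qed
  have "\<exists>g. \<forall>v\<in>range X. \<forall>z\<in>range Z. \<bar>\<integral>x. ?\<phi> v (T g x) * indicator (Z -` {z}) x \<partial>M\<bar> < \<delta>"
  proof (rule weak_mixing)
    show "bdd_meas (indicator (Z -` {z}))" for z by (rule bdd_meas_indicator[OF sZ])
    show "\<bar>indicator (Z -` {z}) x :: real\<bar> \<le> 1" for z x by (simp add: indicator_def)
  qed (use fX fZ kron_orth \<delta>(1) in auto)
  then obtain g where g: "\<And>v z. v \<in> range X \<Longrightarrow> z \<in> range Z \<Longrightarrow> \<bar>\<integral>x. ?\<phi> v (T g x) * indicator (Z -` {z}) x \<partial>M\<bar> < \<delta>"
    by blast
  let ?P = "\<lambda>v z. prob (T g -` X -` {v} \<inter> Z -` {z})"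
  \<comment> \<open>The joint mass after the translated indicator of \<open>v\<close> is replaced by
    its conditional expectation.\<close>
  let ?q = "\<lambda>v z. \<integral>x. indicator (Z -` {z}) x * u v (T g x) \<partial>M"
  have ug: "bdd_meas (\<lambda>x. u v (T g x))" "bdd_meas (\<lambda>x. eta (u v (T g x)))" if "v \<in> range X" for v
    using bdd_meas_T[OF u_bdd_meas[OF that]] bdd_meas_T[OF eta_u_bdd_meas[OF that]] by auto
  have q01: "0 \<le> ?q v z" "?q v z \<le> 1" if v: "v \<in> range X" for v z
  proof -
    show "0 \<le> ?q v z" using u_nonneg[OF v] by (intro Bochner_Integration.integral_nonneg) auto
    have "?q v z \<le> (\<integral>x. 1 \<partial>M)"
      by (intro integral_mono bdd_meas_integrable bdd_meas_intros sZ ug v) (use u_le_1[OF v] in \<open>auto simp: indicator_def\<close>)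
    then show "?q v z \<le> 1" by (simp add: prob_space)
  qed
  have close: "eta (?q v z) - e / ?mm \<le> eta (?P v z)" if v: "v \<in> range X" and z: "z \<in> range Z" for v z
  proof -
    have "(\<integral>x. ?\<phi> v (T g x) * indicator (Z -` {z}) x \<partial>M) =
      (\<integral>x. indicator (T g -` X -` {v} \<inter> Z -` {z}) x - indicator (Z -` {z}) x * u v (T g x) \<partial>M)"
      by (intro Bochner_Integration.integral_cong refl) (auto simp: indicator_def)
    also have "\<dots> = (\<integral>x. indicator (T g -` X -` {v} \<inter> Z -` {z}) x \<partial>M) - ?q v z"
      by (intro Bochner_Integration.integral_diff bdd_meas_integrable bdd_meas_intros ug v sZ vimage_T sX sets.Int)
    also have "(\<integral>x. indicator (T g -` X -` {v} \<inter> Z -` {z}) x \<partial>M) = ?P v z"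
      using vimage_T[OF sX] sZ by simp
    finally have "\<bar>?P v z - ?q v z\<bar> < \<delta>" using g[OF v z] by simp
    then have "\<bar>eta (?P v z) - eta (?q v z)\<bar> < e / ?mm" by (intro \<delta>(2) q01 v) auto
    then show ?thesis by linarith
  qed
  have usum: "AE x in M. (\<Sum>v\<in>range X. u v (T g x)) = 1" by (rule AE_T[OF u_sum])
  have qsum: "(\<Sum>v\<in>range X. ?q v z) = prob (Z -` {z})" for z
  proof -
    have "(\<Sum>v\<in>range X. ?q v z) = (\<integral>x. (\<Sum>v\<in>range X. indicator (Z -` {z}) x * u v (T g x)) \<partial>M)"
      by (intro Bochner_Integration.integral_sum[symmetric] bdd_meas_integrable bdd_meas_intros sZ ug)
    also have "\<dots> = (\<integral>x. indicator (Z -` {z}) x \<partial>M)"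
    proof (rule integral_cong_AE)
      show "(\<lambda>x. \<Sum>v\<in>range X. indicator (Z -` {z}) x * u v (T g x)) \<in> borel_measurable M"
        by (intro bdd_meas_measurable bdd_meas_intros sZ ug)
      show "AE x in M. (\<Sum>v\<in>range X. indicator (Z -` {z}) x * u v (T g x)) = indicator (Z -` {z}) x"
        using usum by eventually_elim (simp flip: sum_distrib_left)
    qed (use sZ in auto)
    finally show ?thesis using sZ by simp
  qed
  have hKg: "kron_entropy X u = (\<Sum>v\<in>range X. \<integral>x. eta (u v (T g x)) \<partial>M)"
  proof -
    have "kron_entropy X u = (\<Sum>v\<in>range X. \<integral>x. eta (u v x) \<partial>M)"
      unfolding kron_entropy_def by (intro Bochner_Integration.integral_sum bdd_meas_integrable eta_u_bdd_meas)
    also have "\<dots> = (\<Sum>v\<in>range X. \<integral>x. eta (u v (T g x)) \<partial>M)"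
      by (intro sum.cong refl integral_T[symmetric, OF bdd_meas_measurable[OF eta_u_bdd_meas]])
    finally show ?thesis .
  qed
  have "kron_entropy X u = (\<Sum>v\<in>range X. \<Sum>z\<in>range Z. \<integral>x. indicator (Z -` {z}) x * eta (u v (T g x)) \<partial>M)"
    unfolding hKg by (intro sum.cong refl sum_cells[symmetric] Z ug)
  also have "\<dots> \<le> (\<Sum>v\<in>range X. \<Sum>z\<in>range Z. eta (?q v z) + ?q v z * ln (prob (Z -` {z})))"
    by (intro sum_mono eta_cell_le sZ ug u_nonneg u_le_1)
  also have "\<dots> = (\<Sum>z\<in>range Z. \<Sum>v\<in>range X. eta (?q v z) + ?q v z * ln (prob (Z -` {z})))"
    by (rule sum.swap)
  also have "\<dots> = (\<Sum>z\<in>range Z. (\<Sum>v\<in>range X. eta (?q v z)) - eta (prob (Z -` {z})))"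
    by (simp only: sum.distrib sum_distrib_right[symmetric] qsum) (simp add: eta_def sum_subtractf sum_negf)
  also have "\<dots> = (\<Sum>v\<in>range X. \<Sum>z\<in>range Z. eta (?q v z)) - ent Z"
    unfolding sum_subtractf ent_sum[OF fZ order_refl] by (subst sum.swap) (rule refl)
  finally have 1: "kron_entropy X u + ent Z \<le> (\<Sum>v\<in>range X. \<Sum>z\<in>range Z. eta (?q v z))" by simp
  have "(\<Sum>v\<in>range X. \<Sum>z\<in>range Z. eta (?q v z) - e / ?mm) \<le> (\<Sum>v\<in>range X. \<Sum>z\<in>range Z. eta (?P v z))"
    by (intro sum_mono close)
  also have "\<dots> = ent (\<lambda>x. (X (T g x), Z x))"
  proof -
    have "range (\<lambda>x. X (T g x)) \<subseteq> range X" by auto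
    moreover have "(\<lambda>x. X (T g x)) -` {v} = T g -` X -` {v}" for v by auto
    ultimately show ?thesis using ent_pair[OF fX _ fZ order_refl, of "\<lambda>x. X (T g x)"] by simp
  qed
  also have "(\<Sum>v\<in>range X. \<Sum>z\<in>range Z. eta (?q v z) - e / ?mm) = (\<Sum>v\<in>range X. \<Sum>z\<in>range Z. eta (?q v z)) - e"
    using mm by (auto simp: sum_subtractf zero_less_mult_iff)
  finally show ?thesis using 1 by (intro exI[of _ g]) linarith
qed

text \<open>The next group element \<open>G L\<close> depends on the whole list chosen so far. Lists
  grow at the head, so \<open>Ls n\<close> is the reversed sequence; entropy ignores the
  order.\<close>

lemma ent_itinerary_lower:
  assumes e: "e > 0"
  shows "\<exists>gs :: nat \<Rightarrow> 'g. \<forall>n. real n * (kron_entropy X u - e) \<le> ent (itinerary X (map gs [1..<Suc n]))"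
proof -
  have "\<exists>g. ent (itinerary X L) + kron_entropy X u - e \<le> ent (\<lambda>x. (X (T g x), itinerary X L x))" for L
    by (rule ent_extend[OF finite_valued_itinerary[OF X] e])
  then obtain G where G: "\<And>L. ent (itinerary X L) + kron_entropy X u - e \<le> ent (\<lambda>x. (X (T (G L) x), itinerary X L x))" by metis
  define Ls where "Ls = rec_nat [] (\<lambda>n L. G L # L)"
  have Ls: "Ls 0 = []" "Ls (Suc n) = G (Ls n) # Ls n" for n by (simp_all add: Ls_def)
  have low: "real n * (kron_entropy X u - e) \<le> ent (itinerary X (Ls n))" for n
  proof (induction n)
    case 0
    have "ent (itinerary X []) = 0"
      unfolding itinerary_def[abs_def] using ent_sum[of "{[]}" "\<lambda>_. []"] prob_space by (simp add: vimage_def space_M)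
    then show ?case by (simp add: Ls)
  next
    case (Suc n)
    have "ent (\<lambda>x. (X (T (G (Ls n)) x), itinerary X (Ls n) x)) = ent (itinerary X (Ls (Suc n)))"
      by (intro ent_cong) (auto simp: Ls itinerary_def)
    then show ?case using G[of "Ls n"] Suc.IH by (simp add: algebra_simps)
  qed
  \<comment> \<open>\<open>Ls 0\<close> is empty, so \<open>gs 0\<close> is unspecified; only
    indices from 1 on are used.\<close>
  define gs where "gs i = hd (Ls i)" for i
  have "Ls n = rev (map gs [1..<Suc n])" for n
    by (induction n) (auto simp: Ls gs_def)
  then have "ent (itinerary X (map gs [1..<Suc n])) = ent (itinerary X (Ls n))" for n
    by (intro ent_cong) (simp add: itinerary_def rev_map[symmetric])
  then show ?thesis using low by metis
qed

theorem max_seq_entropy_eq: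
  "(SUP gs. limsup (\<lambda>n. ereal (ent (itinerary X (map gs [1..<Suc n])) / real n))) = ereal (kron_entropy X u)"
proof (rule antisym)
  show "(SUP gs. limsup (\<lambda>n. ereal (ent (itinerary X (map gs [1..<Suc n])) / real n))) \<le> ereal (kron_entropy X u)"
  proof (rule SUP_least, rule ereal_le_epsilon2)
    fix gs :: "nat \<Rightarrow> 'g" and e :: real assume e: "e > 0"
    obtain C where C: "\<And>L. ent (itinerary X L) \<le> C + real (length L) * (kron_entropy X u + e)"
      using ent_itinerary_upper[OF e] by blast
    have "limsup (\<lambda>n. ereal (ent (itinerary X (map gs [1..<Suc n])) / real n)) \<le> limsup (\<lambda>n. ereal (C / real n + (kron_entropy X u + e)))"
    proof (rule Limsup_mono)
      show "\<forall>\<^sub>F n in sequentially. ereal (ent (itinerary X (map gs [1..<Suc n])) / real n) \<le> ereal (C / real n + (kron_entropy X u + e))"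
        using eventually_gt_at_top[of 0]
      proof eventually_elim
        case (elim n)
        have "ent (itinerary X (map gs [1..<Suc n])) \<le> C + real n * (kron_entropy X u + e)" using C[of "map gs [1..<Suc n]"] by (simp del: upt_Suc)
        then show ?case using elim by (simp add: field_simps)
      qed
    qed
    also have "\<dots> = ereal (0 + (kron_entropy X u + e))"
      by (intro lim_imp_Limsup tendsto_ereal tendsto_add tendsto_const lim_const_over_n) simp
    finally show "limsup (\<lambda>n. ereal (ent (itinerary X (map gs [1..<Suc n])) / real n)) \<le> ereal (kron_entropy X u) + ereal e" by simp
  qed
  show "ereal (kron_entropy X u) \<le> (SUP gs. limsup (\<lambda>n. ereal (ent (itinerary X (map gs [1..<Suc n])) / real n)))"
  proof (rule ereal_le_epsilon2)
    fix e :: real assume e: "e > 0"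
    obtain gs :: "nat \<Rightarrow> 'g" where gs: "\<And>n. real n * (kron_entropy X u - e) \<le> ent (itinerary X (map gs [1..<Suc n]))"
      using ent_itinerary_lower[OF e] by blast
    have "ereal (kron_entropy X u - e) = limsup (\<lambda>n. ereal (kron_entropy X u - e))" by (rule Limsup_const[symmetric]) simp
    also have "\<dots> \<le> limsup (\<lambda>n. ereal (ent (itinerary X (map gs [1..<Suc n])) / real n))"
    proof (rule Limsup_mono)
      show "\<forall>\<^sub>F n in sequentially. ereal (kron_entropy X u - e) \<le> ereal (ent (itinerary X (map gs [1..<Suc n])) / real n)"
        using eventually_gt_at_top[of 0]
        by eventually_elim (use gs in \<open>simp add: field_simps del: upt_Suc\<close>)
    qed
    also have "\<dots> \<le> (SUP gs. limsup (\<lambda>n. ereal (ent (itinerary X (map gs [1..<Suc n])) / real n)))"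
      by (rule SUP_upper) simp
    finally have "ereal (kron_entropy X u - e) + ereal e \<le> (SUP gs. limsup (\<lambda>n. ereal (ent (itinerary X (map gs [1..<Suc n])) / real n))) + ereal e"
      by (rule add_right_mono)
    then show "ereal (kron_entropy X u) \<le> (SUP gs. limsup (\<lambda>n. ereal (ent (itinerary X (map gs [1..<Suc n])) / real n))) + ereal e"
      by simp
  qed
qed

end
end

section \<open>Disintegration over the Kronecker algebra\<close>

text \<open>Entropy is largest for the uniform distribution: use the tangent at \<open>1 / m\<close>
  on the terms of positive mass.\<close>

lemma sum_eta_le_ln_card:
  assumes "finite S" "\<And>v. v \<in> S \<Longrightarrow> p v \<ge> 0" "sum p S = 1" "card {v\<in>S. p v > 0} \<le> m" "m \<ge> 1"
  shows "(\<Sum>v\<in>S. eta (p v)) \<le> ln (real m)"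
proof -
  let ?S = "{v\<in>S. p v > 0}"
  have m: "real m > 0" using assms(5) by simp
  have z: "\<forall>v\<in>S - ?S. p v = 0"
  proof
    fix v assume "v \<in> S - ?S"
    then have "v \<in> S" "\<not> 0 < p v" by simp_all
    with assms(2)[of v] show "p v = 0" by linarith
  qed
  have z': "\<forall>v\<in>S - ?S. eta (p v) = 0"
  proof
    fix v assume "v \<in> S - ?S"
    with z have "p v = 0" by (rule bspec)
    then show "eta (p v) = 0" by simp
  qed
  have "(\<Sum>v\<in>S. eta (p v)) = (\<Sum>v\<in>?S. eta (p v))"
    by (rule sum.mono_neutral_right[OF assms(1) _ z']) simp
  also have "\<dots> \<le> (\<Sum>v\<in>?S. p v * ln (real m) + (1 / real m - p v))"
  proof (rule sum_mono)
    fix v assume "v \<in> ?S"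
    then have "eta (p v) \<le> - p v * ln (1 / real m) + (1 / real m - p v)"
      using m by (intro eta_tangent) auto
    then show "eta (p v) \<le> p v * ln (real m) + (1 / real m - p v)" using m by (simp add: ln_div)
  qed
  also have "\<dots> = sum p ?S * ln (real m) + (real (card ?S) / real m - sum p ?S)"
    by (simp add: sum.distrib sum_subtractf sum_distrib_right)
  also have "sum p ?S = 1"
    unfolding assms(3)[symmetric] by (rule sum.mono_neutral_left[OF assms(1) _ z]) simp
  also have "1 * ln (real m) + (real (card ?S) / real m - 1) \<le> ln (real m)"
    using assms(4) m by simp
  finally show ?thesis .
qed

text \<open>Finite nets of balls of radius \<open>1 / (n + 1)\<close>, one for each
  \<open>n\<close>. A ball of radius below \<open>e / 2\<close> that contains \<open>y\<close> lies
  inside the ball of radius \<open>e\<close> about \<open>y\<close>.\<close>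

lemma compact_countable_base:
  assumes "compact (UNIV :: 'a::metric_space set)"
  shows "\<exists>U :: nat \<Rightarrow> 'a set. (\<forall>i. open (U i)) \<and> (\<forall>V y. open V \<longrightarrow> y \<in> V \<longrightarrow> (\<exists>i. y \<in> U i \<and> U i \<subseteq> V))"
proof -
  have "\<exists>F. finite F \<and> (UNIV :: 'a set) \<subseteq> (\<Union>x\<in>F. ball x (1 / real (Suc n)))" for n
    using assms unfolding compact_eq_totally_bounded by simp
  then obtain F where F: "\<And>n. finite (F n)" "\<And>n. (UNIV :: 'a set) \<subseteq> (\<Union>x\<in>F n. ball x (1 / real (Suc n)))"
    by metis
  let ?B = "\<Union>n. (\<lambda>x. ball x (1 / real (Suc n))) ` F n"
  have c: "countable ?B" using F(1) by (intro countable_UN countable_image) (auto intro: countable_finite)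
  obtain a where "a \<in> F 0" using F(2)[of 0] by auto
  then have ne: "?B \<noteq> {}" by blast
  let ?U = "from_nat_into ?B"
  have "open (?U i)" for i
    using from_nat_into[OF ne, of i] by auto
  moreover have "\<exists>i. y \<in> ?U i \<and> ?U i \<subseteq> V" if V: "open V" "y \<in> V" for V y
  proof -
    obtain e where e: "e > 0" "ball y e \<subseteq> V" using V open_contains_ball by blast
    then obtain n where n: "inverse (real (Suc n)) < e / 2" using reals_Archimedean[of "e / 2"] by auto
    obtain x where x: "x \<in> F n" "dist x y < 1 / real (Suc n)" using F(2)[of n] by (auto simp: subset_iff)
    have "ball x (1 / real (Suc n)) \<subseteq> ball y e"
    proof
      fix z assume "z \<in> ball x (1 / real (Suc n))"
      then show "z \<in> ball y e"
        using n x(2) dist_triangle2[of y z x] by (simp add: dist_commute inverse_eq_divide)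
    qed
    moreover have "ball x (1 / real (Suc n)) \<in> ?B" using x(1) by blast
    then obtain i where "?U i = ball x (1 / real (Suc n))" using from_nat_into_surj[OF c] by blast
    ultimately show ?thesis using x e by (intro exI[of _ i]) auto
  qed
  ultimately show ?thesis by blast
qed

locale kronecker_system =
  fixes T :: "'g::{group_add, countable} \<Rightarrow> 'a::metric_space \<Rightarrow> 'a"
    and \<mu> :: "'a measure" and \<nu> :: "'a \<Rightarrow> 'a measure"
  assumes compact: "compact (UNIV :: 'a set)"
    and action: "meas_action T"
    and inv_erg: "invariant_ergodic T \<mu>"
    and disint: "kronecker_disintegration T \<mu> \<nu>"
begin

lemma sets_\<mu>: "sets \<mu> = sets borel" and prob_\<mu>: "prob_space \<mu>"
  using inv_erg unfolding invariant_ergodic_def by auto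

lemma space_\<mu>: "space \<mu> = UNIV" using sets_eq_imp_space_eq[OF sets_\<mu>] by simp

lemma T_borel: "T g \<in> borel \<rightarrow>\<^sub>M borel"
  using action unfolding meas_action_def by (intro borel_measurable_continuous_onI) auto

lemma T_vimage_borel: "B \<in> sets borel \<Longrightarrow> T g -` B \<in> sets borel"
  using measurable_sets[OF T_borel] by simp

lemma T_\<mu>: "T g \<in> \<mu> \<rightarrow>\<^sub>M \<mu>"
  using T_borel measurable_cong_sets[OF sets_\<mu> sets_\<mu>] by blast

lemma distr_T: "distr \<mu> \<mu> (T g) = \<mu>"
proof (rule measure_eqI)
  fix A assume "A \<in> sets (distr \<mu> \<mu> (T g))"
  then show "emeasure (distr \<mu> \<mu> (T g)) A = emeasure \<mu> A"
    using inv_erg T_\<mu> unfolding invariant_ergodic_def by (simp add: emeasure_distr space_\<mu> sets_\<mu>)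
qed simp

text \<open>Kronecker sets live in the completed \<sigma>-algebra, so the action is considered
  there. \<open>T g\<close> stays measurable because it pulls null sets back to null sets.\<close>

sublocale measure_preserving_action "completion \<mu>" T
proof -
  interpret prob_space \<mu> by (rule prob_\<mu>)
  interpret C: prob_space "completion \<mu>" by (rule prob_space_completion)
  have m: "T g \<in> completion \<mu> \<rightarrow>\<^sub>M \<mu>" for g by (rule measurable_completion[OF T_\<mu>])
  have d: "distr (completion \<mu>) \<mu> (T g) = \<mu>" for g by (simp add: distr_completion[OF T_\<mu>] distr_T)
  have "distr (completion \<mu>) (completion \<mu>) (T g) = completion \<mu>" for g
    using completion.completion_distr_eq[OF m, of g] by (simp add: d)
  moreover have "T g \<in> completion \<mu> \<rightarrow>\<^sub>M completion \<mu>" for g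
    by (rule completion.measurable_completion2[OF m]) (simp add: d)
  moreover have "T (g + h) x = T g (T h x)" "T 0 x = x" for g h x
    using action unfolding meas_action_def by auto
  ultimately show "measure_preserving_action (completion \<mu>) T"
    by unfold_locales (auto simp: space_\<mu>)
qed

lemma borel_sets: "B \<in> sets borel \<Longrightarrow> B \<in> sets (completion \<mu>)"
  by (rule sets_completionI_sets) (simp add: sets_\<mu>)

lemma K_eq: "kronecker_sets T \<mu> = K"
proof -
  have "almost_periodic (indicator B) \<longleftrightarrow> (\<forall>e>0. \<exists>F. finite F \<and> (\<forall>g. \<exists>h\<in>F. L2dist_shift T \<mu> B g h < e))"
    if B: "B \<in> sets (completion \<mu>)" for B
  proof -
    have b: "bdd_meas (indicator B)" by (rule bdd_meas_indicator[OF B])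
    have L: "L2dist_shift T \<mu> B g h = sqrt (shift_dist (indicator B) g h)" for g h
      unfolding L2dist_shift_def shift_dist_def by simp
    have "almost_periodic (indicator B) \<longleftrightarrow> (\<forall>e>0. \<exists>F. finite F \<and> (\<forall>g. \<exists>h\<in>F. shift_dist (indicator B) g h < e))"
      unfolding almost_periodic_def using b totbdd_iff_net[OF shift_dist_nonneg shift_dist_sym shift_dist_tri[OF b]] by simp
    also have "\<dots> \<longleftrightarrow> (\<forall>e>0. \<exists>F. finite F \<and> (\<forall>g. \<exists>h\<in>F. sqrt (shift_dist (indicator B) g h) < e))"
    proof (intro iffI allI impI)
      fix e :: real assume "\<forall>e>0. \<exists>F. finite F \<and> (\<forall>g. \<exists>h\<in>F. shift_dist (indicator B) g h < e)" "e > 0"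
      then have "\<exists>F. finite F \<and> (\<forall>g. \<exists>h\<in>F. shift_dist (indicator B) g h < e\<^sup>2)" by simp
      then show "\<exists>F. finite F \<and> (\<forall>g. \<exists>h\<in>F. sqrt (shift_dist (indicator B) g h) < e)"
        using \<open>e > 0\<close> by (metis less_imp_le real_less_rsqrt real_sqrt_less_iff real_sqrt_unique)
    next
      fix e :: real assume "\<forall>e>0. \<exists>F. finite F \<and> (\<forall>g. \<exists>h\<in>F. sqrt (shift_dist (indicator B) g h) < e)" "e > 0"
      moreover have "sqrt e > 0" using \<open>e > 0\<close> by simp
      ultimately have "\<exists>F. finite F \<and> (\<forall>g. \<exists>h\<in>F. sqrt (shift_dist (indicator B) g h) < sqrt e)" by blast
      then show "\<exists>F. finite F \<and> (\<forall>g. \<exists>h\<in>F. shift_dist (indicator B) g h < e)" by simp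
    qed
    finally show ?thesis unfolding L .
  qed
  then show ?thesis unfolding kronecker_sets_def K_def by auto
qed

lemma prob_\<nu>: "prob_space (\<nu> x)" and sets_\<nu>: "sets (\<nu> x) = sets borel"
  using disint unfolding kronecker_disintegration_def by auto

lemma space_\<nu>: "space (\<nu> x) = UNIV" using sets_eq_imp_space_eq[OF sets_\<nu>] by simp

lemma \<nu>_le_1: "measure (\<nu> x) B \<le> 1"
  using prob_space.prob_le_1[OF prob_\<nu>] .

lemma \<nu>_kron_alg: "B \<in> sets borel \<Longrightarrow> (\<lambda>x. measure (\<nu> x) B) \<in> borel_measurable kron_alg"
  using disint unfolding kronecker_disintegration_def K_eq kron_alg_def by auto

lemma \<nu>_int: "B \<in> sets borel \<Longrightarrow> C \<in> K \<Longrightarrow>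
    prob (C \<inter> B) = (\<integral>x. indicator C x * measure (\<nu> x) B \<partial>completion \<mu>)"
  using disint unfolding kronecker_disintegration_def K_eq by (simp add: set_lebesgue_integral_def)

lemma bdd_meas_kron_alg: "f \<in> borel_measurable kron_alg \<Longrightarrow> (\<And>x. \<bar>f x\<bar> \<le> c) \<Longrightarrow> bdd_meas f"
  using measurable_from_subalg[OF kron_alg_sub] by (rule bdmI) auto

lemma \<nu>_bdd_meas: "B \<in> sets borel \<Longrightarrow> bdd_meas (\<lambda>x. measure (\<nu> x) B)"
  by (rule bdd_meas_kron_alg[OF \<nu>_kron_alg, of _ 1]) (simp_all add: \<nu>_le_1)

lemma cond_prob_charact:
  assumes B: "B \<in> sets (completion \<mu>)" and v: "v \<in> borel_measurable kron_alg" "bdd_meas v"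
    and int: "\<And>C. C \<in> K \<Longrightarrow> prob (C \<inter> B) = (\<integral>x. indicator C x * v x \<partial>completion \<mu>)"
  shows "AE x in completion \<mu>. real_cond_exp (completion \<mu>) kron_alg (indicator B) x = v x"
proof (rule kron_alg.real_cond_exp_charact)
  fix C assume "C \<in> sets kron_alg"
  then have C: "C \<in> K" by (simp add: sets_kron_alg)
  have "(\<integral>x. indicator C x * indicator B x \<partial>completion \<mu>) = (\<integral>x. (indicator (C \<inter> B) x :: real) \<partial>completion \<mu>)"
    by (intro Bochner_Integration.integral_cong refl) (auto simp: indicator_def)
  also have "\<dots> = prob (C \<inter> B)" using B K_sets[OF C] by (simp add: space_\<mu>)
  finally show "(LINT x:C|completion \<mu>. indicator B x) = (LINT x:C|completion \<mu>. v x)"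
    using int[OF C] by (simp add: set_lebesgue_integral_def)
qed (auto intro: bdd_meas_integrable bdd_meas_indicator B v)

text \<open>Extends the defining identity of the disintegration from Kronecker sets to
  Kronecker-measurable functions \<open>f\<close>, by pulling \<open>f\<close> out of a conditional
  expectation.\<close>

lemma \<nu>_swap:
  assumes B: "B \<in> sets borel" and f: "f \<in> borel_measurable kron_alg" "bdd_meas f"
  shows "(\<integral>x. f x * indicator B x \<partial>completion \<mu>) = (\<integral>x. f x * measure (\<nu> x) B \<partial>completion \<mu>)"
proof -
  note sB = borel_sets[OF B]
  have ae: "AE x in completion \<mu>. real_cond_exp (completion \<mu>) kron_alg (indicator B) x = measure (\<nu> x) B"
    by (rule cond_prob_charact[OF sB \<nu>_kron_alg[OF B] \<nu>_bdd_meas[OF B] \<nu>_int[OF B]])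
  have "(\<integral>x. f x * indicator B x \<partial>completion \<mu>) = (\<integral>x. f x * real_cond_exp (completion \<mu>) kron_alg (indicator B) x \<partial>completion \<mu>)"
    by (rule kron_alg.real_cond_exp_intg(2)[symmetric])
      (auto intro!: f bdd_meas_integrable bdd_meas_mult bdd_meas_indicator sB bdd_meas_measurable[OF bdd_meas_indicator])
  also have "\<dots> = (\<integral>x. f x * measure (\<nu> x) B \<partial>completion \<mu>)"
    using ae bdd_meas_measurable[OF f(2)] bdd_meas_measurable[OF \<nu>_bdd_meas[OF B]] by (intro integral_cong_AE) auto
  finally show ?thesis .
qed

lemma \<nu>_null: assumes "N \<in> null_sets \<mu>" shows "AE x in completion \<mu>. measure (\<nu> x) N = 0"
proof -
  have N: "N \<in> sets borel" using assms by (auto simp: null_sets_def sets_\<mu>)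
  have "UNIV \<in> K" using K_Compl[OF K_empty] by simp
  from \<nu>_int[OF N this] have "(\<integral>x. measure (\<nu> x) N \<partial>completion \<mu>) = prob N" by simp
  also have "\<dots> = 0" using assms by (simp add: measure_def null_sets_def)
  finally have "(\<integral>x. measure (\<nu> x) N \<partial>completion \<mu>) = 0" .
  then show ?thesis
    by (rule integral_nonneg_eq_0_iff_AE[OF bdd_meas_integrable[OF \<nu>_bdd_meas[OF N]], THEN iffD1, rotated]) simp
qed

lemma \<nu>_equivariant:
  assumes B: "B \<in> sets borel"
  shows "AE x in completion \<mu>. measure (\<nu> (T g x)) B = measure (\<nu> x) (T g -` B)"
proof -
  have TB: "T g -` B \<in> sets borel" by (rule T_vimage_borel[OF B])
  have 1: "AE x in completion \<mu>. real_cond_exp (completion \<mu>) kron_alg (indicator (T g -` B)) x = measure (\<nu> x) (T g -` B)"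
    by (rule cond_prob_charact[OF borel_sets[OF TB] \<nu>_kron_alg[OF TB] \<nu>_bdd_meas[OF TB] \<nu>_int[OF TB]])
  have TKM: "T g \<in> kron_alg \<rightarrow>\<^sub>M kron_alg"
    by (rule measurableI) (auto simp: space_kron_alg sets_kron_alg K_vimage)
  have 2: "AE x in completion \<mu>. real_cond_exp (completion \<mu>) kron_alg (indicator (T g -` B)) x = measure (\<nu> (T g x)) B"
  proof (rule cond_prob_charact[OF borel_sets[OF TB]])
    show "(\<lambda>x. measure (\<nu> (T g x)) B) \<in> borel_measurable kron_alg"
      by (rule measurable_compose[OF TKM \<nu>_kron_alg[OF B]])
    show "bdd_meas (\<lambda>x. measure (\<nu> (T g x)) B)" by (rule bdd_meas_T[OF \<nu>_bdd_meas[OF B]])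
    fix C assume C: "C \<in> K"
    \<comment> \<open>Chosen so that its preimage under \<open>T g\<close> is \<open>C\<close>,
      which turns the integral over \<open>C\<close> into a translated one.\<close>
    let ?C = "T (- g) -` C"
    have C': "?C \<in> K" by (rule K_vimage[OF C])
    have TT: "T (- g) (T g x) = x" for x using T_add[of "- g" g x] by (simp add: T_0)
    have "prob (C \<inter> T g -` B) = prob (T g -` (?C \<inter> B))" by (simp add: vimage_def TT Int_def)
    also have "\<dots> = prob (?C \<inter> B)" using K_sets[OF C'] borel_sets[OF B] by (intro prob_T) auto
    also have "\<dots> = (\<integral>x. indicator ?C x * measure (\<nu> x) B \<partial>completion \<mu>)" by (rule \<nu>_int[OF B C'])
    also have "\<dots> = (\<integral>x. indicator ?C (T g x) * measure (\<nu> (T g x)) B \<partial>completion \<mu>)"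
      by (rule integral_T[symmetric]) (intro bdd_meas_measurable bdd_meas_mult bdd_meas_indicator K_sets C' \<nu>_bdd_meas B)
    also have "\<dots> = (\<integral>x. indicator C x * measure (\<nu> (T g x)) B \<partial>completion \<mu>)"
      by (simp add: indicator_def TT)
    finally show "prob (C \<inter> T g -` B) = (\<integral>x. indicator C x * measure (\<nu> (T g x)) B \<partial>completion \<mu>)" .
  qed
  show ?thesis using 1 2 by eventually_elim simp
qed

text \<open>Ergodicity is given for strictly invariant Borel sets, whereas \<open>E\<close> is only
  completed-measurable and invariant off a null set. \<open>E\<close> is first replaced by a Borel
  set \<open>S\<close>, then by the intersection of all preimages of \<open>S\<close>. Countability
  of the group keeps that set Borel and almost everywhere equal to \<open>E\<close>.\<close>

lemma ergodic:
  assumes E: "E \<in> sets (completion \<mu>)" and inv: "AE x in completion \<mu>. \<forall>g. T g x \<in> E \<longleftrightarrow> x \<in> E"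
  shows "prob E = 0 \<or> prob E = 1"
proof -
  from E obtain S N N' where S: "E = S \<union> N" "N \<subseteq> N'" "N' \<in> null_sets \<mu>" "S \<in> sets \<mu>"
    by (rule sets_completionE)
  have "AE x in completion \<mu>. x \<notin> N'"
    using AE_not_in[OF S(3)] by (rule AE_completion)
  then have ES: "AE x in completion \<mu>. x \<in> E \<longleftrightarrow> x \<in> S" by eventually_elim (use S in auto)
  have "AE x in completion \<mu>. T g x \<in> E \<longleftrightarrow> T g x \<in> S" for g by (rule AE_T[OF ES])
  then have TES: "AE x in completion \<mu>. \<forall>g. T g x \<in> E \<longleftrightarrow> T g x \<in> S" by (simp add: AE_all_countable)
  let ?E = "\<Inter>g. T g -` S"
  have Eb: "?E \<in> sets borel" using S(4) by (intro sets.countable_INT') (auto simp: sets_\<mu> intro: T_vimage_borel)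
  have "T h -` ?E = ?E" for h
  proof -
    have "(\<forall>g. T g (T h x) \<in> S) \<longleftrightarrow> (\<forall>g. T g x \<in> S)" for x
    proof
      assume *: "\<forall>g. T g (T h x) \<in> S"
      show "\<forall>g. T g x \<in> S"
      proof
        fix g
        show "T g x \<in> S" using *[rule_format, of "g - h"] T_add[of "g - h" h x] by simp
      qed
    next
      assume *: "\<forall>g. T g x \<in> S"
      show "\<forall>g. T g (T h x) \<in> S"
      proof
        fix g
        show "T g (T h x) \<in> S" using *[rule_format, of "g + h"] T_add[of g h x] by simp
      qed
    qed
    then show ?thesis by (simp add: set_eq_iff)
  qed
  then have "measure \<mu> ?E = 0 \<or> measure \<mu> ?E = 1"
    using inv_erg Eb unfolding invariant_ergodic_def by blast
  moreover have "measure \<mu> ?E = prob ?E" using Eb by (simp add: sets_\<mu>)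
  moreover have "prob ?E = prob E"
  proof (rule measure_eq_AE)
    show "AE x in completion \<mu>. x \<in> ?E \<longleftrightarrow> x \<in> E"
      using inv TES by eventually_elim auto
  qed (use E borel_sets[OF Eb] in auto)
  ultimately show ?thesis by simp
qed

text \<open>The join may contain the empty set, which is no level set of the itinerary. Apart from
  it the two families of sets coincide, and \<open>eta 0 = 0\<close>.\<close>

lemma entropy_join:
  assumes \<alpha>: "fin_partition \<mu> \<alpha>" and X: "\<And>x y. X x = X y \<longleftrightarrow> (\<forall>A\<in>\<alpha>. x \<in> A \<longleftrightarrow> y \<in> A)"
  shows "entropy_part \<mu> (join_seq T \<alpha> gs n) = ent (itinerary X (map gs [1..<Suc n]))"
proof -
  let ?Z = "itinerary X (map gs [1..<Suc n])"
  let ?J = "join_seq T \<alpha> gs n"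
  have cover: "\<exists>A\<in>\<alpha>. x \<in> A" for x using \<alpha> unfolding fin_partition_def by blast
  have disj: "A = B" if "A \<in> \<alpha>" "B \<in> \<alpha>" "x \<in> A" "x \<in> B" for A B x
    using \<alpha> that unfolding fin_partition_def by blast
  have cellX: "y \<in> A \<longleftrightarrow> X y = X x" if "A \<in> \<alpha>" "x \<in> A" for x y A
    unfolding X using that disj by blast
  have cell: "(\<Inter>i\<in>{1..n}. T (gs i) -` c i) = ?Z -` {?Z x}"
    if "\<forall>i\<in>{1..n}. c i \<in> \<alpha> \<and> T (gs i) x \<in> c i" for c x
  proof -
    have A: "y \<in> (\<Inter>i\<in>{1..n}. T (gs i) -` c i) \<longleftrightarrow> (\<forall>i\<in>{1..n}. X (T (gs i) y) = X (T (gs i) x))" for y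
    proof -
      have "T (gs i) y \<in> c i \<longleftrightarrow> X (T (gs i) y) = X (T (gs i) x)" if i: "i \<in> {1..n}" for i
        using \<open>\<forall>i\<in>{1..n}. c i \<in> \<alpha> \<and> T (gs i) x \<in> c i\<close> i by (intro cellX) auto
      then show ?thesis by simp
    qed
    have B: "?Z y = ?Z x \<longleftrightarrow> (\<forall>i\<in>{1..n}. X (T (gs i) y) = X (T (gs i) x))" for y
      unfolding itinerary_def by (auto simp del: upt_Suc simp: atLeastLessThanSuc_atLeastAtMost)
    show ?thesis by (rule set_eqI) (unfold A vimage_singleton_eq B, rule refl)
  qed
  have cells: "?J - {{}} = range (\<lambda>x. ?Z -` {?Z x})"
  proof (intro set_eqI iffI)
    fix C assume "C \<in> ?J - {{}}"
    then obtain c x where c: "C = (\<Inter>i\<in>{1..n}. T (gs i) -` c i)" "\<forall>i\<in>{1..n}. c i \<in> \<alpha>" "x \<in> C"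
      unfolding join_seq_def by blast
    then have "\<forall>i\<in>{1..n}. c i \<in> \<alpha> \<and> T (gs i) x \<in> c i" by simp
    from cell[OF this] have "C = ?Z -` {?Z x}" unfolding c(1) .
    then show "C \<in> range (\<lambda>x. ?Z -` {?Z x})" by blast
  next
    fix C assume "C \<in> range (\<lambda>x. ?Z -` {?Z x})"
    then obtain x where x: "C = ?Z -` {?Z x}" by blast
    obtain A where A: "\<And>y. A y \<in> \<alpha>" "\<And>y. y \<in> A y" using cover by metis
    have "(\<Inter>i\<in>{1..n}. T (gs i) -` A (T (gs i) x)) = C" unfolding x by (rule cell) (simp add: A)
    then have "C \<in> ?J" unfolding join_seq_def using A(1)
      by (intro CollectI exI[of _ "\<lambda>i. A (T (gs i) x)"]) simp
    moreover have "x \<in> C" using x by simp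
    ultimately show "C \<in> ?J - {{}}" by auto
  qed
  have fin: "finite ?J"
  proof -
    have "?J \<subseteq> (\<lambda>c. \<Inter>i\<in>{1..n}. T (gs i) -` c i) ` ({1..n} \<rightarrow>\<^sub>E \<alpha>)"
    proof
      fix C assume "C \<in> ?J"
      then obtain c where c: "C = (\<Inter>i\<in>{1..n}. T (gs i) -` c i)" "\<forall>i\<in>{1..n}. c i \<in> \<alpha>" unfolding join_seq_def by blast
      then show "C \<in> (\<lambda>c. \<Inter>i\<in>{1..n}. T (gs i) -` c i) ` ({1..n} \<rightarrow>\<^sub>E \<alpha>)"
      proof (intro image_eqI[of _ _ "restrict c {1..n}"])
        show "C = (\<Inter>i\<in>{1..n}. T (gs i) -` restrict c {1..n} i)" unfolding c(1) by simp
        show "restrict c {1..n} \<in> {1..n} \<rightarrow>\<^sub>E \<alpha>" using c(2) by simp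
      qed
    qed
    moreover have "finite ({1..n} \<rightarrow>\<^sub>E \<alpha>)" using \<alpha> unfolding fin_partition_def by (intro finite_PiE) auto
    ultimately show ?thesis by (rule finite_surj[rotated])
  qed
  have "entropy_part \<mu> ?J = (\<Sum>C\<in>?J. eta (prob C))" by (simp add: entropy_part_def eta_def sum_negf)
  also have "\<dots> = (\<Sum>C\<in>?J - {{}}. eta (prob C))" by (rule sum.mono_neutral_right) (use fin in auto)
  also have "\<dots> = ent ?Z" unfolding cells ent_def ..
  finally show ?thesis .
qed

lemma max_seq_entropy_part_eq:
  assumes \<alpha>: "fin_partition \<mu> \<alpha>" and X: "\<And>x y. X x = X y \<longleftrightarrow> (\<forall>A\<in>\<alpha>. x \<in> A \<longleftrightarrow> y \<in> A)"
    and "finite_valued X" "kron_version X u"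
  shows "max_seq_entropy_part T \<mu> \<alpha> = ereal (kron_entropy X u)"
  unfolding max_seq_entropy_part_def seq_entropy_def entropy_join[OF \<alpha> X] using assms(3,4)
  by (rule max_seq_entropy_eq)

end

section \<open>Fibre measures\<close>

context kronecker_system begin

definition base :: "nat \<Rightarrow> 'a set" where
  "base = (SOME base. (\<forall>i. open (base i)) \<and> (\<forall>V y. open V \<longrightarrow> y \<in> V \<longrightarrow> (\<exists>i. y \<in> base i \<and> base i \<subseteq> V)))"

lemma base_open: "open (base i)" and base_nhds: "open V \<Longrightarrow> y \<in> V \<Longrightarrow> \<exists>i. y \<in> base i \<and> base i \<subseteq> V"
  using someI_ex[OF compact_countable_base[OF compact]] unfolding base_def[symmetric] by auto

text \<open>The complement of the support is a union of null open sets, and the countable base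
  reduces it to countably many.\<close>

lemma msupp_Compl_null: "- msupp (\<nu> x) \<in> null_sets (\<nu> x)"
proof -
  let ?I = "{i. base i \<in> null_sets (\<nu> x)}"
  have "(\<Union>i\<in>?I. base i) \<in> null_sets (\<nu> x)"
    by (rule null_sets_UN') (auto intro: countable_subset[of _ UNIV])
  moreover have "- msupp (\<nu> x) = (\<Union>i\<in>?I. base i)"
  proof (intro set_eqI iffI)
    fix y assume "y \<in> - msupp (\<nu> x)"
    then obtain V where V: "open V" "y \<in> V" "emeasure (\<nu> x) V = 0" unfolding msupp_def by auto
    obtain i where i: "y \<in> base i" "base i \<subseteq> V" using base_nhds[OF V(1,2)] by blast
    have "V \<in> null_sets (\<nu> x)" using V by (simp add: null_sets_def sets_\<nu>)
    then have "base i \<in> null_sets (\<nu> x)"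
      by (rule null_sets_subset) (use i base_open[of i] in \<open>auto simp: sets_\<nu>\<close>)
    then show "y \<in> (\<Union>i\<in>?I. base i)" using i by blast
  next
    fix y assume "y \<in> (\<Union>i\<in>?I. base i)"
    then obtain i where "y \<in> base i" "emeasure (\<nu> x) (base i) = 0" by (auto simp: null_sets_def)
    then show "y \<in> - msupp (\<nu> x)" unfolding msupp_def using base_open[of i] by fastforce
  qed
  ultimately show ?thesis by simp
qed

lemma msupp_meets:
  assumes B: "B \<in> sets borel" "measure (\<nu> x) B > 0" shows "B \<inter> msupp (\<nu> x) \<noteq> {}"
proof
  assume "B \<inter> msupp (\<nu> x) = {}"
  then have "B \<subseteq> - msupp (\<nu> x)" by blast
  then have "B \<in> null_sets (\<nu> x)"
    by (intro null_sets_subset[OF msupp_Compl_null]) (use B in \<open>auto simp: sets_\<nu>\<close>)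
  then show False using B by (simp add: measure_def null_sets_def)
qed

lemma msupp_nonempty: "msupp (\<nu> x) \<noteq> {}"
  using msupp_meets[of UNIV x] prob_space.prob_space[OF prob_\<nu>, of x] by (simp add: space_\<nu>)

text \<open>One Borel null set \<open>N\<close> is removed from all cells to make them Borel; the
  masses \<open>\<nu> x (A - N)\<close> then form a version of the conditional probabilities and
  almost everywhere have total 1, since \<open>N\<close> is null for almost every \<nu> x.\<close>

lemma max_seq_entropy_part_le:
  assumes \<alpha>: "fin_partition \<mu> \<alpha>" and supp: "AE x in completion \<mu>. ecard (msupp (\<nu> x)) = enat m"
  shows "max_seq_entropy_part T \<mu> \<alpha> \<le> ereal (ln (real m))"
proof -
  have "\<forall>x. \<exists>A. A \<in> \<alpha> \<and> x \<in> A" using \<alpha> unfolding fin_partition_def by blast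
  then obtain X where X: "\<And>x. X x \<in> \<alpha>" "\<And>x. x \<in> X x" by metis
  have disj: "A = B" if "A \<in> \<alpha>" "B \<in> \<alpha>" "x \<in> A" "x \<in> B" for A B x
    using \<alpha> that unfolding fin_partition_def by blast
  have rX: "range X \<subseteq> \<alpha>" using X by blast
  have in_iff: "x \<in> A \<longleftrightarrow> X x = A" if "A \<in> \<alpha>" for x A
  proof
    assume "x \<in> A"
    from disj[OF X(1)[of x] that X(2)[of x] this] show "X x = A" .
  next
    assume "X x = A" then show "x \<in> A" using X(2)[of x] by simp
  qed
  have vX: "X -` {A} = A" if "A \<in> \<alpha>" for A
    by (rule set_eqI) (simp add: in_iff[OF that])
  have \<alpha>s: "A \<in> sets (completion \<mu>)" if "A \<in> \<alpha>" for A
    by (rule subsetD[OF _ that]) (use \<alpha> in \<open>simp add: fin_partition_def\<close>)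
  have fX: "finite (range X)" by (rule finite_subset[OF rX]) (use \<alpha> in \<open>simp add: fin_partition_def\<close>)
  have finX: "finite_valued X" unfolding finite_valued_def
  proof (intro conjI fX allI)
    fix v
    show "X -` {v} \<in> sets (completion \<mu>)"
    proof (cases "v \<in> \<alpha>")
      case False
      then have "X -` {v} = {}" using X(1) by auto
      then show ?thesis by simp
    qed (simp add: vX \<alpha>s)
  qed
  have "\<forall>A\<in>\<alpha>. \<exists>N. N \<in> null_sets \<mu> \<and> (\<exists>S\<in>sets \<mu>. S - N = A - N)"
  proof
    fix A assume "A \<in> \<alpha>"
    from \<alpha>s[OF this] obtain S N N' where S: "A = S \<union> N" "N \<subseteq> N'" "N' \<in> null_sets \<mu>" "S \<in> sets \<mu>"
      by (rule sets_completionE)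
    then show "\<exists>N. N \<in> null_sets \<mu> \<and> (\<exists>S\<in>sets \<mu>. S - N = A - N)"
      by (intro exI[of _ N'] conjI bexI[of _ S]) auto
  qed
  then obtain NN where NN: "\<And>A. A \<in> \<alpha> \<Longrightarrow> NN A \<in> null_sets \<mu>" "\<And>A. A \<in> \<alpha> \<Longrightarrow> \<exists>S\<in>sets \<mu>. S - NN A = A - NN A"
    by metis
  define N where "N = (\<Union>A\<in>\<alpha>. NN A)"
  have N: "N \<in> null_sets \<mu>" unfolding N_def
    by (rule null_sets_UN') (use \<alpha> NN in \<open>auto simp: fin_partition_def intro: countable_finite\<close>)
  have AN: "A - N \<in> sets borel" if A: "A \<in> \<alpha>" for A
  proof -
    obtain S where S: "S \<in> sets \<mu>" "S - NN A = A - NN A" using NN(2)[OF A] by blast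
    have "A - N = S - N" using S(2) A unfolding N_def by blast
    moreover have "S - N \<in> sets \<mu>" using S(1) N by (auto simp: null_sets_def)
    ultimately show ?thesis by (simp add: sets_\<mu>)
  qed
  define u where "u A x = measure (\<nu> x) (A - N)" for A x
  have usum: "AE x in completion \<mu>. (\<Sum>v\<in>range X. u v x) = 1"
    using \<nu>_null[OF N]
  proof eventually_elim
    case (elim x)
    interpret n: prob_space "\<nu> x" by (rule prob_\<nu>)
    have Nb: "N \<in> sets (\<nu> x)" using N by (simp add: null_sets_def sets_\<mu> sets_\<nu>)
    have "(\<Sum>v\<in>range X. u v x) = measure (\<nu> x) (\<Union>v\<in>range X. v - N)"
      unfolding u_def
    proof (rule n.finite_measure_finite_Union[symmetric])
      show "(\<lambda>v. v - N) ` range X \<subseteq> sets (\<nu> x)" using AN rX by (auto simp: sets_\<nu>)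
      show "disjoint_family_on (\<lambda>v. v - N) (range X)"
        unfolding disjoint_family_on_def using disj rX by blast
    qed (rule fX)
    also have "(\<Union>v\<in>range X. v - N) = space (\<nu> x) - N" using X(2) by (auto simp: space_\<nu>)
    also have "measure (\<nu> x) \<dots> = 1 - measure (\<nu> x) N" by (rule n.prob_compl[OF Nb])
    finally show ?case using elim by simp
  qed
  have kv: "kron_version X u" unfolding kron_version_def
  proof (intro conjI ballI allI usum)
    fix v assume "v \<in> range X"
    then have v: "v \<in> \<alpha>" using rX by blast
    show "u v \<in> borel_measurable kron_alg" unfolding u_def by (rule \<nu>_kron_alg[OF AN[OF v]])
    show "0 \<le> u v x" "u v x \<le> 1" for x by (simp_all add: u_def \<nu>_le_1)
    fix C assume C: "C \<in> K"
    have "prob (C \<inter> X -` {v}) = prob (C \<inter> (v - N))"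
    proof (rule measure_eq_AE)
      have "AE x in completion \<mu>. x \<notin> N" using AE_not_in[OF N] by (rule AE_completion)
      then show "AE x in completion \<mu>. (x \<in> C \<inter> X -` {v}) = (x \<in> C \<inter> (v - N))"
        unfolding vX[OF v] by eventually_elim auto
      show "C \<inter> X -` {v} \<in> sets (completion \<mu>)" "C \<inter> (v - N) \<in> sets (completion \<mu>)"
        using K_sets[OF C] finite_valued_sets[OF finX, of v] borel_sets[OF AN[OF v]] by auto
    qed
    then show "prob (C \<inter> X -` {v}) = (\<integral>x. indicator C x * u v x \<partial>completion \<mu>)"
      unfolding u_def using \<nu>_int[OF AN[OF v] C] by simp
  qed
  have "max_seq_entropy_part T \<mu> \<alpha> = ereal (kron_entropy X u)"
  proof (rule max_seq_entropy_part_eq[OF \<alpha> _ finX kv])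
    show "X x = X y \<longleftrightarrow> (\<forall>A\<in>\<alpha>. x \<in> A \<longleftrightarrow> y \<in> A)" for x y
      using in_iff X(1) by (metis (no_types))
  qed
  moreover have "kron_entropy X u \<le> (\<integral>x. ln (real m) \<partial>completion \<mu>)"
    unfolding kron_entropy_def
  proof (rule integral_mono_AE)
    show "integrable (completion \<mu>) (\<lambda>x. \<Sum>v\<in>range X. eta (u v x))"
      by (intro bdd_meas_integrable bdd_meas_sum eta_u_bdd_meas[OF finX kv])
    show "AE x in completion \<mu>. (\<Sum>v\<in>range X. eta (u v x)) \<le> ln (real m)"
      using usum supp
    proof eventually_elim
      case (elim x)
      let ?S = "msupp (\<nu> x)"
      have S: "finite ?S" "card ?S = m" using elim(2) by (auto simp: ecard_def split: if_splits)
      have "m \<ge> 1" using S msupp_nonempty[of x] by (metis One_nat_def Suc_leI card_gt_0_iff)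
      moreover have "card {v \<in> range X. u v x > 0} \<le> m"
      proof -
        \<comment> \<open>A cell of positive mass contains a support point, and disjoint cells
          contain different ones.\<close>
        have "\<exists>p. p \<in> (v - N) \<inter> ?S" if "v \<in> {v \<in> range X. u v x > 0}" for v
          using msupp_meets[OF AN, of v x] that rX by (auto simp: u_def)
        then obtain p where p: "\<And>v. v \<in> {v \<in> range X. u v x > 0} \<Longrightarrow> p v \<in> (v - N) \<inter> ?S" by metis
        have "inj_on p {v \<in> range X. u v x > 0}"
        proof (rule inj_onI)
          fix v w assume vw: "v \<in> {v \<in> range X. u v x > 0}" "w \<in> {v \<in> range X. u v x > 0}" "p v = p w"
          then show "v = w" using p[OF vw(1)] p[OF vw(2)] rX by (intro disj[of v w "p v"]) auto
        qed
        moreover have "p ` {v \<in> range X. u v x > 0} \<subseteq> ?S" using p by auto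
        ultimately have "card {v \<in> range X. u v x > 0} \<le> card ?S" by (rule card_inj_on_le) (rule S)
        then show ?thesis using S by simp
      qed
      ultimately show ?case using elim(1) by (intro sum_eta_le_ln_card[OF fX]) (auto simp: u_def)
    qed
  qed simp
  moreover have "(\<integral>x. ln (real m) \<partial>completion \<mu>) = ln (real m)"
    using prob_space.prob_space[OF prob_\<mu>] by simp
  ultimately show ?thesis using prob_space.prob_space[OF prob_\<mu>] by simp
qed

section \<open>Generating partitions and the masses of points\<close>

definition code :: "nat \<Rightarrow> 'a \<Rightarrow> nat set" where "code n x = {i. i < n \<and> x \<in> base i}"

lemma range_code: "range (code n) \<subseteq> Pow {..<n}" unfolding code_def by auto

lemma finite_range_code: "finite (range (code n))" by (rule finite_subset[OF range_code]) simp

lemma code_cell_borel: "code n -` {V} \<in> sets borel"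
proof -
  have [measurable]: "base i \<in> sets borel" for i using base_open by simp
  have "code n -` {V} = {x \<in> space borel. \<forall>i. (i < n \<and> x \<in> base i) \<longleftrightarrow> i \<in> V}" unfolding code_def by auto
  also have "\<dots> \<in> sets borel" by measurable
  finally show ?thesis .
qed

lemma finite_valued_code: "finite_valued (code n)"
  unfolding finite_valued_def using finite_range_code borel_sets[OF code_cell_borel] by blast

lemma kron_version_code: "kron_version (code n) (\<lambda>V x. measure (\<nu> x) (code n -` {V}))"
  unfolding kron_version_def
proof (intro conjI ballI allI AE_I2)
  fix x
  interpret n: prob_space "\<nu> x" by (rule prob_\<nu>)
  have "(\<Sum>V\<in>range (code n). measure (\<nu> x) (code n -` {V})) = measure (\<nu> x) (\<Union>V\<in>range (code n). code n -` {V})"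
    by (rule n.finite_measure_finite_Union[symmetric])
      (auto simp: finite_range_code sets_\<nu> code_cell_borel disjoint_family_on_def)
  also have "(\<Union>V\<in>range (code n). code n -` {V}) = space (\<nu> x)" by (auto simp: space_\<nu>)
  finally show "(\<Sum>V\<in>range (code n). measure (\<nu> x) (code n -` {V})) = 1" by (simp add: n.prob_space)
qed (auto simp: \<nu>_kron_alg code_cell_borel \<nu>_le_1 \<nu>_int)

text \<open>Its negative logarithm is the conditional information function of the partition by
  \<open>code n\<close> given the Kronecker \<sigma>-algebra.\<close>

definition cell_mass :: "nat \<Rightarrow> 'a \<Rightarrow> real" where "cell_mass n x = measure (\<nu> x) (code n -` {code n x})"

definition point_mass :: "'a \<Rightarrow> real" where "point_mass x = measure (\<nu> x) {x}"

lemma cells_Inter: "(\<Inter>n. code n -` {code n x}) = {x}"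
proof (intro set_eqI iffI)
  fix y assume y: "y \<in> (\<Inter>n. code n -` {code n x})"
  show "y \<in> {x}"
  proof (rule ccontr)
    assume "y \<notin> {x}"
    then obtain i where i: "x \<in> base i" "base i \<subseteq> - {y}" using base_nhds[of "- {y}" x] by auto
    have "code (Suc i) y = code (Suc i) x" using y by blast
    moreover have "i \<in> code (Suc i) x" "i \<notin> code (Suc i) y" using i by (auto simp: code_def)
    ultimately show False by blast
  qed
qed simp

lemma cells_decseq: "decseq (\<lambda>n. code n -` {code n x})"
proof (rule decseq_SucI)
  fix n
  have "code n y = {i \<in> code (Suc n) y. i < n}" for y by (auto simp: code_def)
  then show "code (Suc n) -` {code (Suc n) x} \<subseteq> code n -` {code n x}" by auto
qed

lemma cell_mass_tendsto: "(\<lambda>n. cell_mass n x) \<longlonglongrightarrow> point_mass x"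
proof -
  interpret n: prob_space "\<nu> x" by (rule prob_\<nu>)
  show ?thesis unfolding cell_mass_def point_mass_def cells_Inter[of x, symmetric]
    by (rule n.finite_Lim_measure_decseq[OF _ cells_decseq]) (auto simp: sets_\<nu> code_cell_borel)
qed

lemma point_mass_le_cell_mass: "point_mass x \<le> cell_mass n x"
proof -
  interpret n: prob_space "\<nu> x" by (rule prob_\<nu>)
  show ?thesis unfolding point_mass_def cell_mass_def by (rule n.finite_measure_mono) (auto simp: sets_\<nu> code_cell_borel)
qed

text \<open>In \<open>cell_mass\<close> the point enters twice, through \<nu> x and through its
  cell. Separating the two gives sums of the shape needed for measurability and for
  \<open>\<nu>_swap\<close>.\<close>

lemma cell_sum: "(\<Sum>V\<in>range (code n). indicator (code n -` {V}) x * h (measure (\<nu> x) (code n -` {V}))) = (h (cell_mass n x) :: real)"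
proof -
  have "(\<Sum>V\<in>range (code n). indicator (code n -` {V}) x * h (measure (\<nu> x) (code n -` {V}))) =
      (\<Sum>V\<in>range (code n). if V = code n x then h (cell_mass n x) else 0)"
    by (intro sum.cong refl) (auto simp: indicator_def cell_mass_def)
  then show ?thesis using finite_range_code by simp
qed

lemma cell_mass_measurable [measurable]: "cell_mass n \<in> borel_measurable (completion \<mu>)"
proof -
  have "cell_mass n = (\<lambda>x. \<Sum>V\<in>range (code n). indicator (code n -` {V}) x * measure (\<nu> x) (code n -` {V}))"
    using cell_sum[of n _ "\<lambda>p. p"] by auto
  moreover have "bdd_meas \<dots>" by (intro bdd_meas_intros \<nu>_bdd_meas code_cell_borel borel_sets)
  ultimately show ?thesis using bdd_meas_measurable by metis
qed

lemma point_mass_measurable [measurable]: "point_mass \<in> borel_measurable (completion \<mu>)"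
  by (rule borel_measurable_LIMSEQ_real[OF cell_mass_tendsto]) simp

text \<open>Equivariance holds almost everywhere for each fixed Borel set, which says nothing about
  the moving set \<open>{x}\<close>. It is applied to the countably many code cells, and the
  decreasing cells of \<open>T g x\<close> are then followed to the limit; \<open>T g\<close> is
  injective, so their preimages shrink to \<open>{x}\<close>.\<close>

lemma point_mass_invariant: "AE x in completion \<mu>. \<forall>g. point_mass (T g x) = point_mass x"
proof -
  have "AE x in completion \<mu>. \<forall>g n. \<forall>V\<in>range (code n). measure (\<nu> (T g x)) (code n -` {V}) = measure (\<nu> x) (T g -` code n -` {V})"
    unfolding AE_all_countable
    by (intro allI AE_finite_allI finite_range_code \<nu>_equivariant code_cell_borel)
  then show ?thesis
  proof eventually_elim
    case (elim x)
    show ?case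
    proof
      fix g
      interpret n: prob_space "\<nu> x" by (rule prob_\<nu>)
      have "(\<lambda>n. measure (\<nu> x) (T g -` code n -` {code n (T g x)})) \<longlonglongrightarrow> measure (\<nu> x) (\<Inter>n. T g -` code n -` {code n (T g x)})"
      proof (rule n.finite_Lim_measure_decseq)
        show "range (\<lambda>n. T g -` code n -` {code n (T g x)}) \<subseteq> sets (\<nu> x)"
          using T_vimage_borel code_cell_borel by (auto simp: sets_\<nu>)
        show "decseq (\<lambda>n. T g -` code n -` {code n (T g x)})"
          using cells_decseq[of "T g x"] unfolding decseq_def by blast
      qed
      moreover have "(\<Inter>n. T g -` code n -` {code n (T g x)}) = {x}"
      proof -
        have "(\<Inter>n. T g -` code n -` {code n (T g x)}) = T g -` {T g x}"
          unfolding cells_Inter[of "T g x", symmetric] by auto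
        also have "\<dots> = {x}"
        proof -
          have "y = x" if "T g y = T g x" for y
            using that T_add[of "- g" g y] T_add[of "- g" g x] by (simp add: T_0)
          then show ?thesis by auto
        qed
        finally show ?thesis .
      qed
      ultimately have "(\<lambda>n. measure (\<nu> x) (T g -` code n -` {code n (T g x)})) \<longlonglongrightarrow> point_mass x" by (simp add: point_mass_def)
      moreover have "measure (\<nu> x) (T g -` code n -` {code n (T g x)}) = cell_mass n (T g x)" for n
        using elim unfolding cell_mass_def by simp
      ultimately show "point_mass (T g x) = point_mass x" using LIMSEQ_unique[OF cell_mass_tendsto[of "T g x"]] by simp
    qed
  qed
qed

text \<open>By the defining property of \<open>\<nu>\<close>, the \<open>\<nu>\<^sub>x\<close>-mass of the cells of mass at most \<open>s\<close> has the same mean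
  as the indicator that \<open>x\<close> itself lies in such a cell, which is impossible when \<open>\<nu>\<^sub>x{x} > s\<close>.\<close>

lemma heavy_atoms:
  assumes "AE x in completion \<mu>. point_mass x > s"
  shows "AE x in completion \<mu>. \<forall>i. measure (\<nu> x) (base i) = 0 \<or> measure (\<nu> x) (base i) > s"
proof -
  have "AE x in completion \<mu>. measure (\<nu> x) (code n -` {V}) = 0 \<or> measure (\<nu> x) (code n -` {V}) > s" for n V
  proof -
    let ?B = "code n -` {V}"
    define h where "h x = (if measure (\<nu> x) ?B \<le> s then 1 else 0 :: real)" for x
    have [measurable]: "(\<lambda>x. measure (\<nu> x) ?B) \<in> borel_measurable kron_alg" by (rule \<nu>_kron_alg[OF code_cell_borel])
    have hm: "h \<in> borel_measurable kron_alg" unfolding h_def by measurable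
    have hb: "bdd_meas h" by (rule bdd_meas_kron_alg[OF hm, of 1]) (simp add: h_def)
    have "(\<integral>x. h x * measure (\<nu> x) ?B \<partial>completion \<mu>) = (\<integral>x. h x * indicator ?B x \<partial>completion \<mu>)"
      by (rule \<nu>_swap[OF code_cell_borel hm hb, symmetric])
    also have "\<dots> = 0"
    proof (rule integral_eq_zero_AE)
      show "AE x in completion \<mu>. h x * indicator ?B x = 0"
        using assms
      proof eventually_elim
        case (elim x)
        show ?case
        proof (cases "x \<in> ?B")
          case True
          then have "cell_mass n x = measure (\<nu> x) ?B" by (simp add: cell_mass_def)
          then show ?thesis using elim point_mass_le_cell_mass[of x n] by (simp add: h_def)
        qed simp
      qed
    qed
    finally have "(\<integral>x. h x * measure (\<nu> x) ?B \<partial>completion \<mu>) = 0" .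
    moreover have "integrable (completion \<mu>) (\<lambda>x. h x * measure (\<nu> x) ?B)"
      by (intro bdd_meas_integrable bdd_meas_mult hb \<nu>_bdd_meas code_cell_borel)
    moreover have "AE x in completion \<mu>. 0 \<le> h x * measure (\<nu> x) ?B" by (rule AE_I2) (simp add: h_def)
    ultimately have "AE x in completion \<mu>. h x * measure (\<nu> x) ?B = 0"
      using integral_nonneg_eq_0_iff_AE[of "completion \<mu>" "\<lambda>x. h x * measure (\<nu> x) ?B"] by simp
    then show ?thesis by eventually_elim (auto simp: h_def split: if_splits)
  qed
  then have "AE x in completion \<mu>. \<forall>n. \<forall>V\<in>range (code n). measure (\<nu> x) (code n -` {V}) = 0 \<or> measure (\<nu> x) (code n -` {V}) > s"
    unfolding AE_all_countable by (intro allI AE_finite_allI finite_range_code)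
  then show ?thesis
  proof eventually_elim
    case (elim x)
    interpret n: prob_space "\<nu> x" by (rule prob_\<nu>)
    show ?case
    proof
      fix i
      \<comment> \<open>\<open>base i\<close> is a finite union of cells of
        \<open>code (Suc i)\<close>, the first code that sees the index \<open>i\<close>.\<close>
      let ?V = "{V \<in> range (code (Suc i)). i \<in> V}"
      have fV: "finite ?V" using finite_range_code by simp
      have "base i = {y. i \<in> code (Suc i) y}" by (simp add: code_def)
      then have Ui: "base i = (\<Union>V\<in>?V. code (Suc i) -` {V})" by auto
      show "measure (\<nu> x) (base i) = 0 \<or> measure (\<nu> x) (base i) > s"
      proof (cases "\<forall>V\<in>?V. measure (\<nu> x) (code (Suc i) -` {V}) = 0")
        case True
        have "measure (\<nu> x) (base i) \<le> (\<Sum>V\<in>?V. measure (\<nu> x) (code (Suc i) -` {V}))"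
          unfolding Ui by (rule n.finite_measure_subadditive_finite[OF fV]) (auto simp: sets_\<nu> code_cell_borel)
        also have "\<dots> = 0" using True by simp
        finally show ?thesis using measure_nonneg[of "\<nu> x" "base i"] by simp
      next
        case False
        then obtain V where V: "V \<in> ?V" "measure (\<nu> x) (code (Suc i) -` {V}) \<noteq> 0" by blast
        then have "V \<in> range (code (Suc i))" by simp
        with elim V(2) have "s < measure (\<nu> x) (code (Suc i) -` {V})" by blast
        also have "\<dots> \<le> measure (\<nu> x) (base i)"
          by (rule n.finite_measure_mono) (use V base_open[of i] Ui in \<open>auto simp: sets_\<nu>\<close>)
        finally show ?thesis ..
      qed
    qed
  qed
qed

text \<open>The points of \<open>F\<close> have disjoint basic neighbourhoods. None of these is
  null, since \<open>F\<close> lies in the support, so each has mass above \<open>s\<close>.\<close>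

lemma card_msupp_less:
  assumes heavy: "\<forall>i. measure (\<nu> x) (base i) = 0 \<or> measure (\<nu> x) (base i) > s"
    and F: "finite F" "F \<subseteq> msupp (\<nu> x)" "F \<noteq> {}"
  shows "real (card F) * s < 1"
proof -
  interpret n: prob_space "\<nu> x" by (rule prob_\<nu>)
  have "\<forall>p\<in>F. \<exists>d>0. \<forall>q\<in>F. q \<noteq> p \<longrightarrow> d \<le> dist p q"
    using finite_set_avoid[OF F(1)] by blast
  then obtain d where d: "\<And>p. p \<in> F \<Longrightarrow> d p > 0" "\<And>p q. p \<in> F \<Longrightarrow> q \<in> F \<Longrightarrow> q \<noteq> p \<Longrightarrow> d p \<le> dist p q"
    by metis
  \<comment> \<open>Half the least separation, so that balls of radius \<open>e\<close> about
    distinct points of \<open>F\<close> are disjoint.\<close>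
  define e where "e = Min (d ` F) / 2"
  have e: "e > 0" unfolding e_def using d(1) F by simp
  have e2: "2 * e \<le> d p" if "p \<in> F" for p unfolding e_def using F that by simp
  have "\<forall>p. \<exists>i. p \<in> base i \<and> base i \<subseteq> ball p e" using base_nhds[OF open_ball] e by auto
  then obtain j where j: "\<And>p. p \<in> base (j p)" "\<And>p. base (j p) \<subseteq> ball p e" by metis
  have big: "s < measure (\<nu> x) (base (j p))" if "p \<in> F" for p
  proof -
    have "emeasure (\<nu> x) (base (j p)) > 0" using that F(2) j(1) base_open unfolding msupp_def by blast
    then have "measure (\<nu> x) (base (j p)) \<noteq> 0" by (simp add: n.emeasure_eq_measure)
    then show ?thesis using heavy by blast
  qed
  have "real (card F) * s = (\<Sum>p\<in>F. s)" by simp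
  also have "\<dots> < (\<Sum>p\<in>F. measure (\<nu> x) (base (j p)))"
    by (rule sum_strict_mono) (use F big in auto)
  also have "\<dots> = measure (\<nu> x) (\<Union>p\<in>F. base (j p))"
  proof (rule n.finite_measure_finite_Union[symmetric])
    show "disjoint_family_on (\<lambda>p. base (j p)) F"
      unfolding disjoint_family_on_def
    proof (intro ballI impI)
      fix p q assume pq: "p \<in> F" "q \<in> F" "p \<noteq> q"
      show "base (j p) \<inter> base (j q) = {}"
      proof (rule ccontr)
        assume "base (j p) \<inter> base (j q) \<noteq> {}"
        then obtain z where "dist p z < e" "dist q z < e" using j(2) by (auto simp: subset_iff)
        then have "dist p q < 2 * e" using dist_triangle2[of p q z] by simp
        then show False using e2[OF pq(1)] d(2)[OF pq(1,2)] pq(3) by fastforce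
      qed
    qed
  qed (use F base_open in \<open>auto simp: sets_\<nu>\<close>)
  also have "\<dots> \<le> 1" by simp
  finally show ?thesis .
qed

text \<open>By ergodicity the set of points of mass above \<open>s\<close> is null or full. Were it
  full, basic sets would be null or heavier than \<open>s\<close>, so any finite set of
  \<open>n > 0\<close> support points would satisfy \<open>n * s < 1\<close>: impossible if there
  are \<open>m\<close> of them with \<open>m * s \<ge> 1\<close>, or infinitely many.\<close>

lemma point_mass_le:
  assumes supp: "AE x in completion \<mu>. ecard (msupp (\<nu> x)) = k"
    and s: "s > 0" "\<And>m. k = enat m \<Longrightarrow> 1 \<le> real m * s"
  shows "AE x in completion \<mu>. point_mass x \<le> s"
proof -
  let ?E = "{x \<in> space (completion \<mu>). point_mass x > s}"
  have E: "?E \<in> sets (completion \<mu>)" by measurable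
  have "AE x in completion \<mu>. \<forall>g. T g x \<in> ?E \<longleftrightarrow> x \<in> ?E"
    using point_mass_invariant by eventually_elim (simp add: space_\<mu>)
  from ergodic[OF E this] show ?thesis
  proof
    assume "prob ?E = 0"
    then have "AE x in completion \<mu>. x \<notin> ?E" using E by (simp add: prob_eq_0)
    then show ?thesis by eventually_elim (simp add: space_\<mu>)
  next
    assume "prob ?E = 1"
    then have "AE x in completion \<mu>. x \<in> ?E" using AE_in_set_eq_1[OF E] by simp
    then have "AE x in completion \<mu>. point_mass x > s" by eventually_elim simp
    from heavy_atoms[OF this] supp
    have "AE x in completion \<mu>. False"
    proof eventually_elim
      case (elim x)
      let ?S = "msupp (\<nu> x)"
      show ?case
      proof (cases "finite ?S")
        case True
        then have "k = enat (card ?S)" using elim(2) by (simp add: ecard_def)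
        then show ?thesis using s(2) card_msupp_less[OF elim(1) True order_refl msupp_nonempty] by fastforce
      next
        case False
        obtain m :: nat where m: "1 / s < real m" using reals_Archimedean2 by blast
        obtain F where F: "finite F" "card F = m" "F \<subseteq> ?S" using infinite_arbitrarily_large[OF False] by blast
        have "m > 0" using m s(1) by (cases m) (auto simp: field_simps)
        then have "real m * s < 1" using card_msupp_less[OF elim(1) F(1,3)] F(2) by fastforce
        then show ?thesis using m s(1) by (simp add: field_simps)
      qed
    qed
    then show ?thesis by eventually_elim simp
  qed
qed

lemma kron_entropy_code_le: "ereal (kron_entropy (code n) (\<lambda>V x. measure (\<nu> x) (code n -` {V}))) \<le> max_seq_entropy T \<mu>"
proof -
  let ?\<alpha> = "range (\<lambda>x. code n -` {code n x})"
  have \<alpha>: "fin_partition \<mu> ?\<alpha>"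
    unfolding fin_partition_def
  proof (intro conjI)
    have "?\<alpha> = (\<lambda>V. code n -` {V}) ` range (code n)" by auto
    then show "finite ?\<alpha>" using finite_range_code by simp
    show "?\<alpha> \<subseteq> sets (completion \<mu>)" using borel_sets[OF code_cell_borel] by auto
  qed auto
  have "max_seq_entropy_part T \<mu> ?\<alpha> = ereal (kron_entropy (code n) (\<lambda>V x. measure (\<nu> x) (code n -` {V})))"
    by (rule max_seq_entropy_part_eq[OF \<alpha> _ finite_valued_code kron_version_code]) auto
  then show ?thesis unfolding max_seq_entropy_def using \<alpha> by (metis SUP_upper mem_Collect_eq)
qed

text \<open>The mean truncated information of the code partitions is a lower bound for the entropy,
  because \<open>p * \<theta> p \<le> eta p\<close>. Since cell masses decrease to point masses, it
  tends to \<open>- ln s\<close>.\<close>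

lemma max_seq_entropy_ge:
  assumes s: "0 < s" "s \<le> 1" and w: "AE x in completion \<mu>. point_mass x \<le> s"
  shows "ereal (- ln s) \<le> max_seq_entropy T \<mu>"
proof -
  \<comment> \<open>Truncating \<open>- ln\<close> at \<open>- ln s\<close> allows dominated convergence even if the point masses vanish.\<close>
  define \<theta> where "\<theta> p = - ln (max p s)" for p
  have \<theta>b: "\<bar>\<theta> p\<bar> \<le> - ln s" if "p \<le> 1" for p
  proof -
    have "ln s \<le> ln (max p s)" "ln (max p s) \<le> 0" using s that by (auto simp: max_def)
    then show ?thesis by (simp add: \<theta>_def)
  qed
  have \<theta>m [measurable]: "\<theta> \<in> borel_measurable borel" unfolding \<theta>_def by measurable
  have \<theta>c: "isCont \<theta> p" for p unfolding \<theta>_def using s by (intro continuous_intros) auto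
  have eta: "p * \<theta> p \<le> eta p" if "0 \<le> p" for p
  proof (cases "p = 0")
    case False
    then have "ln p \<le> ln (max p s)" using that s by (subst ln_le_cancel_iff) auto
    then show ?thesis using that by (simp add: \<theta>_def eta_def mult_left_mono)
  qed simp
  have \<theta>\<nu>: "(\<lambda>x. \<theta> (measure (\<nu> x) (code n -` {V}))) \<in> borel_measurable kron_alg" for n V
    by (rule measurable_compose[OF \<nu>_kron_alg[OF code_cell_borel] \<theta>m])
  have \<theta>\<nu>b: "bdd_meas (\<lambda>x. \<theta> (measure (\<nu> x) (code n -` {V})))" for n V
    by (rule bdd_meas_kron_alg[OF \<theta>\<nu>]) (rule \<theta>b, rule \<nu>_le_1)
  have le: "ereal (\<integral>x. \<theta> (cell_mass n x) \<partial>completion \<mu>) \<le> max_seq_entropy T \<mu>" for n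
  proof -
    let ?C = "\<lambda>V. code n -` {V}"
    have "(\<integral>x. \<theta> (cell_mass n x) \<partial>completion \<mu>) =
        (\<integral>x. (\<Sum>V\<in>range (code n). \<theta> (measure (\<nu> x) (?C V)) * indicator (?C V) x) \<partial>completion \<mu>)"
      unfolding cell_sum[of n _ \<theta>, symmetric] by (simp add: mult.commute)
    also have "\<dots> = (\<Sum>V\<in>range (code n). \<integral>x. \<theta> (measure (\<nu> x) (?C V)) * indicator (?C V) x \<partial>completion \<mu>)"
      by (intro Bochner_Integration.integral_sum bdd_meas_integrable bdd_meas_mult \<theta>\<nu>b bdd_meas_indicator borel_sets code_cell_borel)
    \<comment> \<open>Averaging the indicator of the cell over \<nu> x turns the information at
      \<open>x\<close> into the fibre sum of \<open>p * \<theta> p\<close>.\<close>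
    also have "\<dots> = (\<Sum>V\<in>range (code n). \<integral>x. \<theta> (measure (\<nu> x) (?C V)) * measure (\<nu> x) (?C V) \<partial>completion \<mu>)"
      by (intro sum.cong refl \<nu>_swap code_cell_borel \<theta>\<nu> \<theta>\<nu>b)
    also have "\<dots> \<le> (\<Sum>V\<in>range (code n). \<integral>x. eta (measure (\<nu> x) (?C V)) \<partial>completion \<mu>)"
    proof (intro sum_mono integral_mono)
      fix V assume V: "V \<in> range (code n)"
      show "integrable (completion \<mu>) (\<lambda>x. \<theta> (measure (\<nu> x) (?C V)) * measure (\<nu> x) (?C V))"
        by (intro bdd_meas_integrable bdd_meas_mult \<theta>\<nu>b \<nu>_bdd_meas code_cell_borel)
      show "integrable (completion \<mu>) (\<lambda>x. eta (measure (\<nu> x) (?C V)))"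
        by (rule bdd_meas_integrable[OF eta_u_bdd_meas[OF finite_valued_code kron_version_code V]])
    qed (use eta in \<open>simp add: mult.commute\<close>)
    also have "\<dots> = kron_entropy (code n) (\<lambda>V x. measure (\<nu> x) (?C V))"
      unfolding kron_entropy_def by (rule Bochner_Integration.integral_sum[symmetric])
        (rule bdd_meas_integrable[OF eta_u_bdd_meas[OF finite_valued_code kron_version_code]])
    finally have "ereal (\<integral>x. \<theta> (cell_mass n x) \<partial>completion \<mu>) \<le> ereal (kron_entropy (code n) (\<lambda>V x. measure (\<nu> x) (?C V)))" by simp
    also have "\<dots> \<le> max_seq_entropy T \<mu>" by (rule kron_entropy_code_le)
    finally show ?thesis .
  qed
  have "(\<lambda>n. \<integral>x. \<theta> (cell_mass n x) \<partial>completion \<mu>) \<longlonglongrightarrow> (\<integral>x. - ln s \<partial>completion \<mu>)"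
  proof (rule integral_dominated_convergence[where w = "\<lambda>_. - ln s"])
    show "AE x in completion \<mu>. (\<lambda>n. \<theta> (cell_mass n x)) \<longlonglongrightarrow> - ln s"
      using w
    proof eventually_elim
      case (elim x)
      have "(\<lambda>n. \<theta> (cell_mass n x)) \<longlonglongrightarrow> \<theta> (point_mass x)" by (rule isCont_tendsto_compose[OF \<theta>c cell_mass_tendsto])
      moreover have "\<theta> (point_mass x) = - ln s" using elim by (simp add: \<theta>_def max_def)
      ultimately show ?case by simp
    qed
    show "AE x in completion \<mu>. norm (\<theta> (cell_mass n x)) \<le> - ln s" for n
      using \<theta>b \<nu>_le_1 by (intro AE_I2) (simp add: cell_mass_def)
    show "(\<lambda>x. \<theta> (cell_mass n x)) \<in> borel_measurable (completion \<mu>)" for n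
      by (rule measurable_compose[OF cell_mass_measurable \<theta>m])
  qed auto
  then have "(\<lambda>n. \<integral>x. \<theta> (cell_mass n x) \<partial>completion \<mu>) \<longlonglongrightarrow> - ln s" using prob_space by simp
  then have "(\<lambda>n. ereal (\<integral>x. \<theta> (cell_mass n x) \<partial>completion \<mu>)) \<longlonglongrightarrow> ereal (- ln s)" by (rule tendsto_ereal)
  then show ?thesis by (rule LIMSEQ_le_const2) (use le in blast)
qed

theorem max_seq_entropy_eq_log_card:
  assumes supp: "AE x in completion \<mu>. ecard (msupp (\<nu> x)) = k"
  shows "max_seq_entropy T \<mu> = log_enat k"
proof (cases k)
  case (enat m)
  \<comment> \<open>The claim does not depend on \<open>x\<close>, so in a probability space its
    validity almost everywhere makes it true.\<close>
  have "AE x in completion \<mu>. m \<ge> 1"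
    using supp
  proof eventually_elim
    case (elim x)
    then have "finite (msupp (\<nu> x))" "card (msupp (\<nu> x)) = m"
      unfolding enat by (auto simp: ecard_def split: if_splits)
    then show ?case using msupp_nonempty[of x] by (metis One_nat_def Suc_leI card_gt_0_iff)
  qed
  then have m: "m \<ge> 1" by simp
  have "ereal (- ln (1 / real m)) \<le> max_seq_entropy T \<mu>"
    by (intro max_seq_entropy_ge point_mass_le[OF supp]) (use m enat in auto)
  then have "ereal (ln (real m)) \<le> max_seq_entropy T \<mu>" using m by (simp add: ln_div)
  moreover have "max_seq_entropy T \<mu> \<le> ereal (ln (real m))"
    unfolding max_seq_entropy_def
    by (rule SUP_least) (use max_seq_entropy_part_le supp[unfolded enat] in blast)
  ultimately show ?thesis by (simp add: log_enat_def enat)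
next
  case infinity
  have "ereal r \<le> max_seq_entropy T \<mu>" for r
  proof -
    \<comment> \<open>The maximum with 0 keeps \<open>?s\<close> at most 1; for infinite
      \<open>k\<close> the condition on \<open>enat m\<close> is vacuous, so \<open>?s\<close> may
      be arbitrarily small.\<close>
    let ?s = "exp (- max r 0)"
    have "ereal (- ln ?s) \<le> max_seq_entropy T \<mu>"
      by (intro max_seq_entropy_ge point_mass_le[OF supp]) (use infinity in auto)
    moreover have "ereal r \<le> ereal (- ln ?s)" by simp
    ultimately show ?thesis by (rule order_trans[rotated])
  qed
  then have "max_seq_entropy T \<mu> = \<infinity>" by (rule ereal_top)
  then show ?thesis by (simp add: log_enat_def infinity)
qed

end

theorem theorem2p9:
  fixes T :: "'g::{group_add, countable} \<Rightarrow> 'a::metric_space \<Rightarrow> 'a"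
    and \<mu> :: "'a measure" and \<nu> :: "'a \<Rightarrow> 'a measure" and k :: enat
  assumes "compact (UNIV :: 'a set)"
    and "infinite (UNIV :: 'g set)"
    and "meas_action T"
    and "invariant_ergodic T \<mu>"
    and "kronecker_disintegration T \<mu> \<nu>"
    and "AE x in completion \<mu>. ecard (msupp (\<nu> x)) = k"
  shows "max_seq_entropy T \<mu> = log_enat k"
proof -
  interpret kronecker_system T \<mu> \<nu> by unfold_locales (use assms in auto)
  show ?thesis by (rule max_seq_entropy_eq_log_card) (use assms in auto)
qed

end
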